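(* Assume the setting and Assumption (A1) of the context, and let $\mathcal F$ be a pointwise measurable class of real functions on $\mathcal Y$ satisfying condition (A3') of the context for some $\beta\in\mathbb R$. Let $\mathbb G$ be the centered Gaussian process on $\mathcal F$ with covariance kernel $K(f_1,f_2)=\sum_{i=1}^k\lambda_i\mathrm{Cov}(\sum_{\ell=1}^{N_{\mathbf 1}}f_1(Y_{\ell,\mathbf 1}),\sum_{\ell=1}^{N_{\mathbf 2_i}}f_2(Y_{\ell,\mathbf 2_i}))$. Then $$\sup_{h\in\mathrm{BL}_1}\Big|E\big(h(\mathbb G^*_C)\,\big|\,(N_{\mathbf j},(Y_{\ell,\mathbf j})_{\ell\ge1})_{\mathbf j\ge\mathbf 1}\big)-E(h(\mathbb G))\Big|\to0$$ in probability as $\underline C\to\infty$, where $\mathrm{BL}_1$ is the set of functions $\ell^\infty(\mathcal F)\to\mathbb R$ bounded by $1$ and $1$-Lipschitz.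
   Context: Fix $k,l\ge1$, $\mathcal Y\subset\mathbb R^l$. Cells $\mathbf j\in(\mathbb N^* )^k$, componentwise order $\le$, $\mathbf 1=(1,\dots,1)$, $\mathbf 2_i$ = $k$-tuple with $1$ in position $i$ and $2$ elsewhere. Data array $(N_{\mathbf j},(Y_{\ell,\mathbf j})_{\ell\ge1})_{\mathbf j\ge\mathbf 1}$, $N_{\mathbf j}\in\mathbb N$, $Y_{\ell,\mathbf j}\in\mathcal Y$. $\mathbf C=(C_1,\dots,C_k)$, $\underline C=\min_iC_i$, $\Pi_C=\prod_iC_i$. Assumption (A1): (i) separate exchangeability: for any permutations $\pi_1,\dots,\pi_k$ of $\mathbb N^*$ the array has the same joint law as the array with cell $\mathbf j$ replaced by cell $(\pi_1(j_1),\dots,\pi_k(j_k))$; (ii) for any $\mathbf c\ge\mathbf 1$, the cells $\mathbf 1\le\mathbf j\le\mathbf c$ are jointly independent of the cells $\mathbf j'\ge\mathbf c+\mathbf 1$; (iii) $E(N_{\mathbf 1})>0$; (iv) cells $\mathbf 1\le\mathbf j\le\mathbf C$ are observed, asymptotics $\underline C\to\infty$ with $\underline C/C_i\to\lambda_i\ge0$. Pointwise measurable, envelope, $\|f\|_{\infty,\beta}=\sup_{y\in\mathcal Y}|f(y)(1+|y|^2)^{\beta/2}|$ and covering numbers $N(\varepsilon,\mathcal F,\|\cdot\|_{\infty,\beta})$ (minimal number of closed radius-$\varepsilon$ balls centered in $\mathcal F$ covering $\mathcal F$) as usual. Condition (A3'): an envelope $F$ with $\|F\|_{\infty,\beta}<\infty$,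 $E[(\sum_{\ell=1}^{N_{\mathbf 1}}(1+|Y_{\ell,\mathbf 1}|^2)^{-\beta/2})^2]<\infty$ and $\int_0^\infty\sqrt{\log N(\varepsilon\|F\|_{\infty,\beta},\mathcal F,\|\cdot\|_{\infty,\beta})}d\varepsilon<\infty$. Pigeonhole bootstrap: independently for each $i$ and of the data, draw $C_i$ elements with replacement and equal probability from $\{1,\dots,C_i\}$; $W^i_j$ = number of times $j$ is drawn; $W_{\mathbf j}=\prod_iW^i_{j_i}$; $\mathbb G^*_Cf=\frac{\sqrt{\underline C}}{\Pi_C}\sum_{\mathbf 1\le\mathbf j\le\mathbf C}(W_{\mathbf j}-1)\sum_{\ell=1}^{N_{\mathbf j}}f(Y_{\ell,\mathbf j})$. *)

theory Defs
  imports "HOL-Probability.Probability"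
begin

definition Cells :: "('k \<Rightarrow> nat) set" where
  "Cells = {j. \<forall>i. 1 \<le> j i}"

definition one_cell :: "'k \<Rightarrow> nat" where
  "one_cell = (\<lambda>_. 1)"

definition two_cell :: "'k \<Rightarrow> 'k \<Rightarrow> nat" where
  "two_cell i = (\<lambda>i'. if i' = i then 1 else 2)"

definition obs_cells :: "('k \<Rightarrow> nat) \<Rightarrow> ('k \<Rightarrow> nat) set" where
  "obs_cells C = {j. \<forall>i. 1 \<le> j i \<and> j i \<le> C i}"

definition minC :: "('k::finite \<Rightarrow> nat) \<Rightarrow> nat" where
  "minC C = Min (range C)"

definition prodC :: "('k::finite \<Rightarrow> nat) \<Rightarrow> nat" where
  "prodC C = (\<Prod>i\<in>UNIV. C i)"

definition cellspace :: "(nat \<times> (nat \<Rightarrow> 'v::topological_space)) measure" where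
  "cellspace = count_space UNIV \<Otimes>\<^sub>M (\<Pi>\<^sub>M l\<in>UNIV. borel)"

definition arr :: "(('k \<Rightarrow> nat) \<Rightarrow> 'a \<Rightarrow> nat) \<Rightarrow> (nat \<Rightarrow> ('k \<Rightarrow> nat) \<Rightarrow> 'a \<Rightarrow> 'v)
     \<Rightarrow> 'a \<Rightarrow> ('k \<Rightarrow> nat) \<Rightarrow> nat \<times> (nat \<Rightarrow> 'v)" where
  "arr N Y \<omega> = (\<lambda>j\<in>Cells. (N j \<omega>, \<lambda>l. Y l j \<omega>))"

definition cellsum :: "(('k \<Rightarrow> nat) \<Rightarrow> 'a \<Rightarrow> nat) \<Rightarrow> (nat \<Rightarrow> ('k \<Rightarrow> nat) \<Rightarrow> 'a \<Rightarrow> 'v)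
     \<Rightarrow> ('v \<Rightarrow> real) \<Rightarrow> ('k \<Rightarrow> nat) \<Rightarrow> 'a \<Rightarrow> real" where
  "cellsum N Y f j \<omega> = (\<Sum>l=1..N j \<omega>. f (Y l j \<omega>))"

definition A1 :: "'a measure \<Rightarrow> (('k::finite \<Rightarrow> nat) \<Rightarrow> 'a \<Rightarrow> nat)
     \<Rightarrow> (nat \<Rightarrow> ('k \<Rightarrow> nat) \<Rightarrow> 'a \<Rightarrow> 'v::topological_space) \<Rightarrow> bool" where
  "A1 M N Y \<longleftrightarrow>
     (\<forall>\<pi>::'k \<Rightarrow> nat \<Rightarrow> nat. (\<forall>i. bij_betw (\<pi> i) {1..} {1..}) \<longrightarrow>
        distr M (\<Pi>\<^sub>M j\<in>Cells. cellspace) (arr N Y)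
        = distr M (\<Pi>\<^sub>M j\<in>Cells. cellspace) (\<lambda>\<omega>. \<lambda>j\<in>Cells. arr N Y \<omega> (\<lambda>i. \<pi> i (j i))))
   \<and> (\<forall>c::'k \<Rightarrow> nat. (\<forall>i. 1 \<le> c i) \<longrightarrow>
        prob_space.indep_var M
          (\<Pi>\<^sub>M j\<in>obs_cells c. cellspace) (\<lambda>\<omega>. restrict (arr N Y \<omega>) (obs_cells c))
          (\<Pi>\<^sub>M j\<in>{j. \<forall>i. c i + 1 \<le> j i}. cellspace)
          (\<lambda>\<omega>. restrict (arr N Y \<omega>) {j. \<forall>i. c i + 1 \<le> j i}))
   \<and> (\<integral>\<^sup>+ \<omega>. ennreal (real (N one_cell \<omega>)) \<partial>M) > 0"

definition pointwise_measurable :: "'v set \<Rightarrow> ('v \<Rightarrow> real) set \<Rightarrow> bool" where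
  "pointwise_measurable Ys F \<longleftrightarrow>
     (\<exists>G. countable G \<and> G \<subseteq> F \<and>
        (\<forall>f\<in>F. \<exists>g::nat \<Rightarrow> 'v \<Rightarrow> real. (\<forall>m. g m \<in> G) \<and>
            (\<forall>y\<in>Ys. (\<lambda>m. g m y) \<longlonglongrightarrow> f y)))"

definition wnorm :: "real \<Rightarrow> 'v::real_normed_vector set \<Rightarrow> ('v \<Rightarrow> real) \<Rightarrow> ereal" where
  "wnorm \<beta> Ys f = (SUP y\<in>Ys. ereal (\<bar>f y\<bar> * (1 + (norm y)\<^sup>2) powr (\<beta>/2)))"

definition covnum :: "real \<Rightarrow> 'v::real_normed_vector set \<Rightarrow> ('v \<Rightarrow> real) set \<Rightarrow> real \<Rightarrow> enat" where
  "covnum \<beta> Ys F \<epsilon> = Inf {enat (card S) | S. finite S \<and> S \<subseteq> F \<and>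
       (\<forall>f\<in>F. \<exists>s\<in>S. wnorm \<beta> Ys (\<lambda>y. f y - s y) \<le> ereal \<epsilon>)}"

definition sqrtlog :: "enat \<Rightarrow> ennreal" where
  "sqrtlog n = (case n of enat m \<Rightarrow> ennreal (sqrt (ln (real m))) | \<infinity> \<Rightarrow> \<infinity>)"

definition A3' :: "'a measure \<Rightarrow> (('k \<Rightarrow> nat) \<Rightarrow> 'a \<Rightarrow> nat)
     \<Rightarrow> (nat \<Rightarrow> ('k \<Rightarrow> nat) \<Rightarrow> 'a \<Rightarrow> 'v::real_normed_vector) \<Rightarrow> 'v set
     \<Rightarrow> ('v \<Rightarrow> real) set \<Rightarrow> real \<Rightarrow> bool" where
  "A3' M N Y Ys F \<beta> \<longleftrightarrow>
     (\<exists>Fe. (\<forall>f\<in>F. \<forall>y\<in>Ys. \<bar>f y\<bar> \<le> Fe y) \<and> wnorm \<beta> Ys Fe < \<infinity> \<and>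
        (\<integral>\<^sup>+ \<omega>. ennreal ((\<Sum>l=1..N one_cell \<omega>. (1 + (norm (Y l one_cell \<omega>))\<^sup>2) powr (-\<beta>/2))\<^sup>2) \<partial>M) < \<infinity> \<and>
        (\<integral>\<^sup>+ \<epsilon>\<in>{0<..}. sqrtlog (covnum \<beta> Ys F (\<epsilon> * real_of_ereal (wnorm \<beta> Ys Fe))) \<partial>lborel) < \<infinity>)"

definition cov :: "'a measure \<Rightarrow> ('a \<Rightarrow> real) \<Rightarrow> ('a \<Rightarrow> real) \<Rightarrow> real" where
  "cov M X Z = (\<integral>\<omega>. X \<omega> * Z \<omega> \<partial>M) - (\<integral>\<omega>. X \<omega> \<partial>M) * (\<integral>\<omega>. Z \<omega> \<partial>M)"

definition Kcov :: "'a measure \<Rightarrow> (('k::finite \<Rightarrow> nat) \<Rightarrow> 'a \<Rightarrow> nat)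
     \<Rightarrow> (nat \<Rightarrow> ('k \<Rightarrow> nat) \<Rightarrow> 'a \<Rightarrow> 'v) \<Rightarrow> ('k \<Rightarrow> real)
     \<Rightarrow> ('v \<Rightarrow> real) \<Rightarrow> ('v \<Rightarrow> real) \<Rightarrow> real" where
  "Kcov M N Y lam f1 f2 =
     (\<Sum>i\<in>UNIV. lam i * cov M (cellsum N Y f1 one_cell) (cellsum N Y f2 (two_cell i)))"

definition linf :: "('v \<Rightarrow> real) set \<Rightarrow> (('v \<Rightarrow> real) \<Rightarrow> real) set" where
  "linf F = {z. bdd_above ((\<lambda>f. \<bar>z f\<bar>) ` F)}"

definition supdist :: "('v \<Rightarrow> real) set \<Rightarrow> (('v \<Rightarrow> real) \<Rightarrow> real) \<Rightarrow> (('v \<Rightarrow> real) \<Rightarrow> real) \<Rightarrow> real" where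
  "supdist F z z' = Sup (insert 0 ((\<lambda>f. \<bar>z f - z' f\<bar>) ` F))"

definition BL1 :: "('v \<Rightarrow> real) set \<Rightarrow> ((('v \<Rightarrow> real) \<Rightarrow> real) \<Rightarrow> real) set" where
  "BL1 F = {h. (\<forall>z\<in>linf F. \<bar>h z\<bar> \<le> 1) \<and>
               (\<forall>z\<in>linf F. \<forall>z'\<in>linf F. \<bar>h z - h z'\<bar> \<le> supdist F z z')}"

definition linf_compact :: "('v \<Rightarrow> real) set \<Rightarrow> (('v \<Rightarrow> real) \<Rightarrow> real) set \<Rightarrow> bool" where
  "linf_compact F K \<longleftrightarrow> K \<subseteq> linf F \<and>
     (\<forall>s::nat \<Rightarrow> ('v \<Rightarrow> real) \<Rightarrow> real. (\<forall>n. s n \<in> K) \<longrightarrow>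
        (\<exists>r z. strict_mono r \<and> z \<in> K \<and> (\<lambda>n. supdist F (s (r n)) z) \<longlonglongrightarrow> 0))"

definition centered_normal :: "'b measure \<Rightarrow> ('b \<Rightarrow> real) \<Rightarrow> real \<Rightarrow> bool" where
  "centered_normal P X v \<longleftrightarrow> v \<ge> 0 \<and>
     distr P borel X = (if v = 0 then return borel 0 else density lborel (normal_density 0 (sqrt v)))"

definition tight_gaussian :: "'b measure \<Rightarrow> ('b \<Rightarrow> ('v \<Rightarrow> real) \<Rightarrow> real)
     \<Rightarrow> ('v \<Rightarrow> real) set \<Rightarrow> (('v \<Rightarrow> real) \<Rightarrow> ('v \<Rightarrow> real) \<Rightarrow> real) \<Rightarrow> bool" where
  "tight_gaussian P G F K \<longleftrightarrow> prob_space P \<and>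
     (\<forall>f\<in>F. (\<lambda>\<omega>. G \<omega> f) \<in> borel_measurable P) \<and>
     (\<forall>S a. finite S \<and> S \<subseteq> F \<longrightarrow>
        centered_normal P (\<lambda>\<omega>. \<Sum>f\<in>S. a f * G \<omega> f) (\<Sum>f\<in>S. \<Sum>g\<in>S. a f * a g * K f g)) \<and>
     (\<forall>\<omega>\<in>space P. G \<omega> \<in> linf F) \<and>
     (\<forall>h\<in>BL1 F. (\<lambda>\<omega>. h (G \<omega>)) \<in> borel_measurable P) \<and>
     (\<forall>\<epsilon>>0. \<exists>K'. linf_compact F K' \<and> {\<omega>\<in>space P. G \<omega> \<in> K'} \<in> sets P \<and>
        measure P {\<omega>\<in>space P. G \<omega> \<in> K'} \<ge> 1 - \<epsilon>)"

definition draws :: "('k::finite \<Rightarrow> nat) \<Rightarrow> ('k \<Rightarrow> nat \<Rightarrow> nat) set" where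
  "draws C = (\<Pi>\<^sub>E i\<in>UNIV. \<Pi>\<^sub>E m\<in>{1..C i}. {1..C i})"

definition Wt :: "('k::finite \<Rightarrow> nat) \<Rightarrow> ('k \<Rightarrow> nat \<Rightarrow> nat) \<Rightarrow> ('k \<Rightarrow> nat) \<Rightarrow> real" where
  "Wt C D j = (\<Prod>i\<in>UNIV. real (card {m\<in>{1..C i}. D i m = j i}))"

definition Gstar :: "('k::finite \<Rightarrow> nat) \<Rightarrow> (('k \<Rightarrow> nat) \<Rightarrow> 'a \<Rightarrow> nat)
     \<Rightarrow> (nat \<Rightarrow> ('k \<Rightarrow> nat) \<Rightarrow> 'a \<Rightarrow> 'v) \<Rightarrow> ('k \<Rightarrow> nat \<Rightarrow> nat) \<Rightarrow> 'a \<Rightarrow> ('v \<Rightarrow> real) \<Rightarrow> real" where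
  "Gstar C N Y D \<omega> f = sqrt (real (minC C)) / real (prodC C) *
     (\<Sum>j\<in>obs_cells C. (Wt C D j - 1) * cellsum N Y f j \<omega>)"

(* E(h(G*_C) | data): expectation over the bootstrap draws only *)
definition boot_exp :: "('k::finite \<Rightarrow> nat) \<Rightarrow> (('k \<Rightarrow> nat) \<Rightarrow> 'a \<Rightarrow> nat)
     \<Rightarrow> (nat \<Rightarrow> ('k \<Rightarrow> nat) \<Rightarrow> 'a \<Rightarrow> 'v) \<Rightarrow> ((('v \<Rightarrow> real) \<Rightarrow> real) \<Rightarrow> real) \<Rightarrow> 'a \<Rightarrow> real" where
  "boot_exp C N Y h \<omega> = measure_pmf.expectation (pmf_of_set (draws C)) (\<lambda>D. h (Gstar C N Y D \<omega>))"

definition outer_prob :: "'a measure \<Rightarrow> 'a set \<Rightarrow> real" where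
  "outer_prob M A = Inf (measure M ` {B\<in>sets M. A \<subseteq> B})"

end

(*
  Write W_j - 1 as the sum, over nonempty sets A of coordinates, of the products over i in A of the
  centred weights W^i_{j_i} - 1.  The components with at least two factors vanish in mean square.
  Equicontinuity: conditionally on the data and on all draws but those of one i in A, each component
  is a one-dimensional multinomial bootstrap of row sums that are Lipschitz in f with respect to the
  weighted sup norm; symmetrization and Rademacher chaining bound its modulus by the tail of the
  entropy series times a square-integrable random factor, so no representation theorem for
  exchangeable arrays is needed.
  Finite-dimensional laws: after truncation, the components with a single factor have conditional
  characteristic functions that are products of n-th powers, and their conditional variances converge
  by a law of large numbers which uses that four cells with pairwise distinct coordinates are
  independent in pairs.  Uniformity over bounded Lipschitz functions comes from Gaussian smoothing: the
  smoothed densities are Fourier integrals of the characteristic functions, and they converge in L1.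
  The Gaussian limit itself is only approximated through the compact sets given by tightness.
*)
theory Submission
  imports Defs
begin

subsection \<open>Averages over finite sets\<close>

text \<open>Suprema over F and over the bounded Lipschitz functionals are never integrated over the
  data. The bootstrap draws form a finite set, so a conditional expectation is a plain finite
  average \<open>avg\<close>, computed at each fixed data point. There a supremum over F is bounded
  by a measurable function of the data alone, and the final exceptional set is covered by two
  measurable events that do not depend on the functional; this is what outer probability asks for.
  Characteristic functions are shown to converge in mean over the data at each fixed frequency,
  because convergence in mean can be integrated over all frequencies by Fubini's theorem and
  dominated convergence. One finite subset of F has to serve both processes: chaining compares f
  with its net point, tightness compares f with a representative along a compact set of paths. A
  common refinement of the two partitions reconciles them, at the cost of doubling the bootstrap
  modulus.\<close>

definition avg :: "'c set \<Rightarrow> ('c \<Rightarrow> 'b) \<Rightarrow> 'b::real_normed_field" where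
  "avg A g = (\<Sum>a\<in>A. g a) / of_nat (card A)"

lemma avg_cong: "(\<And>a. a \<in> A \<Longrightarrow> f a = g a) \<Longrightarrow> avg A f = avg A g"
  by (simp add: avg_def)

lemma avg_mono:
  fixes f g :: "'c \<Rightarrow> real"
  shows "(\<And>a. a \<in> A \<Longrightarrow> f a \<le> g a) \<Longrightarrow> avg A f \<le> avg A g"
  by (auto simp: avg_def intro!: divide_right_mono sum_mono)

lemma avg_nonneg:
  fixes f :: "'c \<Rightarrow> real"
  shows "(\<And>a. a \<in> A \<Longrightarrow> 0 \<le> f a) \<Longrightarrow> 0 \<le> avg A f"
  by (auto simp: avg_def intro!: divide_nonneg_nonneg sum_nonneg)

lemma avg_const: "finite A \<Longrightarrow> A \<noteq> {} \<Longrightarrow> avg A (\<lambda>_. c) = c"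
  by (simp add: avg_def)

lemma avg_zero [simp]: "avg A (\<lambda>_. 0) = 0"
  by (simp add: avg_def)

lemma avg_add: "avg A (\<lambda>a. f a + g a) = avg A f + avg A g"
  by (simp add: avg_def sum.distrib add_divide_distrib)

lemma avg_diff: "avg A (\<lambda>a. f a - g a) = avg A f - avg A g"
  by (simp add: avg_def sum_subtractf diff_divide_distrib)

lemma avg_mult_left: "avg A (\<lambda>a. c * f a) = c * avg A f"
  by (simp add: avg_def sum_distrib_left)

lemma avg_mult_right: "avg A (\<lambda>a. f a * c) = avg A f * c"
  by (simp add: avg_def sum_distrib_right)

lemma avg_sum: "avg A (\<lambda>a. \<Sum>b\<in>B. f a b) = (\<Sum>b\<in>B. avg A (\<lambda>a. f a b))"
  unfolding avg_def by (subst sum.swap) (simp add: sum_divide_distrib)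

lemma avg_commute: "avg A (\<lambda>a. avg B (\<lambda>b. f a b)) = avg B (\<lambda>b. avg A (\<lambda>a. f a b))"
  unfolding avg_def sum_divide_distrib [symmetric]
  by (subst sum.swap) (simp add: mult.commute)

lemma avg_Times: "avg (A \<times> B) (\<lambda>(a, b). f a b) = avg A (\<lambda>a. avg B (f a))"
  by (simp add: avg_def sum.cartesian_product sum_divide_distrib [symmetric] card_cartesian_product)

lemma norm_avg_le: "norm (avg A f) \<le> avg A (\<lambda>a. norm (f a))"
  by (simp add: avg_def norm_divide divide_right_mono norm_sum)

lemma avg_le_bound:
  fixes f :: "'c \<Rightarrow> real"
  assumes "finite A" "A \<noteq> {}" "\<And>a. a \<in> A \<Longrightarrow> f a \<le> c"
  shows "avg A f \<le> c"
  using avg_mono[of A f "\<lambda>_. c"] assms by (simp add: avg_const)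

lemma avg_square_le:
  fixes f :: "'c \<Rightarrow> real"
  assumes "finite A" "A \<noteq> {}"
  shows "(avg A f)\<^sup>2 \<le> avg A (\<lambda>a. (f a)\<^sup>2)"
proof -
  have "0 \<le> avg A (\<lambda>a. (f a - avg A f)\<^sup>2)"
    by (rule avg_nonneg) simp
  also have "avg A (\<lambda>a. (f a - avg A f)\<^sup>2)
      = avg A (\<lambda>a. (f a)\<^sup>2) - avg A (\<lambda>a. (2 * avg A f) * f a) + avg A (\<lambda>_. (avg A f)\<^sup>2)"
    unfolding avg_diff[symmetric] avg_add[symmetric]
    by (rule avg_cong) (simp add: power2_eq_square algebra_simps)
  also have "\<dots> = avg A (\<lambda>a. (f a)\<^sup>2) - (avg A f)\<^sup>2"
    unfolding avg_mult_left avg_const[OF assms] by (simp add: power2_eq_square)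
  finally show ?thesis by simp
qed

lemma avg_sqrt_le:
  fixes f :: "'c \<Rightarrow> real"
  assumes "finite A" "A \<noteq> {}" "\<And>a. a \<in> A \<Longrightarrow> 0 \<le> f a"
  shows "avg A (\<lambda>a. sqrt (f a)) \<le> sqrt (avg A f)"
proof (rule real_le_rsqrt)
  have "(avg A (\<lambda>a. sqrt (f a)))\<^sup>2 \<le> avg A (\<lambda>a. (sqrt (f a))\<^sup>2)"
    by (rule avg_square_le) (use assms in auto)
  also have "\<dots> = avg A f"
    by (rule avg_cong) (use assms in auto)
  finally show "(avg A (\<lambda>a. sqrt (f a)))\<^sup>2 \<le> avg A f" .
qed

lemma avg_abs_le_sqrt:
  fixes f :: "'c \<Rightarrow> real"
  assumes "finite A" "A \<noteq> {}"
  shows "avg A (\<lambda>a. \<bar>f a\<bar>) \<le> sqrt (avg A (\<lambda>a. (f a)\<^sup>2))"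
  using avg_sqrt_le[OF assms, of "\<lambda>a. (f a)\<^sup>2"] by simp

lemma avg_bij: "bij_betw h A B \<Longrightarrow> avg A (\<lambda>a. f (h a)) = avg B f"
  unfolding avg_def by (simp add: sum.reindex_bij_betw[of h A B f] bij_betw_same_card)

lemma avg_PiE_prod:
  fixes f :: "'i \<Rightarrow> 'c \<Rightarrow> 'b::real_normed_field"
  assumes "finite I" "\<And>i. i \<in> I \<Longrightarrow> finite (B i)"
  shows "avg (PiE I B) (\<lambda>g. \<Prod>i\<in>I. f i (g i)) = (\<Prod>i\<in>I. avg (B i) (f i))"
  using assms by (simp add: avg_def prod_sum_PiE card_PiE prod_dividef)

text \<open>The map sending (D, e) to (D(i := e), D i) is an involution of the product set. This
  identity is the form that conditioning on all draws except the i-th takes below.\<close>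

lemma avg_PiE_resample:
  assumes i: "i \<in> I" and fin: "finite (B i)" and ne: "B i \<noteq> {}"
  shows "avg (PiE I B) (\<lambda>D. avg (B i) (\<lambda>e. g (D(i := e)))) = avg (PiE I B) g"
proof -
  have "avg (PiE I B) (\<lambda>D. avg (B i) (\<lambda>e. g (D(i := e))))
      = avg (PiE I B \<times> B i) (\<lambda>(D, e). g (D(i := e)))"
    by (rule avg_Times[symmetric])
  also have "\<dots> = avg (PiE I B \<times> B i) (\<lambda>(D, e). g D)"
    unfolding avg_def
    by (intro arg_cong2[where f="(/)"] refl
        sum.reindex_bij_witness[where i="\<lambda>(D, e). (D(i := e), D i)" and j="\<lambda>(D, e). (D(i := e), D i)"])
       (use i in \<open>auto simp: PiE_iff extensional_def\<close>)
  also have "\<dots> = avg (PiE I B) g"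
    unfolding avg_Times by (simp add: avg_const[OF fin ne])
  finally show ?thesis .
qed

lemma avg_PiE_coord:
  fixes f :: "'c \<Rightarrow> 'b::real_normed_field"
  assumes "finite I" "i \<in> I" "\<And>i. i \<in> I \<Longrightarrow> finite (B i)" "\<And>i. i \<in> I \<Longrightarrow> B i \<noteq> {}"
  shows "avg (PiE I B) (\<lambda>g. f (g i)) = avg (B i) f"
proof -
  have "avg (PiE I B) (\<lambda>g. f (g i)) = avg (PiE I B) (\<lambda>D. avg (B i) (\<lambda>e. f ((D(i := e)) i)))"
    by (rule avg_PiE_resample[symmetric]) (use assms in auto)
  also have "\<dots> = avg (B i) f"
    using assms by (simp add: avg_const finite_PiE PiE_eq_empty_iff)
  finally show ?thesis .
qed

lemma avg_PiE_mean_zero: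
  fixes f :: "'c \<Rightarrow> 'b::real_normed_field"
  assumes "finite I" "i \<in> I" "j \<in> I" "i \<noteq> j"
    and fin: "\<And>i. i \<in> I \<Longrightarrow> finite (B i)" and ne: "\<And>i. i \<in> I \<Longrightarrow> B i \<noteq> {}"
    and f: "avg (B i) f = 0"
  shows "avg (PiE I B) (\<lambda>g. f (g i) * h (g j)) = 0"
proof -
  have "avg (PiE I B) (\<lambda>g. f (g i) * h (g j))
      = avg (PiE I B) (\<lambda>D. avg (B i) (\<lambda>e. f ((D(i := e)) i) * h ((D(i := e)) j)))"
    by (rule avg_PiE_resample[symmetric]) (use assms in auto)
  also have "\<dots> = 0"
    using assms(4) f by (simp add: avg_mult_right)
  finally show ?thesis .
qed

text \<open>Distinct coordinates are independent and centred, hence orthogonal; only the diagonal of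
  the double sum survives.\<close>

lemma avg_PiE_sum_mult:
  fixes f h :: "nat \<Rightarrow> real"
  assumes n: "finite B" "B \<noteq> {}" "finite I" and f: "avg B f = 0" and h: "avg B h = 0"
  shows "avg (PiE I (\<lambda>_. B)) (\<lambda>g. (\<Sum>m\<in>I. f (g m)) * (\<Sum>m\<in>I. h (g m)))
    = of_nat (card I) * avg B (\<lambda>a. f a * h a)"
proof -
  have "avg (PiE I (\<lambda>_. B)) (\<lambda>g. (\<Sum>m\<in>I. f (g m)) * (\<Sum>m\<in>I. h (g m)))
    = (\<Sum>m\<in>I. \<Sum>m'\<in>I. avg (PiE I (\<lambda>_. B)) (\<lambda>g. f (g m) * h (g m')))"
    by (simp add: sum_product avg_sum)
  also have "\<dots> = (\<Sum>m\<in>I. \<Sum>m'\<in>I. if m' = m then avg B (\<lambda>a. f a * h a) else 0)"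
  proof (intro sum.cong refl)
    fix m m' assume m: "m \<in> I" "m' \<in> I"
    show "avg (PiE I (\<lambda>_. B)) (\<lambda>g. f (g m) * h (g m')) = (if m' = m then avg B (\<lambda>a. f a * h a) else 0)"
    proof (cases "m = m'")
      case True
      then show ?thesis
        using avg_PiE_coord[of I m "\<lambda>_. B" "\<lambda>a. f a * h a"] m n by simp
    next
      case False
      then show ?thesis
        using avg_PiE_mean_zero[of I m m' "\<lambda>_. B" f h] m n f by simp
    qed
  qed
  also have "\<dots> = of_nat (card I) * avg B (\<lambda>a. f a * h a)"
    using n by simp
  finally show ?thesis .
qed

subsection \<open>Rademacher chaining\<close>

abbreviation signs :: "'i set \<Rightarrow> ('i \<Rightarrow> real) set" where
  "signs I \<equiv> PiE I (\<lambda>_. {-1, 1})"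

lemma finite_signs: "finite I \<Longrightarrow> finite (signs I)"
  by (simp add: finite_PiE)

lemma signs_nonempty: "signs I \<noteq> {}"
  by (simp add: PiE_eq_empty_iff)

lemma tanh_le_self: "z \<ge> 0 \<Longrightarrow> tanh z \<le> (z::real)"
proof -
  assume "z \<ge> 0"
  have "(\<lambda>z. z - tanh z) 0 \<le> (\<lambda>z. z - tanh z) z"
  proof (rule DERIV_nonneg_imp_nondecreasing[OF \<open>z \<ge> 0\<close>])
    fix x :: real
    have "((\<lambda>z. z - tanh z) has_real_derivative (1 - (1 - (tanh x)\<^sup>2))) (at x)"
      by (auto intro!: derivative_eq_intros)
    then show "\<exists>y. ((\<lambda>z. z - tanh z) has_real_derivative y) (at x) \<and> 0 \<le> y"
      by (intro exI conjI, assumption) simp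
  qed
  then show ?thesis by simp
qed

text \<open>The sub-Gaussian bound for one random sign. After taking logarithms the difference of
  the two sides has derivative \<open>z - tanh z\<close>, which is nonnegative for z \<ge> 0;
  evenness gives the rest.\<close>

lemma cosh_le_exp_half_square: "cosh (x::real) \<le> exp (x\<^sup>2 / 2)"
proof -
  have "cosh x \<le> exp (x\<^sup>2 / 2)" if x: "x \<ge> 0" for x :: real
  proof -
    have "(\<lambda>x. x\<^sup>2/2 - ln (cosh x)) 0 \<le> (\<lambda>x. x\<^sup>2/2 - ln (cosh x)) x"
    proof (rule DERIV_nonneg_imp_nondecreasing[OF x])
      fix z :: real assume z: "0 \<le> z"
      have "((\<lambda>x. x\<^sup>2/2 - ln (cosh x)) has_real_derivative (z - tanh z)) (at z)"
        by (auto intro!: derivative_eq_intros simp: tanh_def)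
      then show "\<exists>y. ((\<lambda>x. x\<^sup>2/2 - ln (cosh x)) has_real_derivative y) (at z) \<and> 0 \<le> y"
        by (intro exI conjI, assumption) (use tanh_le_self[OF z] in simp)
    qed
    then have "ln (cosh x) \<le> x\<^sup>2/2" by simp
    then have "exp (ln (cosh x)) \<le> exp (x\<^sup>2/2)" by (subst exp_le_cancel_iff)
    then show ?thesis by (simp add: cosh_real_pos)
  qed
  from this[of "\<bar>x\<bar>"] show ?thesis by simp
qed

lemma avg_signs_exp:
  assumes "finite I"
  shows "avg (signs I) (\<lambda>e. exp (t * (\<Sum>m\<in>I. e m * c m))) \<le> exp (t\<^sup>2 * (\<Sum>m\<in>I. (c m)\<^sup>2) / 2)"
proof -
  have "avg (signs I) (\<lambda>e. exp (t * (\<Sum>m\<in>I. e m * c m)))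
      = avg (signs I) (\<lambda>e. \<Prod>m\<in>I. exp (t * (e m * c m)))"
    using assms by (simp add: sum_distrib_left exp_sum)
  also have "\<dots> = (\<Prod>m\<in>I. avg {-1, 1} (\<lambda>x. exp (t * (x * c m))))"
    by (rule avg_PiE_prod) (use assms in auto)
  also have "\<dots> = (\<Prod>m\<in>I. cosh (t * c m))"
    by (simp add: avg_def cosh_field_def add.commute)
  also have "\<dots> \<le> (\<Prod>m\<in>I. exp ((t * c m)\<^sup>2 / 2))"
    by (intro prod_mono) (simp add: cosh_le_exp_half_square)
  also have "\<dots> = exp (t\<^sup>2 * (\<Sum>m\<in>I. (c m)\<^sup>2) / 2)"
    using assms by (simp add: exp_sum[symmetric] power_mult_distrib sum_distrib_left sum_divide_distrib)
  finally show ?thesis .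
qed

text \<open>Exponential moments with a union bound over the 2 |T| signed sums. \<open>Z\<close> only
  has to lie below some |sum| at each sign vector, so it can be instantiated with a maximum whose
  maximizer depends on the signs. For s = 0 all coefficients vanish, and this case is split off
  because the optimal t divides by s.\<close>

lemma rademacher_maximal:
  fixes c :: "'t \<Rightarrow> 'i \<Rightarrow> real"
  assumes I: "finite I" and T: "finite T" "T \<noteq> {}" and s: "s \<ge> 0"
    and c: "\<And>t. t \<in> T \<Longrightarrow> (\<Sum>m\<in>I. (c t m)\<^sup>2) \<le> s\<^sup>2"
    and Z: "\<And>e. e \<in> signs I \<Longrightarrow> \<exists>t\<in>T. Z e \<le> \<bar>\<Sum>m\<in>I. e m * c t m\<bar>"
  shows "avg (signs I) Z \<le> s * sqrt (2 * ln (2 * card T))"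
proof (cases "s = 0")
  case True
  have "Z e \<le> 0" if "e \<in> signs I" for e
  proof -
    obtain t where t: "t \<in> T" "Z e \<le> \<bar>\<Sum>m\<in>I. e m * c t m\<bar>" using Z[OF \<open>e \<in> signs I\<close>] by auto
    have "(\<Sum>m\<in>I. (c t m)\<^sup>2) = 0" using c[OF t(1)] True
      by (smt (verit) sum_nonneg zero_le_power2 power_zero_numeral)
    then have "\<forall>m\<in>I. c t m = 0" using I by (subst (asm) sum_nonneg_eq_0_iff) auto
    then show ?thesis using t(2) by simp
  qed
  then show ?thesis using True avg_mono[of "signs I" Z "\<lambda>_. 0"] by simp
next
  case False
  define L where "L = ln (2 * real (card T))"
  have cT: "card T \<ge> 1" using T by (simp add: Suc_le_eq card_gt_0_iff)
  have L: "L > 0" unfolding L_def using cT by (intro ln_gt_zero) linarith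
  \<comment> \<open>The optimal exponent. With u the claimed bound, t u = 2 L, and the 2 |T|
    exponential moments add up to at most exp L * exp L, which \<open>exp (- (t * u))\<close>
    cancels exactly.\<close>
  define t where "t = sqrt (2 * L) / s"
  have t: "t > 0" using False s L by (simp add: t_def)
  have t2: "t\<^sup>2 * s\<^sup>2 = 2 * L" unfolding t_def using False L by (simp add: power_divide)
  define u where "u = s * sqrt (2 * L)"
  have tu: "t * u = 2 * L" unfolding t_def u_def using False L by simp
  define X where "X r e = (\<Sum>m\<in>I. e m * c r m)" for r and e :: "'i \<Rightarrow> real"
  \<comment> \<open>The tangent inequality \<open>1 + x \<le> exp x\<close> at x = t (Z - u) takes
    the place of Jensen's inequality for the logarithm, so that averages can be taken
    directly.\<close>
  have ptw: "t * Z e \<le> t * u - 1 + exp (- (t * u)) * (\<Sum>r\<in>T. exp (t * X r e) + exp ((-t) * X r e))"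
    if e: "e \<in> signs I" for e
  proof -
    obtain r where r: "r \<in> T" "Z e \<le> \<bar>X r e\<bar>" using Z[OF e] unfolding X_def by auto
    have "exp (t * \<bar>X r e\<bar>) \<le> exp (t * X r e) + exp ((-t) * X r e)"
      by (cases "X r e \<ge> 0") (auto simp: abs_if)
    also have "\<dots> \<le> (\<Sum>r\<in>T. exp (t * X r e) + exp ((-t) * X r e))"
      by (rule member_le_sum[where f="\<lambda>r. exp (t * X r e) + exp ((-t) * X r e)"]) (use r T in \<open>auto intro: add_nonneg_nonneg\<close>)
    finally have 1: "exp (t * \<bar>X r e\<bar>) \<le> (\<Sum>r\<in>T. exp (t * X r e) + exp ((-t) * X r e))" .
    have "t * Z e - t * u \<le> t * \<bar>X r e\<bar> - t * u" using r t by simp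
    also have "\<dots> \<le> exp (t * \<bar>X r e\<bar> - t * u) - 1" using exp_ge_add_one_self[of "t * \<bar>X r e\<bar> - t * u"] by linarith
    also have "exp (t * \<bar>X r e\<bar> - t * u) = exp (- (t * u)) * exp (t * \<bar>X r e\<bar>)"
      by (simp add: exp_diff exp_minus field_simps)
    finally show ?thesis using mult_left_mono[OF 1, of "exp (- (t * u))"] by (smt (verit) exp_ge_zero)
  qed
  have ex: "avg (signs I) (\<lambda>e. exp (v * X r e)) \<le> exp L" if "r \<in> T" "v\<^sup>2 = t\<^sup>2" for r v
  proof -
    have "avg (signs I) (\<lambda>e. exp (v * X r e)) \<le> exp (v\<^sup>2 * (\<Sum>m\<in>I. (c r m)\<^sup>2) / 2)"
      unfolding X_def by (rule avg_signs_exp[OF I])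
    also have "\<dots> \<le> exp (t\<^sup>2 * s\<^sup>2 / 2)"
      using c[OF that(1)] that(2) by (simp add: mult_left_mono)
    also have "\<dots> = exp L" by (simp add: t2)
    finally show ?thesis .
  qed
  have "t * avg (signs I) Z = avg (signs I) (\<lambda>e. t * Z e)" by (simp add: avg_mult_left)
  also have "\<dots> \<le> avg (signs I) (\<lambda>e. (t * u - 1) + exp (- (t * u)) * (\<Sum>r\<in>T. exp (t * X r e) + exp ((-t) * X r e)))"
    by (rule avg_mono) (rule ptw)
  also have "\<dots> = (t * u - 1) + exp (- (t * u)) * (\<Sum>r\<in>T. avg (signs I) (\<lambda>e. exp (t * X r e)) + avg (signs I) (\<lambda>e. exp ((-t) * X r e)))"
    by (simp only: avg_add avg_mult_left avg_sum avg_const[OF finite_signs[OF I] signs_nonempty])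
  also have "\<dots> \<le> (t * u - 1) + exp (- (t * u)) * (\<Sum>r\<in>T. exp L + exp L)"
    by (intro add_left_mono mult_left_mono sum_mono add_mono ex) auto
  also have "(\<Sum>r\<in>T. exp L + exp L) = exp L * exp L"
    using cT by (simp add: L_def)
  also have "exp (- (t * u)) * (exp L * exp L) = 1"
    by (simp add: tu exp_add[symmetric])
  finally have "t * avg (signs I) Z \<le> t * u" by simp
  then have "avg (signs I) Z \<le> u" using t by simp
  then show ?thesis by (simp add: u_def L_def)
qed

definition sup_abs :: "'f set \<Rightarrow> ('f \<Rightarrow> real) \<Rightarrow> real" where
  "sup_abs F x = (SUP f\<in>F. \<bar>x f\<bar>)"

lemma sup_abs_le: "F \<noteq> {} \<Longrightarrow> (\<And>f. f \<in> F \<Longrightarrow> \<bar>x f\<bar> \<le> c) \<Longrightarrow> sup_abs F x \<le> c"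
  unfolding sup_abs_def by (rule cSUP_least)

lemma sup_abs_ge: "f \<in> F \<Longrightarrow> (\<And>f. f \<in> F \<Longrightarrow> \<bar>x f\<bar> \<le> c) \<Longrightarrow> \<bar>x f\<bar> \<le> sup_abs F x"
  unfolding sup_abs_def by (rule cSUP_upper) (auto simp: bdd_above_def)

text \<open>The summability assumption is the entropy integral in dyadic form. The approximation
  rate K / 2^q is not part of the locale: each chaining lemma assumes it for its own weights, which
  are r on single indices and R on cells.\<close>

locale chain =
  fixes F :: "'f set" and net :: "nat \<Rightarrow> 'f \<Rightarrow> 'f" and K :: real
  assumes F_ne: "F \<noteq> {}" and K: "K \<ge> 0"
    and net_fin: "\<And>q. finite (net q ` F)" and net_in: "\<And>q f. f \<in> F \<Longrightarrow> net q f \<in> F"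
    and summ: "summable (\<lambda>q. sqrt (ln (real (card (net q ` F)))) / 2 ^ q)"
begin

text \<open>The bound of \<open>rademacher_maximal\<close> for one link of the chain: an increment
  between levels q and q + 1 is at most K / 2^q + K / 2^(q+1) \<le> 2 K / 2^q per unit weight, and
  there are at most as many links as pairs of neighbouring net points.\<close>

definition step :: "nat \<Rightarrow> real" where
  "step q = 2 * K / 2 ^ q * sqrt (2 * ln (2 * (real (card (net q ` F)) * real (card (net (Suc q) ` F)))))"

definition tail :: "nat \<Rightarrow> real" where
  "tail q0 = (\<Sum>q. step (q + q0))"

lemma card_ge1: "card (net q ` F) \<ge> 1"
  using net_fin[of q] F_ne by (simp add: Suc_le_eq card_gt_0_iff)

lemma step_nonneg: "step q \<ge> 0"
proof -
  have "1 \<le> card (net q ` F) * card (net (Suc q) ` F)" using card_ge1[of q] card_ge1[of "Suc q"] by (metis mult_le_mono mult_1)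
  then have "real 1 \<le> real (card (net q ` F) * card (net (Suc q) ` F))" by (subst of_nat_le_iff)
  then show ?thesis unfolding step_def using K by (simp add: ln_ge_zero)
qed

lemma summable_step: "summable step"
proof -
  let ?a = "\<lambda>q. sqrt (ln (real (card (net q ` F))))"
  \<comment> \<open>Subadditivity of the square root splits the logarithm of the product. The factor
    2 on the last term is the index shift from 2^q to 2^(q+1).\<close>
  have bd: "norm (step q) \<le> 2 * sqrt 2 * K * (sqrt (ln 2) * (1/2) ^ q + ?a q / 2 ^ q + 2 * (?a (Suc q) / 2 ^ Suc q))" for q
  proof -
    have c: "real (card (net q ` F)) \<ge> 1" for q using card_ge1[of q] by simp
    have l: "ln (2 * (real (card (net q ` F)) * real (card (net (Suc q) ` F))))
        = ln 2 + (ln (real (card (net q ` F))) + ln (real (card (net (Suc q) ` F))))"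
      using c[of q] c[of "Suc q"] by (simp add: ln_mult)
    have "sqrt (ln 2 + (ln (real (card (net q ` F))) + ln (real (card (net (Suc q) ` F))))) \<le> sqrt (ln 2) + (?a q + ?a (Suc q))"
      using c[of q] c[of "Suc q"]
      by (intro order.trans[OF sqrt_add_le_add_sqrt] add_left_mono) auto
    then have "norm (step q) \<le> 2 * K / 2 ^ q * (sqrt 2 * (sqrt (ln 2) + (?a q + ?a (Suc q))))"
      using step_nonneg[of q] K unfolding step_def l real_sqrt_mult[of 2 "_ + _"]
      by (simp only: real_norm_def abs_of_nonneg) (intro mult_left_mono, auto)
    also have "\<dots> = 2 * sqrt 2 * K * (sqrt (ln 2) * (1/2) ^ q + ?a q / 2 ^ q + 2 * (?a (Suc q) / 2 ^ Suc q))"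
      by (simp add: field_simps power_one_over)
    finally show ?thesis .
  qed
  have "summable (\<lambda>q. ?a (Suc q) / 2 ^ Suc q)" using summ by (subst summable_Suc_iff[where f="\<lambda>q. ?a q / 2 ^ q"])
  then have "summable (\<lambda>q. 2 * sqrt 2 * K * (sqrt (ln 2) * (1/2) ^ q + ?a q / 2 ^ q + 2 * (?a (Suc q) / 2 ^ Suc q)))"
    using summ by (intro summable_mult summable_add) auto
  then show ?thesis by (rule summable_comparison_test'[where N=0]) (rule bd)
qed

lemma tail_tendsto: "tail \<longlonglongrightarrow> 0"
proof -
  have "tail = (\<lambda>n. suminf step - (\<Sum>q<n. step q))"
    unfolding tail_def using suminf_minus_initial_segment[OF summable_step] by auto
  moreover have "(\<lambda>n. suminf step - (\<Sum>q<n. step q)) \<longlonglongrightarrow> suminf step - suminf step"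
    by (intro tendsto_diff tendsto_const summable_LIMSEQ summable_step)
  ultimately show ?thesis by simp
qed

lemma sum_step_le_tail: "(\<Sum>q=q0..<Q. step q) \<le> tail q0"
proof -
  have "(\<Sum>q=q0..<Q. step q) \<le> (\<Sum>q=q0..<q0+Q. step q)"
    by (rule sum_mono2) (auto simp: step_nonneg)
  also have "\<dots> = (\<Sum>q<Q. step (q + q0))"
    using sum.shift_bounds_nat_ivl[of step 0 q0 Q] by (simp add: atLeast0LessThan add.commute)
  also have "\<dots> \<le> tail q0" unfolding tail_def
    by (rule sum_le_suminf) (use summable_step step_nonneg in \<open>auto simp: summable_iff_shift\<close>)
  finally show ?thesis .
qed

lemma tail_nonneg: "tail q \<ge> 0"
  using sum_step_le_tail[of q q] by simp

text \<open>The telescoping passes through the points \<open>net q f\<close> of one fixed f instead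
  of projecting one net onto the next, so the nets may be unrelated to each other. Past level Q the
  remainder is bounded term by term by K / 2^Q times the total weight; I is finite, so it vanishes
  as Q grows.\<close>

lemma rademacher_chain:
  fixes z :: "'f \<Rightarrow> 'i \<Rightarrow> real"
  assumes I: "finite I" and r: "\<And>m. m \<in> I \<Longrightarrow> r m \<ge> 0"
    and z: "\<And>f m q. f \<in> F \<Longrightarrow> m \<in> I \<Longrightarrow> \<bar>z f m - z (net q f) m\<bar> \<le> K / 2 ^ q * r m"
  shows "avg (signs I) (\<lambda>e. sup_abs F (\<lambda>f. \<Sum>m\<in>I. e m * (z f m - z (net q0 f) m)))
     \<le> tail q0 * sqrt (\<Sum>m\<in>I. (r m)\<^sup>2)"
proof -
  define s where "s = sqrt (\<Sum>m\<in>I. (r m)\<^sup>2)"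
  have s: "s \<ge> 0" "s\<^sup>2 = (\<Sum>m\<in>I. (r m)\<^sup>2)" by (auto simp: s_def sum_nonneg)
  define X where "X e f = (\<Sum>m\<in>I. e m * z f m)" for e f
  define Mx where "Mx q e = Max ((\<lambda>f. \<bar>X e (net q f) - X e (net (Suc q) f)\<bar>) ` F)" for q e
  have finpair: "finite ((\<lambda>f. (net q f, net (Suc q) f)) ` F)" (is "finite (?T q)")
    and pair_avg: "card ((\<lambda>f. (net q f, net (Suc q) f)) ` F) \<le> card (net q ` F) * card (net (Suc q) ` F)" for q
  proof -
    have sub: "?T q \<subseteq> net q ` F \<times> net (Suc q) ` F" by auto
    then show "finite (?T q)" using net_fin by (meson finite_SigmaI finite_subset)
    show "card (?T q) \<le> card (net q ` F) * card (net (Suc q) ` F)"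
      using card_mono[OF _ sub] net_fin by (simp add: card_cartesian_product)
  qed
  \<comment> \<open>F may be infinite, but an increment depends on f only through a pair of
    neighbouring net points. Hence the maximum ranges over a finite set.\<close>
  have Mimg: "(\<lambda>f. \<bar>X e (net q f) - X e (net (Suc q) f)\<bar>) ` F = (\<lambda>(a, b). \<bar>X e a - X e b\<bar>) ` ?T q" for q e
    by (auto simp: image_image)
  have Mfin: "finite ((\<lambda>f. \<bar>X e (net q f) - X e (net (Suc q) f)\<bar>) ` F)" for q e
    unfolding Mimg using finpair by blast
  have M1: "avg (signs I) (Mx q) \<le> step q * s" for q
  proof -
    have "avg (signs I) (Mx q) \<le> (2 * K / 2 ^ q * s) * sqrt (2 * ln (2 * card (?T q)))"
    proof (rule rademacher_maximal[where c="\<lambda>(a, b) m. z a m - z b m"])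
      show "finite I" "finite (?T q)" "?T q \<noteq> {}" by (auto simp: I finpair F_ne)
      show "0 \<le> 2 * K / 2 ^ q * s" using K s by simp
    next
      fix t assume "t \<in> ?T q"
      then obtain f where f: "f \<in> F" "t = (net q f, net (Suc q) f)" by auto
      have "\<bar>z (net q f) m - z (net (Suc q) f) m\<bar> \<le> 2 * K / 2 ^ q * r m" if "m \<in> I" for m
      proof -
        have "\<bar>z (net q f) m - z (net (Suc q) f) m\<bar> \<le> K / 2 ^ q * r m + K / 2 ^ Suc q * r m"
          using z[OF f(1) that, of q] z[OF f(1) that, of "Suc q"] by linarith
        also have "\<dots> \<le> K / 2 ^ q * r m + K / 2 ^ q * r m"
          using K r[OF that] by (intro add_left_mono mult_right_mono divide_left_mono) auto
        finally show ?thesis by simp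
      qed
      then have "(\<Sum>m\<in>I. (z (net q f) m - z (net (Suc q) f) m)\<^sup>2) \<le> (\<Sum>m\<in>I. (2 * K / 2 ^ q * r m)\<^sup>2)"
        by (intro sum_mono) (metis abs_ge_zero power2_abs power_mono)
      also have "\<dots> = (2 * K / 2 ^ q * s)\<^sup>2"
        by (simp only: power_mult_distrib s sum_distrib_left power_divide)
      finally show "(\<Sum>m\<in>I. ((case t of (a, b) \<Rightarrow> \<lambda>m. z a m - z b m) m)\<^sup>2) \<le> (2 * K / 2 ^ q * s)\<^sup>2"
        by (simp add: f)
    next
      fix e
      have "Mx q e \<in> (\<lambda>f. \<bar>X e (net q f) - X e (net (Suc q) f)\<bar>) ` F"
        unfolding Mx_def by (rule Max_in) (use Mfin F_ne in auto)
      then obtain f where f: "f \<in> F" "Mx q e = \<bar>X e (net q f) - X e (net (Suc q) f)\<bar>" by auto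
      then show "\<exists>t\<in>?T q. Mx q e \<le> \<bar>\<Sum>m\<in>I. e m * (case t of (a, b) \<Rightarrow> \<lambda>m. z a m - z b m) m\<bar>"
        by (intro bexI[of _ "(net q f, net (Suc q) f)"]) (auto simp: X_def sum_subtractf right_diff_distrib)
    qed
    also have "\<dots> \<le> (2 * K / 2 ^ q * s) * sqrt (2 * ln (2 * (real (card (net q ` F)) * real (card (net (Suc q) ` F)))))"
    proof -
      have "card (?T q) \<ge> 1" using finpair F_ne by (simp add: Suc_le_eq card_gt_0_iff)
      moreover have "real (2 * card (?T q)) \<le> 2 * (real (card (net q ` F)) * real (card (net (Suc q) ` F)))"
        using pair_avg[of q] by (simp flip: of_nat_mult)
      ultimately show ?thesis using K s
        by (intro mult_left_mono real_sqrt_le_mono ln_mono) auto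
    qed
    also have "\<dots> = step q * s" by (simp add: step_def)
    finally show ?thesis .
  qed
  have sup: "sup_abs F (\<lambda>f. \<Sum>m\<in>I. e m * (z f m - z (net q0 f) m))
      \<le> (\<Sum>q=q0..<Q. Mx q e) + K / 2 ^ Q * (\<Sum>m\<in>I. r m)" if Q: "Q \<ge> q0" and e: "e \<in> signs I" for Q e
  proof (rule sup_abs_le[OF F_ne])
    fix f assume f: "f \<in> F"
    have tel: "\<bar>X e (net Q f) - X e (net q0 f)\<bar> \<le> (\<Sum>q=q0..<Q. Mx q e)"
      using Q
    proof (induction Q rule: dec_induct)
      case (step q)
      have "\<bar>X e (net q f) - X e (net (Suc q) f)\<bar> \<le> Mx q e"
        unfolding Mx_def by (rule Max_ge) (use Mfin f in auto)
      then show ?case using step by simp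
    qed simp
    have "\<bar>X e f - X e (net Q f)\<bar> = \<bar>\<Sum>m\<in>I. e m * (z f m - z (net Q f) m)\<bar>"
      by (simp add: X_def sum_subtractf right_diff_distrib)
    also have "\<dots> \<le> (\<Sum>m\<in>I. \<bar>e m * (z f m - z (net Q f) m)\<bar>)" by (rule sum_abs)
    also have "\<dots> \<le> (\<Sum>m\<in>I. K / 2 ^ Q * r m)"
    proof (rule sum_mono)
      fix m assume m: "m \<in> I"
      have "\<bar>e m\<bar> = 1" using e m by (auto simp: PiE_iff)
      then show "\<bar>e m * (z f m - z (net Q f) m)\<bar> \<le> K / 2 ^ Q * r m" using z[OF f m] by (simp add: abs_mult)
    qed
    finally have "\<bar>X e f - X e (net Q f)\<bar> \<le> K / 2 ^ Q * (\<Sum>m\<in>I. r m)" by (simp add: sum_distrib_left)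
    then have "\<bar>X e f - X e (net q0 f)\<bar> \<le> (\<Sum>q=q0..<Q. Mx q e) + K / 2 ^ Q * (\<Sum>m\<in>I. r m)"
      using tel by linarith
    then show "\<bar>\<Sum>m\<in>I. e m * (z f m - z (net q0 f) m)\<bar> \<le> (\<Sum>q=q0..<Q. Mx q e) + K / 2 ^ Q * (\<Sum>m\<in>I. r m)"
      by (simp add: X_def sum_subtractf right_diff_distrib)
  qed
  have "avg (signs I) (\<lambda>e. sup_abs F (\<lambda>f. \<Sum>m\<in>I. e m * (z f m - z (net q0 f) m)))
      \<le> tail q0 * s + K / 2 ^ Q * (\<Sum>m\<in>I. r m)" if Q: "Q \<ge> q0" for Q
  proof -
    have "avg (signs I) (\<lambda>e. sup_abs F (\<lambda>f. \<Sum>m\<in>I. e m * (z f m - z (net q0 f) m)))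
        \<le> avg (signs I) (\<lambda>e. (\<Sum>q=q0..<Q. Mx q e) + K / 2 ^ Q * (\<Sum>m\<in>I. r m))"
      by (rule avg_mono) (rule sup[OF Q])
    also have "\<dots> = (\<Sum>q=q0..<Q. avg (signs I) (Mx q)) + K / 2 ^ Q * (\<Sum>m\<in>I. r m)"
      by (simp only: avg_add avg_sum avg_const[OF finite_signs[OF I] signs_nonempty])
    also have "\<dots> \<le> (\<Sum>q=q0..<Q. step q * s) + K / 2 ^ Q * (\<Sum>m\<in>I. r m)"
      by (intro add_right_mono sum_mono M1)
    also have "\<dots> \<le> tail q0 * s + K / 2 ^ Q * (\<Sum>m\<in>I. r m)"
      unfolding sum_distrib_right[symmetric]
      by (intro add_right_mono mult_right_mono sum_step_le_tail s)
    finally show ?thesis .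
  qed
  moreover have "(\<lambda>Q. tail q0 * s + K / 2 ^ Q * (\<Sum>m\<in>I. r m)) \<longlonglongrightarrow> tail q0 * s + 0"
  proof (intro tendsto_add tendsto_const)
    have "(\<lambda>Q. (1/2::real) ^ Q * (K * (\<Sum>m\<in>I. r m))) \<longlonglongrightarrow> 0 * (K * (\<Sum>m\<in>I. r m))"
      by (intro tendsto_mult tendsto_const LIMSEQ_realpow_zero) auto
    then show "(\<lambda>Q. K / 2 ^ Q * (\<Sum>m\<in>I. r m)) \<longlonglongrightarrow> 0"
      by (simp add: power_one_over field_simps)
  qed
  ultimately have "avg (signs I) (\<lambda>e. sup_abs F (\<lambda>f. \<Sum>m\<in>I. e m * (z f m - z (net q0 f) m))) \<le> tail q0 * s + 0"
    by (intro LIMSEQ_le_const[of "\<lambda>Q. tail q0 * s + K / 2 ^ Q * (\<Sum>m\<in>I. r m)"]) auto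
  then show ?thesis by (simp add: s_def)
qed

end

subsection \<open>Multinomial resampling\<close>

definition resamples :: "nat \<Rightarrow> (nat \<Rightarrow> nat) set" where
  "resamples n = PiE {1..n} (\<lambda>_. {1..n})"

definition draw_count :: "nat \<Rightarrow> (nat \<Rightarrow> nat) \<Rightarrow> nat \<Rightarrow> real" where
  "draw_count n D a = real (card {m\<in>{1..n}. D m = a})"

lemma finite_resamples: "finite (resamples n)"
  by (simp add: resamples_def finite_PiE)

lemma resamples_nonempty: "resamples n \<noteq> {}"
  by (simp add: resamples_def PiE_eq_empty_iff)

lemma sum_draw_count:
  assumes "D \<in> resamples n"
  shows "(\<Sum>a\<in>{1..n}. draw_count n D a * x a) = (\<Sum>m\<in>{1..n}. x (D m))"
proof -
  have "(\<Sum>m\<in>{1..n}. x (D m)) = (\<Sum>a\<in>{1..n}. \<Sum>m\<in>{m\<in>{1..n}. D m = a}. x (D m))"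
    by (rule sum.group[symmetric]) (use assms in \<open>auto simp: resamples_def PiE_iff\<close>)
  also have "\<dots> = (\<Sum>a\<in>{1..n}. draw_count n D a * x a)"
    by (intro sum.cong refl) (simp add: draw_count_def)
  finally show ?thesis by simp
qed

lemma avg_resamples_coord:
  assumes "m \<in> {1..n}"
  shows "avg (resamples n) (\<lambda>D. x (D m)) = avg {1..n} x"
  using avg_PiE_coord[of "{1..n}" m "\<lambda>_. {1..n}" x] assms by (auto simp: resamples_def)

lemma sum_avg_resamples: "(\<Sum>m\<in>{1..n}. avg (resamples n) (\<lambda>D. x (D m))) = (\<Sum>a\<in>{1..n}. x a)"
  using avg_resamples_coord[of _ n x] by (simp add: avg_def)

text \<open>Exchanging the two resamples at the coordinates with \<open>e m = -1\<close> is an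
  involution of the set of pairs and flips the sign of the difference exactly there. \<Phi> acts on
  the whole function of f, so that it may be a supremum over F.\<close>

lemma avg_swap_signs:
  fixes \<Phi> :: "('f \<Rightarrow> real) \<Rightarrow> real"
  assumes e: "e \<in> signs {1..n}"
  shows "avg (resamples n \<times> resamples n) (\<lambda>(D, D'). \<Phi> (\<lambda>f. \<Sum>m\<in>{1..n}. y f (D m) - y f (D' m)))
    = avg (resamples n \<times> resamples n) (\<lambda>(D, D'). \<Phi> (\<lambda>f. \<Sum>m\<in>{1..n}. e m * (y f (D m) - y f (D' m))))"
proof -
  define sw where "sw D D' = (\<lambda>m\<in>{1..n}. if e m = 1 then D m else D' m)" for D D' :: "nat \<Rightarrow> nat"
  have sw: "sw D D' \<in> resamples n" if "D \<in> resamples n" "D' \<in> resamples n" for D D'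
    using that by (auto simp: sw_def resamples_def PiE_iff extensional_def)
  have swsw: "sw (sw D D') (sw D' D) = D" if "D \<in> resamples n" for D D'
    using that by (auto simp: sw_def resamples_def PiE_iff extensional_def fun_eq_iff)
  have "bij_betw (\<lambda>(D, D'). (sw D D', sw D' D)) (R \<times> R) (R \<times> R)"
    if "\<And>D D'. D \<in> R \<Longrightarrow> D' \<in> R \<Longrightarrow> sw D D' \<in> R" "\<And>D D'. D \<in> R \<Longrightarrow> sw (sw D D') (sw D' D) = D" for R
    by (rule bij_betw_byWitness[where f'="\<lambda>(D, D'). (sw D D', sw D' D)"]) (auto simp: that)
  from this[of "resamples n"] have bij: "bij_betw (\<lambda>(D, D'). (sw D D', sw D' D)) (resamples n \<times> resamples n) (resamples n \<times> resamples n)"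
    using sw swsw by blast
  have "avg (resamples n \<times> resamples n) (\<lambda>(D, D'). \<Phi> (\<lambda>f. \<Sum>m\<in>{1..n}. y f (D m) - y f (D' m)))
    = avg (resamples n \<times> resamples n) (\<lambda>p. (\<lambda>(D, D'). \<Phi> (\<lambda>f. \<Sum>m\<in>{1..n}. y f (D m) - y f (D' m))) ((\<lambda>(D, D'). (sw D D', sw D' D)) p))"
    by (rule avg_bij[OF bij, symmetric])
  also have "\<dots> = avg (resamples n \<times> resamples n) (\<lambda>(D, D'). \<Phi> (\<lambda>f. \<Sum>m\<in>{1..n}. e m * (y f (D m) - y f (D' m))))"
  proof (rule avg_cong, clarify)
    fix D D'
    have "(\<Sum>m\<in>{1..n}. y f (sw D D' m) - y f (sw D' D m)) = (\<Sum>m\<in>{1..n}. e m * (y f (D m) - y f (D' m)))" for f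
    proof (rule sum.cong[OF refl])
      fix m assume m: "m \<in> {1..n}"
      have "e m \<in> {-1, 1}" using e m by (auto simp: resamples_def PiE_iff)
      then show "y f (sw D D' m) - y f (sw D' D m) = e m * (y f (D m) - y f (D' m))"
        using m by (auto simp: sw_def)
    qed
    then show "\<Phi> (\<lambda>f. \<Sum>m\<in>{1..n}. y f (sw D D' m) - y f (sw D' D m)) =
       \<Phi> (\<lambda>f. \<Sum>m\<in>{1..n}. e m * (y f (D m) - y f (D' m)))" by simp
  qed
  finally show ?thesis .
qed

text \<open>Symmetrization: comparing with an independent resample and swapping the two samples
  coordinatewise replaces the multinomial weights by independent signs.\<close>

lemma (in chain) resample_chain:
  fixes z :: "'f \<Rightarrow> nat \<Rightarrow> real"
  assumes r: "\<And>m. m \<in> {1..n} \<Longrightarrow> r m \<ge> 0"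
    and z: "\<And>f m q. f \<in> F \<Longrightarrow> m \<in> {1..n} \<Longrightarrow> \<bar>z f m - z (net q f) m\<bar> \<le> K / 2 ^ q * r m"
  shows "avg (resamples n) (\<lambda>D. sup_abs F (\<lambda>f. \<Sum>a\<in>{1..n}. (draw_count n D a - 1) * (z f a - z (net q0 f) a)))
     \<le> 2 * tail q0 * sqrt (\<Sum>a\<in>{1..n}. (r a)\<^sup>2)"
proof -
  let ?I = "{1..n}" and ?R = "resamples n"
  note fR = finite_resamples[of n] and nR = resamples_nonempty[of n]
  define y where "y f a = z f a - z (net q0 f) a" for f a
  have ybd: "\<bar>y f a\<bar> \<le> K * r a" if "f \<in> F" "a \<in> ?I" for f a
  proof -
    have "\<bar>y f a\<bar> \<le> K / 2 ^ q0 * r a" using z[OF that] by (simp add: y_def)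
    also have "\<dots> \<le> K / 1 * r a" using K r[OF that(2)] by (intro mult_right_mono divide_left_mono) auto
    finally show ?thesis by simp
  qed
  define S where "S D D' = sup_abs F (\<lambda>f. \<Sum>m\<in>?I. y f (D m) - y f (D' m))" for D D'
  \<comment> \<open>The centring term is the average of the same sum over an independent resample.
    Absolute value and supremum then move inside that average.\<close>
  have pw: "sup_abs F (\<lambda>f. \<Sum>a\<in>?I. (draw_count n D a - 1) * y f a) \<le> avg ?R (S D)" if D: "D \<in> ?R" for D
  proof (rule sup_abs_le[OF F_ne])
    fix f assume f: "f \<in> F"
    have "(\<Sum>a\<in>?I. (draw_count n D a - 1) * y f a) = (\<Sum>m\<in>?I. y f (D m)) - (\<Sum>a\<in>?I. y f a)"
      using sum_draw_count[OF D, of "y f"] by (simp add: left_diff_distrib sum_subtractf)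
    also have "\<dots> = avg ?R (\<lambda>D'. \<Sum>m\<in>?I. y f (D m) - y f (D' m))"
      by (simp only: sum_subtractf avg_diff avg_const[OF fR nR] avg_sum sum_avg_resamples)
    finally have "\<bar>\<Sum>a\<in>?I. (draw_count n D a - 1) * y f a\<bar> \<le> avg ?R (\<lambda>D'. \<bar>\<Sum>m\<in>?I. y f (D m) - y f (D' m)\<bar>)"
      using norm_avg_le[of ?R "\<lambda>D'. \<Sum>m\<in>?I. y f (D m) - y f (D' m)"] by simp
    also have "\<dots> \<le> avg ?R (S D)"
    proof (rule avg_mono)
      fix D' assume D': "D' \<in> ?R"
      show "\<bar>\<Sum>m\<in>?I. y f (D m) - y f (D' m)\<bar> \<le> S D D'" unfolding S_def
      proof (rule sup_abs_ge[OF f])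
        fix g assume g: "g \<in> F"
        have "\<bar>\<Sum>m\<in>?I. y g (D m) - y g (D' m)\<bar> \<le> (\<Sum>m\<in>?I. \<bar>y g (D m) - y g (D' m)\<bar>)" by (rule sum_abs)
        also have "\<dots> \<le> (\<Sum>m\<in>?I. K * r (D m) + K * r (D' m))"
        proof (rule sum_mono)
          fix m assume "m \<in> ?I"
          then have "D m \<in> ?I" "D' m \<in> ?I" using D D' by (auto simp: resamples_def PiE_iff)
          from ybd[OF g this(1)] ybd[OF g this(2)]
          show "\<bar>y g (D m) - y g (D' m)\<bar> \<le> K * r (D m) + K * r (D' m)" by linarith
        qed
        finally show "\<bar>\<Sum>m\<in>?I. y g (D m) - y g (D' m)\<bar> \<le> (\<Sum>m\<in>?I. K * r (D m) + K * r (D' m))" .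
      qed
    qed
    finally show "\<bar>\<Sum>a\<in>?I. (draw_count n D a - 1) * y f a\<bar> \<le> avg ?R (S D)" .
  qed
  define Se where "Se D D' e = sup_abs F (\<lambda>f. \<Sum>m\<in>?I. e m * (y f (D m) - y f (D' m)))" for D D' e
  have fp: "finite (?R \<times> ?R)" and np: "?R \<times> ?R \<noteq> {}" using fR nR by auto
  have "avg ?R (\<lambda>D. sup_abs F (\<lambda>f. \<Sum>a\<in>?I. (draw_count n D a - 1) * y f a)) \<le> avg ?R (\<lambda>D. avg ?R (S D))"
    by (rule avg_mono) (rule pw)
  also have "\<dots> = avg (?R \<times> ?R) (\<lambda>(D, D'). S D D')" by (rule avg_Times[symmetric])
  also have "\<dots> = avg (signs ?I) (\<lambda>e. avg (?R \<times> ?R) (\<lambda>(D, D'). S D D'))"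
    by (rule avg_const[symmetric]) (auto simp: finite_signs signs_nonempty)
  also have "\<dots> = avg (signs ?I) (\<lambda>e. avg (?R \<times> ?R) (\<lambda>(D, D'). Se D D' e))"
    unfolding S_def Se_def by (rule avg_cong) (rule avg_swap_signs)
  also have "\<dots> = avg (?R \<times> ?R) (\<lambda>(D, D'). avg (signs ?I) (Se D D'))"
    by (subst avg_commute) (simp add: case_prod_beta')
  also have "\<dots> \<le> avg (?R \<times> ?R) (\<lambda>(D, D'). tail q0 * sqrt (\<Sum>m\<in>?I. (r (D m) + r (D' m))\<^sup>2))"
  proof (rule avg_mono, clarify)
    fix D D' assume D: "D \<in> ?R" and D': "D' \<in> ?R"
    \<comment> \<open>With both resamples frozen, the differences of the drawn values inherit the
      approximation rate with the summed weights r (D m) + r (D' m).\<close>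
    have "avg (signs ?I) (\<lambda>e. sup_abs F (\<lambda>f. \<Sum>m\<in>?I. e m *
        ((\<lambda>f m. z f (D m) - z f (D' m)) f m - (\<lambda>f m. z f (D m) - z f (D' m)) (net q0 f) m)))
      \<le> tail q0 * sqrt (\<Sum>m\<in>?I. (r (D m) + r (D' m))\<^sup>2)"
    proof (rule rademacher_chain[where r="\<lambda>m. r (D m) + r (D' m)"])
      fix m assume "m \<in> ?I"
      then have m: "D m \<in> ?I" "D' m \<in> ?I" using D D' by (auto simp: resamples_def PiE_iff)
      then show "0 \<le> r (D m) + r (D' m)" using r by (simp add: add_nonneg_nonneg)
      fix f q assume f: "f \<in> F"
      show "\<bar>z f (D m) - z f (D' m) - (z (net q f) (D m) - z (net q f) (D' m))\<bar> \<le> K / 2 ^ q * (r (D m) + r (D' m))"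
        using z[OF f m(1), of q] z[OF f m(2), of q] unfolding distrib_left by linarith
    qed simp
    then show "avg (signs ?I) (Se D D') \<le> tail q0 * sqrt (\<Sum>m\<in>?I. (r (D m) + r (D' m))\<^sup>2)"
      unfolding Se_def y_def by (simp add: algebra_simps)
  qed
  also have "\<dots> = tail q0 * avg (?R \<times> ?R) (\<lambda>(D, D'). sqrt (\<Sum>m\<in>?I. (r (D m) + r (D' m))\<^sup>2))"
    by (simp add: case_prod_beta' avg_mult_left)
  also have "avg (?R \<times> ?R) (\<lambda>(D, D'). sqrt (\<Sum>m\<in>?I. (r (D m) + r (D' m))\<^sup>2))
      \<le> sqrt (avg (?R \<times> ?R) (\<lambda>(D, D'). \<Sum>m\<in>?I. (r (D m) + r (D' m))\<^sup>2))"
    using avg_sqrt_le[OF fp np, of "\<lambda>(D, D'). \<Sum>m\<in>?I. (r (D m) + r (D' m))\<^sup>2"]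
    by (auto simp: case_prod_beta' sum_nonneg)
  \<comment> \<open>Summed over m, the squared weight at a uniformly drawn index averages to the
    full sum over a. The two copies contribute 2 + 2 = 4, whose root is the constant 2 of the
    statement.\<close>
  also have "avg (?R \<times> ?R) (\<lambda>(D, D'). \<Sum>m\<in>?I. (r (D m) + r (D' m))\<^sup>2)
      \<le> avg (?R \<times> ?R) (\<lambda>(D, D'). \<Sum>m\<in>?I. 2 * (r (D m))\<^sup>2 + 2 * (r (D' m))\<^sup>2)"
  proof (rule avg_mono, clarify, rule sum_mono)
    fix D D' m
    show "(r (D m) + r (D' m))\<^sup>2 \<le> 2 * (r (D m))\<^sup>2 + 2 * (r (D' m))\<^sup>2"
      using sum_squares_bound[of "r (D m)" "r (D' m)"] by (simp add: power2_sum)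
  qed
  also have "\<dots> = (\<Sum>m\<in>?I. avg ?R (\<lambda>D. 2 * (r (D m))\<^sup>2)) + (\<Sum>m\<in>?I. avg ?R (\<lambda>D. 2 * (r (D m))\<^sup>2))"
    by (simp only: avg_Times avg_sum avg_add sum.distrib avg_const[OF fR nR])
  also have "\<dots> = 4 * (\<Sum>a\<in>?I. (r a)\<^sup>2)"
    by (simp only: avg_mult_left sum_distrib_left[symmetric] sum_avg_resamples[where x="\<lambda>a. (r a)\<^sup>2"])
  also have "sqrt (4 * (\<Sum>a\<in>?I. (r a)\<^sup>2)) = 2 * sqrt (\<Sum>a\<in>?I. (r a)\<^sup>2)"
    by (simp add: real_sqrt_mult)
  finally show ?thesis using tail_nonneg[of q0] by (simp add: y_def mult_left_mono)
qed

text \<open>Multinomial covariance: a centred count is the sum over the n draws of independent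
  centred indicators, so the covariance is n times that of a single draw.\<close>

lemma avg_draw_count_cov:
  assumes n: "n \<ge> 1" and a: "a \<in> {1..n}" "b \<in> {1..n}"
  shows "avg (resamples n) (\<lambda>D. (draw_count n D a - 1) * (draw_count n D b - 1)) = (if a = b then 1 else 0) - 1 / real n"
proof -
  define \<delta> where "\<delta> a m = (if m = a then 1 else 0) - 1 / real n" for a m :: nat
  have s1: "(\<Sum>m\<in>{1..n}. \<delta> a m) = 0" if "a \<in> {1..n}" for a
    using that n by (simp add: \<delta>_def sum_subtractf)
  have W: "draw_count n D a - 1 = (\<Sum>m\<in>{1..n}. \<delta> a (D m))" for D a
    using n by (simp add: \<delta>_def sum_subtractf draw_count_def sum.If_cases Int_def)
  have "avg (resamples n) (\<lambda>D. (draw_count n D a - 1) * (draw_count n D b - 1))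
    = of_nat (card {1..n}) * avg {1..n} (\<lambda>m. \<delta> a m * \<delta> b m)"
    unfolding W resamples_def by (rule avg_PiE_sum_mult) (use s1 a n in \<open>auto simp: avg_def\<close>)
  also have "\<dots> = (\<Sum>m\<in>{1..n}. \<delta> a m * \<delta> b m)" using n by (simp add: avg_def)
  also have "\<dots> = (\<Sum>m\<in>{1..n}. (if m = a then \<delta> b m else 0) - 1 / real n * \<delta> b m)"
    by (intro sum.cong refl) (auto simp: \<delta>_def left_diff_distrib)
  also have "\<dots> = \<delta> b a"
    using a s1[OF a(2)] by (simp add: sum_subtractf sum_divide_distrib[symmetric])
  finally show ?thesis by (simp add: \<delta>_def)
qed

subsection \<open>Pigeonhole weights\<close>

lemma finite_obs_cells: "finite (obs_cells (C::'k::finite \<Rightarrow> nat))"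
  and obs_cells_PiE: "obs_cells C = PiE UNIV (\<lambda>i. {1..C i})"
proof -
  show *: "obs_cells C = PiE UNIV (\<lambda>i. {1..C i})"
    by (auto simp: obs_cells_def PiE_iff)
  show "finite (obs_cells C)" unfolding * by (simp add: finite_PiE)
qed

lemma card_obs_cells: "card (obs_cells C) = prodC C"
  unfolding obs_cells_PiE prodC_def by (simp add: card_PiE)

lemma obs_cells_nonempty: "(\<And>i. C i \<ge> 1) \<Longrightarrow> obs_cells C \<noteq> {}"
proof -
  assume "\<And>i. C i \<ge> 1"
  then have "(\<lambda>_. 1) \<in> obs_cells C" by (simp add: obs_cells_def)
  then show ?thesis by blast
qed

lemma draws_PiE: "draws C = PiE UNIV (\<lambda>i. resamples (C i))"
  by (simp add: draws_def resamples_def)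

lemma finite_draws: "finite (draws (C::'k::finite \<Rightarrow> nat))"
  unfolding draws_PiE by (simp add: finite_PiE finite_resamples)

lemma draws_nonempty: "draws C \<noteq> {}"
  unfolding draws_PiE by (simp add: PiE_eq_empty_iff resamples_nonempty)

lemma minC_le: "minC C \<le> C i"
  unfolding minC_def by simp

lemma minC_ge_iff: "m \<le> minC C \<longleftrightarrow> (\<forall>i. m \<le> C i)"
  unfolding minC_def by (subst Min_ge_iff) auto

lemma prodC_pos: "(\<And>i. C i \<ge> 1) \<Longrightarrow> prodC C \<ge> 1"
  unfolding prodC_def by (simp add: Suc_le_eq prod_pos)

lemma avg_draws_prod:
  fixes f :: "'k::finite \<Rightarrow> (nat \<Rightarrow> nat) \<Rightarrow> 'b::real_normed_field"
  shows "avg (draws C) (\<lambda>D. \<Prod>i\<in>A. f i (D i)) = (\<Prod>i\<in>A. avg (resamples (C i)) (f i))"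
proof -
  have "avg (draws C) (\<lambda>D. \<Prod>i\<in>A. f i (D i)) = avg (draws C) (\<lambda>D. \<Prod>i\<in>UNIV. if i \<in> A then f i (D i) else 1)"
    by (simp add: prod.inter_restrict[of UNIV _ A, simplified])
  also have "\<dots> = (\<Prod>i\<in>UNIV. avg (resamples (C i)) (\<lambda>e. if i \<in> A then f i e else 1))"
    unfolding draws_PiE by (rule avg_PiE_prod[where f="\<lambda>i e. if i \<in> A then f i e else 1"]) (simp_all only: finite_resamples finite_UNIV finite)
  also have "\<dots> = (\<Prod>i\<in>UNIV. if i \<in> A then avg (resamples (C i)) (f i) else 1)"
    by (intro prod.cong refl) (simp add: avg_const finite_resamples resamples_nonempty)
  also have "\<dots> = (\<Prod>i\<in>A. avg (resamples (C i)) (f i))"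
    by (simp add: prod.inter_restrict[of UNIV _ A, simplified])
  finally show ?thesis .
qed

lemma avg_obs_prod:
  fixes f :: "'k::finite \<Rightarrow> nat \<Rightarrow> 'b::real_normed_field"
  assumes "\<And>i. C i \<ge> 1"
  shows "avg (obs_cells C) (\<lambda>j. \<Prod>i\<in>A. f i (j i)) = (\<Prod>i\<in>A. avg {1..C i} (f i))"
proof -
  have "avg (obs_cells C) (\<lambda>D. \<Prod>i\<in>A. f i (D i)) = avg (obs_cells C) (\<lambda>D. \<Prod>i\<in>UNIV. if i \<in> A then f i (D i) else 1)"
    by (simp add: prod.inter_restrict[of UNIV _ A, simplified])
  also have "\<dots> = (\<Prod>i\<in>UNIV. avg {1..C i} (\<lambda>e. if i \<in> A then f i e else 1))"
    unfolding obs_cells_PiE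
    by (rule avg_PiE_prod[where f="\<lambda>i e. if i \<in> A then f i e else 1"]) auto
  also have "\<dots> = (\<Prod>i\<in>UNIV. if i \<in> A then avg {1..C i} (f i) else 1)"
    using assms by (intro prod.cong refl) (auto simp: avg_const not_le simp del: One_nat_def)
  also have "\<dots> = (\<Prod>i\<in>A. avg {1..C i} (f i))"
    by (simp add: prod.inter_restrict[of UNIV _ A, simplified] del: One_nat_def)
  finally show ?thesis .
qed

definition bscale :: "('k::finite \<Rightarrow> nat) \<Rightarrow> real" where
  "bscale C = sqrt (real (minC C)) / real (prodC C)"

definition wdev :: "('k::finite \<Rightarrow> nat) \<Rightarrow> ('k \<Rightarrow> nat \<Rightarrow> nat) \<Rightarrow> 'k \<Rightarrow> nat \<Rightarrow> real" where
  "wdev C D i a = draw_count (C i) (D i) a - 1"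

definition bstat :: "('k::finite \<Rightarrow> nat) \<Rightarrow> ('k \<Rightarrow> nat \<Rightarrow> nat) \<Rightarrow> (('k \<Rightarrow> nat) \<Rightarrow> real) \<Rightarrow> real" where
  "bstat C D x = bscale C * (\<Sum>j\<in>obs_cells C. (Wt C D j - 1) * x j)"

text \<open>One term of the Hoeffding-type decomposition of the product weights: the deviations
  \<open>wdev\<close> of different coordinates are independent under the draws.\<close>

definition bcomponent :: "('k::finite \<Rightarrow> nat) \<Rightarrow> 'k set \<Rightarrow> ('k \<Rightarrow> nat \<Rightarrow> nat) \<Rightarrow> (('k \<Rightarrow> nat) \<Rightarrow> real) \<Rightarrow> real" where
  "bcomponent C A D x = bscale C * (\<Sum>j\<in>obs_cells C. (\<Prod>i\<in>A. wdev C D i (j i)) * x j)"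

lemma Gstar_eq_bstat: "Gstar C N Y D \<omega> f = bstat C D (\<lambda>j. cellsum N Y f j \<omega>)"
  by (simp add: Gstar_def bstat_def bscale_def)

lemma Wt_expand: "Wt C D j - 1 = (\<Sum>A\<in>UNIV - {{}}. \<Prod>i\<in>A. wdev C D i (j i))"
proof -
  have "Wt C D j = (\<Prod>i\<in>UNIV. wdev C D i (j i) + 1)"
    by (simp add: Wt_def wdev_def draw_count_def)
  also have "\<dots> = (\<Sum>A\<in>Pow UNIV. (\<Prod>i\<in>A. wdev C D i (j i)) * (\<Prod>i\<in>UNIV - A. 1))"
    by (rule prod_add) simp
  also have "\<dots> = (\<Sum>A\<in>UNIV. \<Prod>i\<in>A. wdev C D i (j i))" by simp
  also have "\<dots> = 1 + (\<Sum>A\<in>UNIV - {{}}. \<Prod>i\<in>A. wdev C D i (j i))"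
    by (subst sum.remove[of _ "{}"]) auto
  finally show ?thesis by simp
qed

lemma bstat_expand: "bstat C D x = (\<Sum>A\<in>UNIV - {{}}. bcomponent C A D x)"
  unfolding bstat_def bcomponent_def Wt_expand sum_distrib_right sum_distrib_left
  by (subst sum.swap) simp

lemma bcomponent_diff: "bcomponent C A D (\<lambda>j. x j - y j) = bcomponent C A D x - bcomponent C A D y"
  by (simp add: bcomponent_def right_diff_distrib sum_subtractf)

lemma bstat_diff: "bstat C D (\<lambda>j. x j - y j) = bstat C D x - bstat C D y"
  by (simp add: bstat_def right_diff_distrib sum_subtractf)

lemma bstat_sum: "bstat C D (\<lambda>j. \<Sum>s\<in>S. t s * x s j) = (\<Sum>s\<in>S. t s * bstat C D (x s))"
  unfolding bstat_def sum_distrib_left by (subst sum.swap) (simp add: mult_ac)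

lemma avg_wdev_prod:
  assumes "\<And>i. C i \<ge> 1" "j \<in> obs_cells C" "j' \<in> obs_cells C"
  shows "avg (draws C) (\<lambda>D. (\<Prod>i\<in>A. wdev C D i (j i)) * (\<Prod>i\<in>A. wdev C D i (j' i)))
    = (\<Prod>i\<in>A. (if j i = j' i then 1 else 0) - 1 / real (C i))"
  unfolding prod.distrib[symmetric] wdev_def
  using avg_draws_prod[where C=C and A=A and f="\<lambda>i e. (draw_count (C i) e (j i) - 1) * (draw_count (C i) e (j' i) - 1)"]
  using assms by (simp add: avg_draw_count_cov obs_cells_def del: One_nat_def cong: prod.cong)

text \<open>When all coordinates but one are frozen, the remaining weights enter the chaining factor
  in absolute value. By |u v| \<le> (u^2 + v^2) / 2 each coordinate contributes at most the variance
  1 - 1 / C_i of a count.\<close>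

lemma avg_abs_wdev_prod_le:
  assumes C: "\<And>i. C i \<ge> 1" and j: "j \<in> obs_cells C" "j' \<in> obs_cells C"
  shows "avg (draws C) (\<lambda>D. (\<Prod>i\<in>A. \<bar>wdev C D i (j i)\<bar>) * (\<Prod>i\<in>A. \<bar>wdev C D i (j' i)\<bar>)) \<le> 1"
proof -
  have "avg (draws C) (\<lambda>D. (\<Prod>i\<in>A. \<bar>wdev C D i (j i)\<bar>) * (\<Prod>i\<in>A. \<bar>wdev C D i (j' i)\<bar>))
    = (\<Prod>i\<in>A. avg (resamples (C i)) (\<lambda>e. \<bar>draw_count (C i) e (j i) - 1\<bar> * \<bar>draw_count (C i) e (j' i) - 1\<bar>))"
    unfolding prod.distrib[symmetric] wdev_def by (rule avg_draws_prod)
  also have "\<dots> \<le> (\<Prod>i\<in>A. 1)"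
  proof (rule prod_mono, intro conjI)
    fix i
    let ?u = "\<lambda>e. draw_count (C i) e (j i) - 1" and ?v = "\<lambda>e. draw_count (C i) e (j' i) - 1"
    show "0 \<le> avg (resamples (C i)) (\<lambda>e. \<bar>?u e\<bar> * \<bar>?v e\<bar>)" by (rule avg_nonneg) simp
    have "avg (resamples (C i)) (\<lambda>e. \<bar>?u e\<bar> * \<bar>?v e\<bar>) \<le> avg (resamples (C i)) (\<lambda>e. (1/2) * (?u e * ?u e) + (1/2) * (?v e * ?v e))"
    proof (rule avg_mono)
      fix e
      show "\<bar>?u e\<bar> * \<bar>?v e\<bar> \<le> (1/2) * (?u e * ?u e) + (1/2) * (?v e * ?v e)"
        using sum_squares_bound[of "\<bar>?u e\<bar>" "\<bar>?v e\<bar>"] by (simp add: power2_eq_square)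
    qed
    also have "\<dots> = (1/2) * (1 - 1 / real (C i)) + (1/2) * (1 - 1 / real (C i))"
    proof -
      have "j i \<in> {1..C i}" "j' i \<in> {1..C i}" using j by (auto simp: obs_cells_def)
      then show ?thesis unfolding avg_add avg_mult_left by (simp add: avg_draw_count_cov C del: One_nat_def)
    qed
    also have "\<dots> \<le> 1" by simp
    finally show "avg (resamples (C i)) (\<lambda>e. \<bar>?u e\<bar> * \<bar>?v e\<bar>) \<le> 1" .
  qed
  finally show ?thesis by simp
qed

definition slice :: "('k::finite \<Rightarrow> nat) \<Rightarrow> 'k \<Rightarrow> nat \<Rightarrow> ('k \<Rightarrow> nat) set" where
  "slice C i a = {j\<in>obs_cells C. j i = a}"

lemma sum_slices:
  "(\<Sum>a\<in>{1..C i}. \<Sum>j\<in>slice C i a. g j) = (\<Sum>j\<in>obs_cells C. g j)"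
  unfolding slice_def by (rule sum.group) (auto simp: finite_obs_cells, auto simp: obs_cells_def)

lemma (in chain) bcomponent_chain:
  fixes x :: "'f \<Rightarrow> ('k::finite \<Rightarrow> nat) \<Rightarrow> real"
  assumes C: "\<And>i. C i \<ge> 1" and i: "i \<in> A" and R: "\<And>j. R j \<ge> 0"
    and x: "\<And>f j q. f \<in> F \<Longrightarrow> j \<in> obs_cells C \<Longrightarrow> \<bar>x f j - x (net q f) j\<bar> \<le> K / 2 ^ q * R j"
  shows "avg (draws C) (\<lambda>D. sup_abs F (\<lambda>f. bcomponent C A D (x f) - bcomponent C A D (x (net q0 f))))
    \<le> 2 * tail q0 * (bscale C * sqrt (\<Sum>a\<in>{1..C i}. (\<Sum>j\<in>slice C i a. R j)\<^sup>2))"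
proof -
  let ?O = "obs_cells C"
  define s where "s = bscale C"
  have s: "s \<ge> 0" by (simp add: s_def bscale_def)
  \<comment> \<open>The product omits the coordinate i, so it is unchanged when D is replaced by D(i
    := e).\<close>
  define V where "V D j = (\<Prod>i'\<in>A-{i}. wdev C D i' (j i'))" for D j
  define z where "z D f a = s * (\<Sum>j\<in>slice C i a. V D j * x f j)" for D f a
  define r where "r D a = s * (\<Sum>j\<in>slice C i a. \<bar>V D j\<bar> * R j)" for D a
  have r0: "r D a \<ge> 0" for D a unfolding r_def using s R by (intro mult_nonneg_nonneg sum_nonneg) auto
  have b: "bcomponent C A (D(i := e)) (x f) = (\<Sum>a\<in>{1..C i}. (draw_count (C i) e a - 1) * z D f a)" for D e f
  proof -
    have P: "(\<Prod>i'\<in>A. wdev C (D(i := e)) i' (j i')) = (draw_count (C i) e (j i) - 1) * V D j" for j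
    proof -
      have "(\<Prod>i'\<in>A. wdev C (D(i := e)) i' (j i')) = wdev C (D(i := e)) i (j i) * (\<Prod>i'\<in>A-{i}. wdev C (D(i := e)) i' (j i'))"
        by (rule prod.remove) (use i in auto)
      also have "(\<Prod>i'\<in>A-{i}. wdev C (D(i := e)) i' (j i')) = V D j"
        unfolding V_def by (rule prod.cong) (auto simp: wdev_def)
      finally show ?thesis by (simp add: wdev_def)
    qed
    have "bcomponent C A (D(i := e)) (x f) = s * (\<Sum>a\<in>{1..C i}. \<Sum>j\<in>slice C i a. ((draw_count (C i) e (j i) - 1) * V D j) * x f j)"
      unfolding bcomponent_def P s_def by (simp only: sum_slices)
    also have "\<dots> = s * (\<Sum>a\<in>{1..C i}. \<Sum>j\<in>slice C i a. (draw_count (C i) e a - 1) * (V D j * x f j))"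
      by (intro arg_cong[where f="\<lambda>y. s * y"] sum.cong refl) (simp add: slice_def)
    also have "\<dots> = (\<Sum>a\<in>{1..C i}. (draw_count (C i) e a - 1) * z D f a)"
      unfolding z_def sum_distrib_left by (intro sum.cong refl) (simp add: mult_ac)
    finally show ?thesis .
  qed
  have "avg (draws C) (\<lambda>D. sup_abs F (\<lambda>f. bcomponent C A D (x f) - bcomponent C A D (x (net q0 f))))
    = avg (draws C) (\<lambda>D. avg (resamples (C i)) (\<lambda>e. sup_abs F (\<lambda>f. bcomponent C A (D(i := e)) (x f) - bcomponent C A (D(i := e)) (x (net q0 f)))))"
    unfolding draws_PiE
    by (rule avg_PiE_resample[where B="\<lambda>i. resamples (C i)", symmetric]) (auto simp: finite_resamples resamples_nonempty)
  also have "\<dots> = avg (draws C) (\<lambda>D. avg (resamples (C i)) (\<lambda>e. sup_abs F (\<lambda>f. \<Sum>a\<in>{1..C i}. (draw_count (C i) e a - 1) * (z D f a - z D (net q0 f) a))))"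
    unfolding b by (simp add: right_diff_distrib sum_subtractf)
  also have "\<dots> \<le> avg (draws C) (\<lambda>D. 2 * tail q0 * sqrt (\<Sum>a\<in>{1..C i}. (r D a)\<^sup>2))"
  proof (rule avg_mono, rule resample_chain)
    fix D f m q assume f: "f \<in> F" and m: "m \<in> {1..C i}"
    have "z D f m - z D (net q f) m = s * (\<Sum>j\<in>slice C i m. V D j * (x f j - x (net q f) j))"
      unfolding z_def by (simp add: right_diff_distrib sum_subtractf)
    then have "\<bar>z D f m - z D (net q f) m\<bar> = s * \<bar>\<Sum>j\<in>slice C i m. V D j * (x f j - x (net q f) j)\<bar>"
      using s by (simp add: abs_mult)
    also have "\<dots> \<le> s * (\<Sum>j\<in>slice C i m. \<bar>V D j * (x f j - x (net q f) j)\<bar>)"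
      using s by (intro mult_left_mono sum_abs)
    also have "\<dots> \<le> s * (\<Sum>j\<in>slice C i m. \<bar>V D j\<bar> * (K / 2 ^ q * R j))"
      unfolding abs_mult[of "V D _"] using s x[OF f]
      by (intro mult_left_mono sum_mono abs_ge_zero) (simp_all add: slice_def)
    also have "\<dots> = K / 2 ^ q * r D m"
      unfolding r_def by (simp add: sum_distrib_left mult_ac)
    finally show "\<bar>z D f m - z D (net q f) m\<bar> \<le> K / 2 ^ q * r D m" .
  qed (rule r0)
  also have "\<dots> = 2 * tail q0 * avg (draws C) (\<lambda>D. sqrt (\<Sum>a\<in>{1..C i}. (r D a)\<^sup>2))"
    by (rule avg_mult_left)
  also have "avg (draws C) (\<lambda>D. sqrt (\<Sum>a\<in>{1..C i}. (r D a)\<^sup>2)) \<le> sqrt (avg (draws C) (\<lambda>D. \<Sum>a\<in>{1..C i}. (r D a)\<^sup>2))"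
    by (rule avg_sqrt_le) (auto simp: finite_draws draws_nonempty sum_nonneg)
  also have "avg (draws C) (\<lambda>D. \<Sum>a\<in>{1..C i}. (r D a)\<^sup>2) = (\<Sum>a\<in>{1..C i}. avg (draws C) (\<lambda>D. (r D a)\<^sup>2))"
    by (rule avg_sum)
  also have "\<dots> \<le> (\<Sum>a\<in>{1..C i}. s\<^sup>2 * (\<Sum>j\<in>slice C i a. R j)\<^sup>2)"
  proof (rule sum_mono)
    fix a
    have "avg (draws C) (\<lambda>D. (r D a)\<^sup>2)
      = avg (draws C) (\<lambda>D. s\<^sup>2 * (\<Sum>j\<in>slice C i a. \<Sum>j'\<in>slice C i a. (R j * R j') * (\<bar>V D j\<bar> * \<bar>V D j'\<bar>)))"
      by (rule avg_cong) (simp add: r_def power_mult_distrib power2_eq_square sum_product mult_ac)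
    also have "\<dots> = s\<^sup>2 * (\<Sum>j\<in>slice C i a. \<Sum>j'\<in>slice C i a. (R j * R j') * avg (draws C) (\<lambda>D. \<bar>V D j\<bar> * \<bar>V D j'\<bar>))"
      by (simp only: avg_mult_left avg_sum)
    also have "\<dots> \<le> s\<^sup>2 * (\<Sum>j\<in>slice C i a. \<Sum>j'\<in>slice C i a. (R j * R j') * 1)"
    proof (intro mult_left_mono sum_mono)
      fix j j' assume "j \<in> slice C i a" "j' \<in> slice C i a"
      then show "avg (draws C) (\<lambda>D. \<bar>V D j\<bar> * \<bar>V D j'\<bar>) \<le> 1"
        unfolding V_def abs_prod by (intro avg_abs_wdev_prod_le C) (auto simp: slice_def)
    qed (auto simp: R)
    also have "\<dots> = s\<^sup>2 * (\<Sum>j\<in>slice C i a. R j)\<^sup>2"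
      by (simp add: power2_eq_square sum_product)
    finally show "avg (draws C) (\<lambda>D. (r D a)\<^sup>2) \<le> s\<^sup>2 * (\<Sum>j\<in>slice C i a. R j)\<^sup>2" .
  qed
  also have "sqrt (\<Sum>a\<in>{1..C i}. s\<^sup>2 * (\<Sum>j\<in>slice C i a. R j)\<^sup>2) = s * sqrt (\<Sum>a\<in>{1..C i}. (\<Sum>j\<in>slice C i a. R j)\<^sup>2)"
    using s by (simp add: sum_distrib_left[symmetric] real_sqrt_mult)
  finally show ?thesis using tail_nonneg[of q0] by (simp add: s_def mult_left_mono)
qed

lemma avg_slice_kernel:
  assumes "n \<ge> 1"
  shows "avg {1..n} (\<lambda>a. avg {1..n} (\<lambda>b. (if a = b then 1 else 0) + 1 / real n)) = 2 / real n"
  using assms by (simp add: avg_add avg_const) (simp add: avg_def divide_simps)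

text \<open>The covariance of the weights factorizes over A into the terms [j_i = j'_i] - 1 / C_i.
  Replacing the minus by a plus makes the kernel nonnegative without losing its order: its double
  average is the product of the 2 / C_i, which makes components with several factors small.\<close>

lemma avg_bcomponent_square_le:
  fixes x :: "('k::finite \<Rightarrow> nat) \<Rightarrow> real"
  assumes C: "\<And>i. C i \<ge> 1"
  shows "avg (draws C) (\<lambda>D. (bcomponent C A D x)\<^sup>2)
    \<le> real (minC C) * avg (obs_cells C) (\<lambda>j. avg (obs_cells C) (\<lambda>j'.
        (\<Prod>i\<in>A. (if j i = j' i then 1 else 0) + 1 / real (C i)) * \<bar>x j * x j'\<bar>))"
proof -
  let ?O = "obs_cells C"
  have sc: "(bscale C)\<^sup>2 * (real (prodC C) * real (prodC C)) = real (minC C)"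
    using prodC_pos[of C] C by (simp add: bscale_def power_divide power2_eq_square)
  have "avg (draws C) (\<lambda>D. (bcomponent C A D x)\<^sup>2)
    = avg (draws C) (\<lambda>D. (bscale C)\<^sup>2 * (\<Sum>j\<in>?O. \<Sum>j'\<in>?O. ((\<Prod>i\<in>A. wdev C D i (j i)) * (\<Prod>i\<in>A. wdev C D i (j' i))) * (x j * x j')))"
    by (rule avg_cong) (simp add: bcomponent_def power_mult_distrib power2_eq_square sum_product mult_ac)
  also have "\<dots> = (bscale C)\<^sup>2 * (\<Sum>j\<in>?O. \<Sum>j'\<in>?O. (\<Prod>i\<in>A. (if j i = j' i then 1 else 0) - 1 / real (C i)) * (x j * x j'))"
    unfolding avg_mult_left avg_sum avg_mult_right
    by (intro arg_cong[where f="\<lambda>y. (bscale C)\<^sup>2 * y"] sum.cong refl arg_cong2[where f="(*)"] avg_wdev_prod C)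
  also have "\<dots> \<le> (bscale C)\<^sup>2 * (\<Sum>j\<in>?O. \<Sum>j'\<in>?O. (\<Prod>i\<in>A. (if j i = j' i then 1 else 0) + 1 / real (C i)) * \<bar>x j * x j'\<bar>)"
  proof (intro mult_left_mono sum_mono)
    fix j j'
    have "(\<Prod>i\<in>A. (if j i = j' i then 1 else 0) - 1 / real (C i)) * (x j * x j')
      \<le> \<bar>\<Prod>i\<in>A. (if j i = j' i then 1 else 0) - 1 / real (C i)\<bar> * \<bar>x j * x j'\<bar>"
      by (rule order.trans[OF abs_ge_self]) (simp add: abs_mult)
    also have "\<dots> \<le> (\<Prod>i\<in>A. (if j i = j' i then 1 else 0) + 1 / real (C i)) * \<bar>x j * x j'\<bar>"
      unfolding abs_prod by (intro mult_right_mono prod_mono) (auto simp: abs_if)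
    finally show "(\<Prod>i\<in>A. (if j i = j' i then 1 else 0) - 1 / real (C i)) * (x j * x j')
      \<le> (\<Prod>i\<in>A. (if j i = j' i then 1 else 0) + 1 / real (C i)) * \<bar>x j * x j'\<bar>" .
  qed simp
  also have "\<dots> = real (minC C) * avg ?O (\<lambda>j. avg ?O (\<lambda>j'. (\<Prod>i\<in>A. (if j i = j' i then 1 else 0) + 1 / real (C i)) * \<bar>x j * x j'\<bar>))"
    unfolding sc[symmetric] avg_def card_obs_cells sum_divide_distrib[symmetric]
    using prodC_pos[of C] C by simp
  finally show ?thesis .
qed

lemma avg_kernel:
  fixes C :: "'k::finite \<Rightarrow> nat"
  assumes C: "\<And>i. C i \<ge> 1"
  shows "avg (obs_cells C) (\<lambda>j. avg (obs_cells C) (\<lambda>j'.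
        (\<Prod>i\<in>A. (if j i = j' i then 1 else 0) + 1 / real (C i)))) = (\<Prod>i\<in>A. 2 / real (C i))"
proof -
  have "avg (obs_cells C) (\<lambda>j. avg (obs_cells C) (\<lambda>j'.
        (\<Prod>i\<in>A. (if j i = j' i then 1 else 0) + 1 / real (C i))))
     = avg (obs_cells C) (\<lambda>j. \<Prod>i\<in>A. avg {1..C i} (\<lambda>b. (if j i = b then 1 else 0) + 1 / real (C i)))"
    by (intro avg_cong avg_obs_prod[where f="\<lambda>i b. (if _ i = b then 1 else 0) + 1 / real (C i)"] C)
  also have "\<dots> = (\<Prod>i\<in>A. avg {1..C i} (\<lambda>a. avg {1..C i} (\<lambda>b. (if a = b then 1 else 0) + 1 / real (C i))))"
    by (rule avg_obs_prod[where f="\<lambda>i a. avg {1..C i} (\<lambda>b. (if a = b then 1 else 0) + 1 / real (C i))"]) (rule C)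
  also have "\<dots> = (\<Prod>i\<in>A. 2 / real (C i))"
    by (intro prod.cong refl avg_slice_kernel C)
  finally show ?thesis .
qed

section \<open>Second moments of the components, averaged over draws and data\<close>

lemma integral_avg:
  fixes f :: "'c \<Rightarrow> 'a \<Rightarrow> 'b::{real_normed_field, second_countable_topology, banach}"
  assumes "\<And>a. a \<in> A \<Longrightarrow> integrable M (f a)"
  shows "(\<integral>\<omega>. avg A (\<lambda>a. f a \<omega>) \<partial>M) = avg A (\<lambda>a. \<integral>\<omega>. f a \<omega> \<partial>M)"
  unfolding avg_def by (simp add: assms)

lemma integrable_avg:
  fixes f :: "'c \<Rightarrow> 'a \<Rightarrow> 'b::{real_normed_field, second_countable_topology, banach}"
  assumes "\<And>a. a \<in> A \<Longrightarrow> integrable M (f a)"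
  shows "integrable M (\<lambda>\<omega>. avg A (\<lambda>a. f a \<omega>))"
  unfolding avg_def by (rule integrable_divide_zero) (rule Bochner_Integration.integrable_sum, rule assms)

lemma measurable_avg [measurable (raw)]:
  fixes f :: "'c \<Rightarrow> 'a \<Rightarrow> 'b::{real_normed_field, second_countable_topology}"
  assumes "\<And>a. a \<in> A \<Longrightarrow> f a \<in> borel_measurable M"
  shows "(\<lambda>\<omega>. avg A (\<lambda>a. f a \<omega>)) \<in> borel_measurable M"
  unfolding avg_def by (intro borel_measurable_divide borel_measurable_sum assms) auto

lemma integrable_mult_squares:
  fixes X Z :: "'a \<Rightarrow> real"
  assumes [measurable]: "X \<in> borel_measurable M" "Z \<in> borel_measurable M"
    and "integrable M (\<lambda>\<omega>. (X \<omega>)\<^sup>2)" "integrable M (\<lambda>\<omega>. (Z \<omega>)\<^sup>2)"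
  shows "integrable M (\<lambda>\<omega>. X \<omega> * Z \<omega>)"
proof (rule Bochner_Integration.integrable_bound)
  show "integrable M (\<lambda>\<omega>. (X \<omega>)\<^sup>2 + (Z \<omega>)\<^sup>2)" using assms by auto
  show "AE \<omega> in M. norm (X \<omega> * Z \<omega>) \<le> norm ((X \<omega>)\<^sup>2 + (Z \<omega>)\<^sup>2)"
  proof (rule AE_I2)
    fix \<omega>
    have "2 * (\<bar>X \<omega>\<bar> * \<bar>Z \<omega>\<bar>) \<le> (X \<omega>)\<^sup>2 + (Z \<omega>)\<^sup>2" using sum_squares_bound[of "\<bar>X \<omega>\<bar>" "\<bar>Z \<omega>\<bar>"] by simp
    then show "norm (X \<omega> * Z \<omega>) \<le> norm ((X \<omega>)\<^sup>2 + (Z \<omega>)\<^sup>2)"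
      using mult_nonneg_nonneg[OF abs_ge_zero[of "X \<omega>"] abs_ge_zero[of "Z \<omega>"]] unfolding real_norm_def abs_mult by linarith
  qed
qed measurable

lemma integral_abs_mult_le:
  fixes X Z :: "'a \<Rightarrow> real"
  assumes [measurable]: "X \<in> borel_measurable M" "Z \<in> borel_measurable M"
    and i: "integrable M (\<lambda>\<omega>. (X \<omega>)\<^sup>2)" "integrable M (\<lambda>\<omega>. (Z \<omega>)\<^sup>2)"
    and q: "(\<integral>\<omega>. (X \<omega>)\<^sup>2 \<partial>M) \<le> q" "(\<integral>\<omega>. (Z \<omega>)\<^sup>2 \<partial>M) \<le> q"
  shows "(\<integral>\<omega>. \<bar>X \<omega> * Z \<omega>\<bar> \<partial>M) \<le> q"
proof -
  have "(\<integral>\<omega>. \<bar>X \<omega> * Z \<omega>\<bar> \<partial>M) \<le> (\<integral>\<omega>. (1/2) * (X \<omega>)\<^sup>2 + (1/2) * (Z \<omega>)\<^sup>2 \<partial>M)"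
  proof (rule integral_mono)
    show "integrable M (\<lambda>\<omega>. \<bar>X \<omega> * Z \<omega>\<bar>)" by (intro integrable_abs integrable_mult_squares assms)
    show "integrable M (\<lambda>\<omega>. (1/2) * (X \<omega>)\<^sup>2 + (1/2) * (Z \<omega>)\<^sup>2)" using i by auto
    fix \<omega>
    show "\<bar>X \<omega> * Z \<omega>\<bar> \<le> (1/2) * (X \<omega>)\<^sup>2 + (1/2) * (Z \<omega>)\<^sup>2"
      using sum_squares_bound[of "\<bar>X \<omega>\<bar>" "\<bar>Z \<omega>\<bar>"] by (simp add: abs_mult)
  qed
  also have "\<dots> = (1/2) * (\<integral>\<omega>. (X \<omega>)\<^sup>2 \<partial>M) + (1/2) * (\<integral>\<omega>. (Z \<omega>)\<^sup>2 \<partial>M)"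
    using i by simp
  also have "\<dots> \<le> q" using q by simp
  finally show ?thesis .
qed

text \<open>The entries enter only through a common bound q on their second moments. All smallness
  for larger A comes from the weights.\<close>

lemma integral_bcomponent_square_le:
  fixes X :: "('k::finite \<Rightarrow> nat) \<Rightarrow> 'a \<Rightarrow> real"
  assumes C: "\<And>i. C i \<ge> 1"
    and Xm: "\<And>j. j \<in> obs_cells C \<Longrightarrow> X j \<in> borel_measurable M"
    and Xi: "\<And>j. j \<in> obs_cells C \<Longrightarrow> integrable M (\<lambda>\<omega>. (X j \<omega>)\<^sup>2)"
    and q: "\<And>j. j \<in> obs_cells C \<Longrightarrow> (\<integral>\<omega>. (X j \<omega>)\<^sup>2 \<partial>M) \<le> q"
  shows "integrable M (\<lambda>\<omega>. avg (draws C) (\<lambda>D. (bcomponent C A D (\<lambda>j. X j \<omega>))\<^sup>2))"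
    and "(\<integral>\<omega>. avg (draws C) (\<lambda>D. (bcomponent C A D (\<lambda>j. X j \<omega>))\<^sup>2) \<partial>M)
      \<le> q * real (minC C) * (\<Prod>i\<in>A. 2 / real (C i))"
proof -
  let ?O = "obs_cells C"
  let ?c = "\<lambda>j j'. \<Prod>i\<in>A. (if j i = j' i then 1 else 0) + 1 / real (C i)"
  have pi: "integrable M (\<lambda>\<omega>. X j \<omega> * X j' \<omega>)" if "j \<in> ?O" "j' \<in> ?O" for j j'
    using that by (intro integrable_mult_squares Xm Xi)
  have "(\<lambda>\<omega>. (bcomponent C A D (\<lambda>j. X j \<omega>))\<^sup>2) = (\<lambda>\<omega>. \<Sum>j\<in>?O. \<Sum>j'\<in>?O. ((bscale C)\<^sup>2 * (\<Prod>i\<in>A. wdev C D i (j i)) * (\<Prod>i\<in>A. wdev C D i (j' i))) * (X j \<omega> * X j' \<omega>))" for D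
    by (rule ext) (simp add: bcomponent_def power_mult_distrib power2_eq_square sum_product sum_distrib_left mult_ac)
  then have "integrable M (\<lambda>\<omega>. (bcomponent C A D (\<lambda>j. X j \<omega>))\<^sup>2)" for D
    by (simp add: pi)
  then show int: "integrable M (\<lambda>\<omega>. avg (draws C) (\<lambda>D. (bcomponent C A D (\<lambda>j. X j \<omega>))\<^sup>2))"
    by (rule integrable_avg)
  have int2: "integrable M (\<lambda>\<omega>. avg ?O (\<lambda>j. avg ?O (\<lambda>j'. ?c j j' * \<bar>X j \<omega> * X j' \<omega>\<bar>)))"
    by (intro integrable_avg integrable_mult_right integrable_abs pi)
  have c0: "?c j j' \<ge> 0" for j j' by (intro prod_nonneg) auto
  have "(\<integral>\<omega>. avg (draws C) (\<lambda>D. (bcomponent C A D (\<lambda>j. X j \<omega>))\<^sup>2) \<partial>M)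
    \<le> (\<integral>\<omega>. real (minC C) * avg ?O (\<lambda>j. avg ?O (\<lambda>j'. ?c j j' * \<bar>X j \<omega> * X j' \<omega>\<bar>)) \<partial>M)"
    by (rule integral_mono[OF int integrable_mult_right[OF int2]]) (rule avg_bcomponent_square_le[OF C])
  also have "\<dots> = real (minC C) * avg ?O (\<lambda>j. avg ?O (\<lambda>j'. ?c j j' * (\<integral>\<omega>. \<bar>X j \<omega> * X j' \<omega>\<bar> \<partial>M)))"
    by (simp add: integral_avg integrable_avg pi cong: avg_cong)
  also have "\<dots> \<le> real (minC C) * avg ?O (\<lambda>j. avg ?O (\<lambda>j'. ?c j j' * q))"
    by (intro mult_left_mono avg_mono integral_abs_mult_le Xm Xi q c0) auto
  also have "\<dots> = q * real (minC C) * (\<Prod>i\<in>A. 2 / real (C i))"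
    unfolding avg_mult_right avg_kernel[OF C] by simp
  finally show "(\<integral>\<omega>. avg (draws C) (\<lambda>D. (bcomponent C A D (\<lambda>j. X j \<omega>))\<^sup>2) \<partial>M)
      \<le> q * real (minC C) * (\<Prod>i\<in>A. 2 / real (C i))" .
qed

subsection \<open>Dissociated exchangeable arrays\<close>

text \<open>Exchangeability speaks about permutations of all indices, while the arguments below move
  finitely many. In the union B of A and its image, the complements of A and of the image have
  equally many points and can be matched; outside B the permutation is the identity.\<close>

lemma extend_to_bij_betw:
  fixes f :: "'c \<Rightarrow> 'c"
  assumes "finite A" "inj_on f A" "A \<subseteq> U" "f ` A \<subseteq> U"
  obtains p where "bij_betw p U U" "\<And>a. a \<in> A \<Longrightarrow> p a = f a"
proof -
  define B where "B = A \<union> f ` A"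
  have B: "finite B" "A \<subseteq> B" "f ` A \<subseteq> B" "B \<subseteq> U" using assms by (auto simp: B_def)
  have "card (B - A) = card (B - f ` A)"
    using B assms by (simp add: card_Diff_subset card_image)
  then obtain g where g: "bij_betw g (B - A) (B - f ` A)"
    using B(1) by (meson finite_Diff finite_same_card_bij)
  define p where "p x = (if x \<in> A then f x else if x \<in> B then g x else x)" for x
  have "bij_betw p A (f ` A)"
    using assms(2) by (auto simp: p_def bij_betw_def inj_on_def)
  moreover have "bij_betw p (B - A) (B - f ` A)"
    using g by (subst bij_betw_cong[of _ _ g]) (auto simp: p_def)
  moreover have "bij_betw p (U - B) (U - B)"
    using B by (subst bij_betw_cong[of _ _ id]) (auto simp: p_def)
  ultimately have "bij_betw p ((A \<union> (B - A)) \<union> (U - B)) ((f ` A \<union> (B - f ` A)) \<union> (U - B))"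
    using B by (intro bij_betw_combine) auto
  then have "bij_betw p U U" using B by (simp add: Un_absorb1 Un_absorb2)
  moreover have "p a = f a" if "a \<in> A" for a using that by (simp add: p_def)
  ultimately show ?thesis using that by blast
qed

lemma avg_coincidence:
  fixes C :: "'k::finite \<Rightarrow> nat"
  assumes C: "\<And>i. C i \<ge> 1" and j: "j \<in> obs_cells C"
  shows "avg (obs_cells C) (\<lambda>l. if j c = l c then 1 else 0 :: real) = 1 / real (C c)"
proof -
  have "avg (obs_cells C) (\<lambda>l. \<Prod>i\<in>{c}. (if j i = l i then 1 else 0 :: real)) = (\<Prod>i\<in>{c}. avg {1..C i} (\<lambda>a. if j i = a then 1 else 0))"
    by (rule avg_obs_prod[where f="\<lambda>i a. if j i = a then 1 else 0"]) (rule C)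
  then show ?thesis using j by (simp add: avg_def obs_cells_def)
qed

text \<open>Common coordinates are counted instead of merely detected. The count dominates the
  indicator of a coincidence, and by linearity its average over cells is a sum of terms 1 /
  C_c.\<close>

definition coinc :: "'k::finite set \<Rightarrow> ('k \<Rightarrow> nat) \<Rightarrow> ('k \<Rightarrow> nat) \<Rightarrow> real" where
  "coinc I j l = (\<Sum>c\<in>I. if j c = l c then 1 else 0)"

lemma coinc_nonneg: "coinc I j l \<ge> 0"
  unfolding coinc_def by (intro sum_nonneg) auto

lemma coinc_ge1: "c \<in> I \<Longrightarrow> j c = l c \<Longrightarrow> coinc I j l \<ge> 1"
proof -
  assume c: "c \<in> I" "j c = l c"
  have "(if j c = l c then 1 else 0 :: real) \<le> coinc I j l"
    unfolding coinc_def by (rule member_le_sum[OF c(1)]) (auto simp: finite_subset[OF subset_UNIV])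
  then show ?thesis using c by simp
qed

lemma avg_coinc:
  assumes "\<And>i. C i \<ge> 1" "j \<in> obs_cells C"
  shows "avg (obs_cells C) (coinc UNIV j) = (\<Sum>c\<in>UNIV. 1 / real (C c))"
  unfolding coinc_def by (subst avg_sum) (simp add: avg_coincidence[OF assms])

locale dissociated_array = prob_space M
  for M :: "'a measure"
    and N :: "('k::finite \<Rightarrow> nat) \<Rightarrow> 'a \<Rightarrow> nat"
    and Y :: "nat \<Rightarrow> ('k \<Rightarrow> nat) \<Rightarrow> 'a \<Rightarrow> 'v::topological_space" +
  assumes N_meas [measurable]: "\<And>j. N j \<in> measurable M (count_space UNIV)"
    and Y_meas [measurable]: "\<And>l j. Y l j \<in> borel_measurable M"
    and A1: "A1 M N Y"
begin

definition cell :: "('k \<Rightarrow> nat) \<Rightarrow> 'a \<Rightarrow> nat \<times> (nat \<Rightarrow> 'v)" where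
  "cell j \<omega> = (N j \<omega>, \<lambda>l. Y l j \<omega>)"

lemma measurable_cell [measurable]: "cell j \<in> measurable M cellspace"
  unfolding cell_def cellspace_def by (intro measurable_Pair N_meas measurable_PiM_single') auto

lemma arr_eq: "arr N Y \<omega> = (\<lambda>j\<in>Cells. cell j \<omega>)"
  by (simp add: arr_def cell_def)

lemma measurable_arr [measurable]: "arr N Y \<in> measurable M (\<Pi>\<^sub>M j\<in>Cells. cellspace)"
  unfolding arr_eq by (intro measurable_restrict measurable_cell)

lemma exch_integral:
  fixes \<Phi> :: "(('k \<Rightarrow> nat) \<Rightarrow> nat \<times> (nat \<Rightarrow> 'v)) \<Rightarrow> real"
  assumes p: "\<And>i. bij_betw (p i) {1..} {1..}" and [measurable]: "\<Phi> \<in> borel_measurable (\<Pi>\<^sub>M j\<in>Cells. cellspace)"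
  shows "(\<integral>\<omega>. \<Phi> (arr N Y \<omega>) \<partial>M) = (\<integral>\<omega>. \<Phi> (\<lambda>j\<in>Cells. arr N Y \<omega> (\<lambda>i. p i (j i))) \<partial>M)"
proof -
  have pc: "(\<lambda>i. p i (j i)) \<in> Cells" if "j \<in> Cells" for j
    using that p by (auto simp: Cells_def bij_betw_def)
  have [measurable]: "(\<lambda>\<omega>. \<lambda>j\<in>Cells. arr N Y \<omega> (\<lambda>i. p i (j i))) \<in> measurable M (\<Pi>\<^sub>M j\<in>Cells. cellspace)"
    by (intro measurable_restrict) (simp add: arr_eq pc)
  have "distr M (\<Pi>\<^sub>M j\<in>Cells. cellspace) (arr N Y)
        = distr M (\<Pi>\<^sub>M j\<in>Cells. cellspace) (\<lambda>\<omega>. \<lambda>j\<in>Cells. arr N Y \<omega> (\<lambda>i. p i (j i)))"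
    using A1 p unfolding A1_def by blast
  then have "integral\<^sup>L (distr M (\<Pi>\<^sub>M j\<in>Cells. cellspace) (arr N Y)) \<Phi> =
    integral\<^sup>L (distr M (\<Pi>\<^sub>M j\<in>Cells. cellspace) (\<lambda>\<omega>. \<lambda>j\<in>Cells. arr N Y \<omega> (\<lambda>i. p i (j i)))) \<Phi>" by simp
  then show ?thesis by (simp add: integral_distr)
qed

text \<open>Translates by 2 of \<open>one_cell\<close> and \<open>two_cell i\<close>. The original
  pair has all coordinates at most 2, the translated pair has all coordinates at least 3, so the
  dissociation assumption separates the two pairs.\<close>

definition three_cell :: "'k \<Rightarrow> nat" where "three_cell = (\<lambda>_. 3)"
definition four_cell :: "'k \<Rightarrow> 'k \<Rightarrow> nat" where "four_cell i = (\<lambda>i'. if i' = i then 3 else 4)"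

lemma special_cells: "one_cell \<in> Cells" "two_cell i \<in> Cells" "three_cell \<in> Cells" "four_cell i \<in> Cells"
  by (auto simp: Cells_def one_cell_def two_cell_def three_cell_def four_cell_def)

lemma measurable_component_pair:
  assumes [measurable]: "case_prod h \<in> borel_measurable (cellspace \<Otimes>\<^sub>M cellspace)"
    and "a \<in> I" "b \<in> I"
  shows "(\<lambda>x. h (x a) (x b)) \<in> borel_measurable (\<Pi>\<^sub>M j\<in>I. cellspace)"
proof -
  have "(\<lambda>x. case_prod h (x a, x b)) \<in> borel_measurable (\<Pi>\<^sub>M j\<in>I. cellspace)"
    using assms(2,3) by measurable
  then show ?thesis by simp
qed

text \<open>Overwriting coordinate i of the second cell lets j and j' range independently over all
  observed cells. Averages over pairs that share coordinate i thus become averages over a full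
  product set.\<close>

definition pairf :: "(nat \<times> (nat \<Rightarrow> 'v) \<Rightarrow> nat \<times> (nat \<Rightarrow> 'v) \<Rightarrow> real) \<Rightarrow> 'k \<Rightarrow> ('k \<Rightarrow> nat) \<Rightarrow> ('k \<Rightarrow> nat) \<Rightarrow> 'a \<Rightarrow> real" where
  "pairf h i j j' \<omega> = h (cell j \<omega>) (cell (j'(i := j i)) \<omega>)"

lemma measurable_pairf:
  assumes "case_prod h \<in> borel_measurable (cellspace \<Otimes>\<^sub>M cellspace)"
  shows "pairf h i j j' \<in> borel_measurable M"
proof -
  have "(\<lambda>\<omega>. case_prod h (cell j \<omega>, cell (j'(i := j i)) \<omega>)) \<in> borel_measurable M"
    using assms by measurable
  then show ?thesis by (simp add: pairf_def[abs_def])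
qed

lemma pairf_special: "pairf h i one_cell (\<lambda>_. 2) \<omega> = h (cell one_cell \<omega>) (cell (two_cell i) \<omega>)"
proof -
  have "(\<lambda>_. 2)(i := one_cell i) = two_cell i" by (auto simp: one_cell_def two_cell_def)
  then show ?thesis by (simp add: pairf_def)
qed

text \<open>A permutation of each axis carries 1 to j c and, for c different from i, 2 to j' c. In
  coordinate i only the image of 1 is prescribed, since \<open>pairf\<close> ignores j' there and
  \<open>two_cell i\<close> equals 1 there.\<close>

lemma pairf_expectation:
  assumes h: "case_prod h \<in> borel_measurable (cellspace \<Otimes>\<^sub>M cellspace)"
    and j: "j \<in> Cells" "j' \<in> Cells" "\<And>c. c \<noteq> i \<Longrightarrow> j c \<noteq> j' c"
  shows "(\<integral>\<omega>. pairf h i j j' \<omega> \<partial>M) = (\<integral>\<omega>. h (cell one_cell \<omega>) (cell (two_cell i) \<omega>) \<partial>M)"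
proof -
  have "\<exists>p::nat \<Rightarrow> nat. bij_betw p {1..} {1..} \<and> p 1 = j c \<and> (c \<noteq> i \<longrightarrow> p 2 = j' c)" for c
  proof (cases "c = i")
    case True
    obtain p :: "nat \<Rightarrow> nat" where "bij_betw p {1..} {1..}" "\<And>a. a \<in> {1} \<Longrightarrow> p a = (\<lambda>_. j c) a"
    proof (rule extend_to_bij_betw[of "{1::nat}" "\<lambda>_. j c" "{1..}"])
      show "(\<lambda>_. j c) ` {1::nat} \<subseteq> {1..}" using j by (auto simp: Cells_def)
    qed (simp_all only: finite.intros inj_on_empty inj_on_insert, auto)
    then show ?thesis using True by (intro exI[of _ p]) auto
  next
    case False
    obtain p :: "nat \<Rightarrow> nat" where "bij_betw p {1..} {1..}" "\<And>a. a \<in> {1,2} \<Longrightarrow> p a = (\<lambda>a. if a = 1 then j c else j' c) a"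
      by (rule extend_to_bij_betw[of "{1,2::nat}" "\<lambda>a. if a = 1 then j c else j' c" "{1..}"])
         (use j(1,2) j(3)[OF False] in \<open>auto simp: Cells_def inj_on_def\<close>)
    then show ?thesis by (intro exI[of _ p]) auto
  qed
  then obtain p :: "'k \<Rightarrow> nat \<Rightarrow> nat" where p: "\<And>c. bij_betw (p c) {1..} {1..}" "\<And>c. p c 1 = j c" "\<And>c. c \<noteq> i \<Longrightarrow> p c 2 = j' c"
    by metis
  have e: "(\<lambda>c. p c (one_cell c)) = j" "(\<lambda>c. p c (two_cell i c)) = j'(i := j i)"
    using p by (auto simp: one_cell_def two_cell_def)
  have jc: "j'(i := j i) \<in> Cells" using j by (auto simp: Cells_def)
  have "(\<integral>\<omega>. (\<lambda>x. h (x one_cell) (x (two_cell i))) (arr N Y \<omega>) \<partial>M)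
    = (\<integral>\<omega>. (\<lambda>x. h (x one_cell) (x (two_cell i))) (\<lambda>j\<in>Cells. arr N Y \<omega> (\<lambda>i. p i (j i))) \<partial>M)"
    by (rule exch_integral) (intro p(1) measurable_component_pair h special_cells)+
  then show ?thesis using j(1) jc by (simp add: special_cells e arr_eq pairf_def)
qed

lemma integral_cell:
  assumes g: "g \<in> borel_measurable cellspace" and j: "j \<in> Cells"
  shows "(\<integral>\<omega>. g (cell j \<omega>) \<partial>M) = (\<integral>\<omega>. g (cell one_cell \<omega>) \<partial>M :: real)"
proof -
  have "case_prod (\<lambda>a b. g a) \<in> borel_measurable (cellspace \<Otimes>\<^sub>M cellspace)"
    using g by measurable
  \<comment> \<open>The function ignores its second argument; the successor cell is only a companion
    that differs from j in every coordinate.\<close>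
  from pairf_expectation[OF this j, of "\<lambda>c. Suc (j c)"] show ?thesis
    by (simp add: pairf_def Cells_def)
qed

text \<open>Four distinct indices on each axis can be carried to 1, 2, 3, 4 by a permutation. The
  general quadruple is thereby reduced to the standard one, whose two pairs lie in independent
  blocks.\<close>

lemma pairf_bounded_indep:
  assumes h: "case_prod h \<in> borel_measurable (cellspace \<Otimes>\<^sub>M cellspace)"
    and b: "\<And>x y. \<bar>h x y\<bar> \<le> B"
    and j: "j \<in> Cells" "j' \<in> Cells" "l \<in> Cells" "l' \<in> Cells"
    and dist: "\<And>c. distinct [j c, j' c, l c, l' c]"
  shows "(\<integral>\<omega>. pairf h i j j' \<omega> * pairf h i l l' \<omega> \<partial>M) = (\<integral>\<omega>. h (cell one_cell \<omega>) (cell (two_cell i) \<omega>) \<partial>M)\<^sup>2"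
proof -
  define f where "f c a = (if a = 1 then j c else if a = 2 then j' c else if a = 3 then l c else l' c)" for c and a :: nat
  have "\<exists>p::nat \<Rightarrow> nat. bij_betw p {1..} {1..} \<and> p 1 = j c \<and> p 2 = j' c \<and> p 3 = l c \<and> p 4 = l' c" for c
  proof -
    obtain p :: "nat \<Rightarrow> nat" where "bij_betw p {1..} {1..}" "\<And>a. a \<in> {1,2,3,4} \<Longrightarrow> p a = f c a"
      by (rule extend_to_bij_betw[of "{1,2,3,4::nat}" "f c" "{1..}"])
         (use j dist[of c] in \<open>auto simp: Cells_def f_def inj_on_def split: if_splits\<close>)
    then show ?thesis by (intro exI[of _ p]) (auto simp: f_def)
  qed
  then obtain p :: "'k \<Rightarrow> nat \<Rightarrow> nat" where p: "\<And>c. bij_betw (p c) {1..} {1..}" "\<And>c. p c 1 = j c" "\<And>c. p c 2 = j' c"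
      "\<And>c. p c 3 = l c" "\<And>c. p c 4 = l' c"
    by metis
  have e: "(\<lambda>c. p c (one_cell c)) = j" "(\<lambda>c. p c (two_cell i c)) = j'(i := j i)"
     "(\<lambda>c. p c (three_cell c)) = l" "(\<lambda>c. p c (four_cell i c)) = l'(i := l i)"
    using p by (auto simp: one_cell_def two_cell_def three_cell_def four_cell_def)
  have jc: "j'(i := j i) \<in> Cells" "l'(i := l i) \<in> Cells" using j by (auto simp: Cells_def)
  define \<Phi> where "\<Phi> x = h (x one_cell) (x (two_cell i)) * h (x three_cell) (x (four_cell i))" for x
  have \<Phi>: "\<Phi> \<in> borel_measurable (\<Pi>\<^sub>M j\<in>Cells. cellspace)"
    unfolding \<Phi>_def by (intro borel_measurable_times measurable_component_pair h special_cells)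
  have "(\<integral>\<omega>. pairf h i j j' \<omega> * pairf h i l l' \<omega> \<partial>M) = (\<integral>\<omega>. \<Phi> (\<lambda>j\<in>Cells. arr N Y \<omega> (\<lambda>i. p i (j i))) \<partial>M)"
    using j jc by (simp add: special_cells e arr_eq pairf_def \<Phi>_def)
  also have "\<dots> = (\<integral>\<omega>. \<Phi> (arr N Y \<omega>) \<partial>M)"
    by (rule exch_integral[symmetric]) (rule p(1), rule \<Phi>)
  also have "\<dots> = (\<integral>\<omega>. pairf h i one_cell (\<lambda>_. 2) \<omega> * pairf h i three_cell (\<lambda>_. 4) \<omega> \<partial>M)"
  proof -
    have "(\<lambda>_. 4)(i := three_cell i) = four_cell i" by (auto simp: three_cell_def four_cell_def)
    then show ?thesis by (simp only: \<Phi>_def arr_eq restrict_apply' special_cells pairf_special) (simp add: pairf_def)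
  qed
  also have "\<dots> = (\<integral>\<omega>. pairf h i one_cell (\<lambda>_. 2) \<omega> \<partial>M) * (\<integral>\<omega>. pairf h i three_cell (\<lambda>_. 4) \<omega> \<partial>M)"
  proof (rule indep_var_lebesgue_integral)
    \<comment> \<open>Dissociation is used at the corner cell (2, ..., 2): cells with coordinates up
      to 2 against cells with coordinates from 3 on.\<close>
    let ?O1 = "obs_cells (\<lambda>_::'k. 2)" and ?O2 = "{j::'k \<Rightarrow> nat. \<forall>i. (\<lambda>_. 2) i + 1 \<le> j i}"
    have in1: "one_cell \<in> ?O1" "two_cell i \<in> ?O1" by (auto simp: obs_cells_def one_cell_def two_cell_def)
    have in2: "three_cell \<in> ?O2" "four_cell i \<in> ?O2" by (auto simp: three_cell_def four_cell_def)
    have ind: "indep_var (\<Pi>\<^sub>M j\<in>?O1. cellspace) (\<lambda>\<omega>. restrict (arr N Y \<omega>) ?O1)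
          (\<Pi>\<^sub>M j\<in>?O2. cellspace) (\<lambda>\<omega>. restrict (arr N Y \<omega>) ?O2)"
      using A1 unfolding A1_def by (auto dest!: spec[of _ "\<lambda>_::'k. 2"])
    have "indep_var borel ((\<lambda>x. h (x one_cell) (x (two_cell i))) \<circ> (\<lambda>\<omega>. restrict (arr N Y \<omega>) ?O1))
        borel ((\<lambda>x. h (x three_cell) (x (four_cell i))) \<circ> (\<lambda>\<omega>. restrict (arr N Y \<omega>) ?O2))"
      by (rule indep_var_compose[OF ind]) (intro measurable_component_pair h in1 in2)+
    moreover have "(\<lambda>x. h (x one_cell) (x (two_cell i))) \<circ> (\<lambda>\<omega>. restrict (arr N Y \<omega>) ?O1) = pairf h i one_cell (\<lambda>_. 2)"
      by (rule ext) (simp only: o_def arr_eq restrict_apply' special_cells in1 pairf_special)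
    moreover have "(\<lambda>x. h (x three_cell) (x (four_cell i))) \<circ> (\<lambda>\<omega>. restrict (arr N Y \<omega>) ?O2) = pairf h i three_cell (\<lambda>_. 4)"
    proof (rule ext)
      fix \<omega>
      have "(\<lambda>_. 4)(i := three_cell i) = four_cell i" by (auto simp: three_cell_def four_cell_def)
      then show "((\<lambda>x. h (x three_cell) (x (four_cell i))) \<circ> (\<lambda>\<omega>. restrict (arr N Y \<omega>) ?O2)) \<omega> = pairf h i three_cell (\<lambda>_. 4) \<omega>"
        by (simp only: o_def arr_eq restrict_apply' special_cells in2 pairf_def)
    qed
    ultimately show "indep_var borel (pairf h i one_cell (\<lambda>_. 2)) borel (pairf h i three_cell (\<lambda>_. 4))" by simp
    show "integrable M (pairf h i one_cell (\<lambda>_. 2))" "integrable M (pairf h i three_cell (\<lambda>_. 4))"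
      by (auto intro!: integrable_const_bound[where B=B] measurable_pairf h simp: pairf_def b)
  qed
  also have "(\<integral>\<omega>. pairf h i one_cell (\<lambda>_. 2) \<omega> \<partial>M) = (\<integral>\<omega>. h (cell one_cell \<omega>) (cell (two_cell i) \<omega>) \<partial>M)"
    by (rule pairf_expectation[OF h]) (auto simp: Cells_def one_cell_def)
  also have "(\<integral>\<omega>. pairf h i three_cell (\<lambda>_. 4) \<omega> \<partial>M) = (\<integral>\<omega>. h (cell one_cell \<omega>) (cell (two_cell i) \<omega>) \<partial>M)"
    by (rule pairf_expectation[OF h]) (auto simp: Cells_def three_cell_def)
  finally show ?thesis by (simp add: power2_eq_square)
qed

text \<open>Quadruples of cells with pairwise distinct coordinates are uncorrelated in pairs, and all
  other quadruples are asymptotically negligible.\<close>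

lemma pairf_lln:
  fixes i :: 'k
  assumes h: "case_prod h \<in> borel_measurable (cellspace \<Otimes>\<^sub>M cellspace)"
    and b: "\<And>x y. \<bar>h x y\<bar> \<le> B" and C: "\<And>i. C i \<ge> 1"
  defines "\<theta> \<equiv> \<integral>\<omega>. h (cell one_cell \<omega>) (cell (two_cell i) \<omega>) \<partial>M"
  shows "(\<integral>\<omega>. (avg (obs_cells C) (\<lambda>j. avg (obs_cells C) (\<lambda>j'. pairf h i j j' \<omega>)) - \<theta>)\<^sup>2 \<partial>M)
    \<le> 4 * B\<^sup>2 * (6 * (\<Sum>c\<in>UNIV. 1 / real (C c)))"
proof -
  let ?O = "obs_cells C"
  note fO = finite_obs_cells[of C] and nO = obs_cells_nonempty[of C, OF C]
  have OC: "?O \<subseteq> Cells" by (auto simp: obs_cells_def Cells_def)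
  have B0: "B \<ge> 0" using b[of undefined undefined] by linarith
  have int: "integrable M (pairf h i j j')" for j j'
    by (intro integrable_const_bound[where B=B] measurable_pairf h) (auto simp: pairf_def b)
  have thB: "\<bar>\<theta>\<bar> \<le> B"
  proof -
    have "\<bar>\<theta>\<bar> \<le> (\<integral>\<omega>. \<bar>pairf h i one_cell (\<lambda>_. 2) \<omega>\<bar> \<partial>M)"
      unfolding \<theta>_def pairf_special[symmetric] by (rule integral_abs_bound)
    also have "\<dots> \<le> (\<integral>\<omega>. B \<partial>M)"
      by (intro integral_mono integrable_abs int) (auto simp: pairf_def b)
    finally show ?thesis by (simp add: prob_space)
  qed
  define Z where "Z j j' \<omega> = pairf h i j j' \<omega> - \<theta>" for j j' \<omega>
  have Zb: "\<bar>Z j j' \<omega>\<bar> \<le> 2 * B" for j j' \<omega>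
    using b[of "cell j \<omega>" "cell (j'(i := j i)) \<omega>"] thB unfolding Z_def pairf_def by linarith
  have ZZb: "\<bar>Z j j' \<omega> * Z l l' \<omega>\<bar> \<le> 4 * B\<^sup>2" for j j' l l' \<omega>
    using mult_mono[OF Zb[of j j' \<omega>] Zb[of l l' \<omega>]] B0 by (simp add: abs_mult power2_eq_square)
  have Zm: "Z j j' \<in> borel_measurable M" for j j'
    unfolding Z_def by (intro borel_measurable_diff measurable_pairf h) simp
  have intZ: "integrable M (\<lambda>\<omega>. Z j j' \<omega> * Z l l' \<omega>)" for j j' l l'
    by (intro integrable_const_bound[where B="4 * B\<^sup>2"] borel_measurable_times Zm) (use ZZb in simp)
  \<comment> \<open>One summand for each of the six pairs among four cells. As soon as two of the
    cells share a coordinate, u is at least 1 and absorbs the crude bound 4 B^2; the average of the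
    six summands gives the factor 6 of the statement.\<close>
  define u where "u j j' l l' = coinc UNIV j j' + coinc UNIV j l + coinc UNIV j l' + coinc UNIV j' l + coinc UNIV j' l' + coinc UNIV l l'"
    for j j' l l' :: "'k \<Rightarrow> nat"
  have key: "(\<integral>\<omega>. Z j j' \<omega> * Z l l' \<omega> \<partial>M) \<le> 4 * B\<^sup>2 * u j j' l l'"
    if o: "j \<in> ?O" "j' \<in> ?O" "l \<in> ?O" "l' \<in> ?O" for j j' l l'
  proof (cases "\<forall>c. distinct [j c, j' c, l c, l' c]")
    case True
    have jc: "j \<in> Cells" "j' \<in> Cells" "l \<in> Cells" "l' \<in> Cells" using o OC by auto
    have intp: "integrable M (\<lambda>\<omega>. pairf h i j j' \<omega> * pairf h i l l' \<omega>)"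
    proof (rule integrable_const_bound[where B="B\<^sup>2"])
      show "AE \<omega> in M. norm (pairf h i j j' \<omega> * pairf h i l l' \<omega>) \<le> B\<^sup>2"
        using B0 unfolding pairf_def power2_eq_square real_norm_def abs_mult
        by (intro AE_I2 mult_mono b) auto
    qed (intro borel_measurable_times measurable_pairf h)
    have "(\<integral>\<omega>. Z j j' \<omega> * Z l l' \<omega> \<partial>M) = (\<integral>\<omega>. pairf h i j j' \<omega> * pairf h i l l' \<omega> - \<theta> * pairf h i j j' \<omega> - \<theta> * pairf h i l l' \<omega> + \<theta>\<^sup>2 \<partial>M)"
      by (simp add: Z_def algebra_simps power2_eq_square)
    also have "\<dots> = (\<integral>\<omega>. pairf h i j j' \<omega> * pairf h i l l' \<omega> \<partial>M) - \<theta> * (\<integral>\<omega>. pairf h i j j' \<omega> \<partial>M) - \<theta> * (\<integral>\<omega>. pairf h i l l' \<omega> \<partial>M) + \<theta>\<^sup>2"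
      using int intp by (simp add: prob_space)
    also have "(\<integral>\<omega>. pairf h i j j' \<omega> * pairf h i l l' \<omega> \<partial>M) = \<theta>\<^sup>2"
      unfolding \<theta>_def by (rule pairf_bounded_indep[OF h b jc]) (use True in blast)
    also have "(\<integral>\<omega>. pairf h i j j' \<omega> \<partial>M) = \<theta>"
      unfolding \<theta>_def by (rule pairf_expectation[OF h]) (use jc True in auto)
    also have "(\<integral>\<omega>. pairf h i l l' \<omega> \<partial>M) = \<theta>"
      unfolding \<theta>_def by (rule pairf_expectation[OF h]) (use jc True in auto)
    finally have "(\<integral>\<omega>. Z j j' \<omega> * Z l l' \<omega> \<partial>M) = 0" by (simp add: power2_eq_square)
    then show ?thesis by (simp add: u_def coinc_nonneg)
  next
    case False
    then obtain c where "j c = j' c \<or> j c = l c \<or> j c = l' c \<or> j' c = l c \<or> j' c = l' c \<or> l c = l' c"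
      by auto
    moreover note coinc_nonneg[of UNIV j j'] coinc_nonneg[of UNIV j l] coinc_nonneg[of UNIV j l']
      coinc_nonneg[of UNIV j' l] coinc_nonneg[of UNIV j' l'] coinc_nonneg[of UNIV l l']
    ultimately have u1: "1 \<le> u j j' l l'"
      using coinc_ge1[OF UNIV_I, of j c j'] coinc_ge1[OF UNIV_I, of j c l] coinc_ge1[OF UNIV_I, of j c l']
        coinc_ge1[OF UNIV_I, of j' c l] coinc_ge1[OF UNIV_I, of j' c l'] coinc_ge1[OF UNIV_I, of l c l']
      unfolding u_def by linarith
    have "(\<integral>\<omega>. Z j j' \<omega> * Z l l' \<omega> \<partial>M) \<le> (\<integral>\<omega>. 4 * B\<^sup>2 \<partial>M)"
      by (rule integral_mono[OF intZ]) (auto intro: abs_le_D1 ZZb)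
    also have "\<dots> = 4 * B\<^sup>2 * 1" by (simp add: prob_space)
    also have "\<dots> \<le> 4 * B\<^sup>2 * u j j' l l'" by (rule mult_left_mono[OF u1]) simp
    finally show ?thesis .
  qed
  \<comment> \<open>The square of a double average is an average over quadruples of cells, which
    brings the estimate \<open>key\<close> into play.\<close>
  have "(\<integral>\<omega>. (avg ?O (\<lambda>j. avg ?O (\<lambda>j'. pairf h i j j' \<omega>)) - \<theta>)\<^sup>2 \<partial>M)
    = (\<integral>\<omega>. avg ?O (\<lambda>j. avg ?O (\<lambda>j'. avg ?O (\<lambda>l. avg ?O (\<lambda>l'. Z j j' \<omega> * Z l l' \<omega>)))) \<partial>M)"
    unfolding avg_mult_left avg_mult_right Z_def avg_diff avg_const[OF fO nO] power2_eq_square ..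
  also have "\<dots> = avg ?O (\<lambda>j. avg ?O (\<lambda>j'. avg ?O (\<lambda>l. avg ?O (\<lambda>l'. \<integral>\<omega>. Z j j' \<omega> * Z l l' \<omega> \<partial>M))))"
    by (simp only: integral_avg integrable_avg intZ)
  also have "\<dots> \<le> avg ?O (\<lambda>j. avg ?O (\<lambda>j'. avg ?O (\<lambda>l. avg ?O (\<lambda>l'. 4 * B\<^sup>2 * u j j' l l'))))"
    by (intro avg_mono key)
  also have "\<dots> = 4 * B\<^sup>2 * avg ?O (\<lambda>j. avg ?O (\<lambda>j'. avg ?O (\<lambda>l. avg ?O (\<lambda>l'. u j j' l l'))))"
    by (simp only: avg_mult_left)
  also have "avg ?O (\<lambda>j. avg ?O (\<lambda>j'. avg ?O (\<lambda>l. avg ?O (\<lambda>l'. u j j' l l')))) = 6 * (\<Sum>c\<in>UNIV. 1 / real (C c))"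
    unfolding u_def avg_add avg_const[OF fO nO]
    by (simp add: avg_coinc[OF C] avg_const[OF fO nO] cong: avg_cong)
  finally show ?thesis .
qed

end

subsection \<open>Characteristic functions of bootstrap statistics\<close>

lemma cmod_iexp_diff_le: "cmod (iexp x - iexp y) \<le> \<bar>x - y\<bar>"
proof -
  have "iexp x - iexp y = iexp y * (iexp (x - y) - 1)"
    by (simp add: right_diff_distrib exp_add[symmetric] algebra_simps)
  then have "cmod (iexp x - iexp y) = cmod (iexp (x - y) - 1)" by (simp add: norm_mult)
  also have "\<dots> \<le> \<bar>x - y\<bar>" using iexp_approx1[of "x - y" 0] by simp
  finally show ?thesis .
qed

lemma cmod_avg_iexp_le:
  assumes "finite A" "A \<noteq> {}"
  shows "cmod (avg A (\<lambda>a. iexp (y a))) \<le> 1"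
  using norm_avg_le[of A "\<lambda>a. iexp (y a)"] by (simp add: avg_const assms)

lemma exp_minus_quadratic_bound:
  assumes "0 \<le> (u::real)"
  shows "\<bar>exp (- u) - (1 - u)\<bar> \<le> u\<^sup>2"
proof (cases "u \<le> 1")
  case True
  have "1 - u \<le> exp (- u)" using exp_ge_add_one_self[of "- u"] by simp
  moreover have "exp (- u) \<le> 1 - u + u\<^sup>2"
  proof -
    have "exp (- u) = 1 / exp u" by (simp add: exp_minus field_simps)
    also have "\<dots> \<le> 1 / (1 + u)"
      using exp_ge_add_one_self[of u] assms by (intro divide_left_mono) auto
    also have "\<dots> \<le> 1 - u + u\<^sup>2"
    proof -
      have "1 \<le> (1 - u + u\<^sup>2) * (1 + u)"
        using assms by (simp add: algebra_simps power2_eq_square)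
      then show ?thesis using assms by (simp add: divide_le_eq)
    qed
    finally show ?thesis .
  qed
  ultimately show ?thesis by linarith
next
  case False
  have "exp (- u) \<le> 1" "exp (- u) \<ge> 0" using assms by auto
  moreover have "u \<le> u\<^sup>2" using False by (simp add: power2_eq_square)
  ultimately show ?thesis using False by linarith
qed

text \<open>A quantitative central limit theorem for n independent uniform draws from a finite
  centred population. The linear Taylor term averages to zero by \<open>m\<close>, the quadratic one
  to 1 - u with u = v / (2 n), so the n-th power of exp (- u) is the Gaussian value exp (- v / 2).
  The per-draw errors d^3 and d^4 are multiplied by n when n-th powers of numbers in the unit disc
  are compared, so the bound vanishes for d of order 1 / sqrt n.\<close>

lemma charfun_power_approx:
  assumes n: "n \<ge> 1" and m: "(\<Sum>a\<in>{1..n}. y a) = 0" and d: "\<And>a. a \<in> {1..n} \<Longrightarrow> \<bar>y a\<bar> \<le> d"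
  shows "cmod ((avg {1..n} (\<lambda>a. iexp (y a))) ^ n - of_real (exp (- (\<Sum>a\<in>{1..n}. (y a)\<^sup>2) / 2)))
    \<le> real n * d ^ 3 + real n * d ^ 4"
proof -
  let ?I = "{1..n}"
  have I: "finite ?I" "?I \<noteq> {}" using n by auto
  have d0: "d \<ge> 0" using d[of 1] n by auto
  define v where "v = (\<Sum>a\<in>?I. (y a)\<^sup>2)"
  have v0: "v \<ge> 0" by (simp add: v_def sum_nonneg)
  have y2: "(y a)\<^sup>2 \<le> d\<^sup>2" if "a \<in> ?I" for a using d[OF that] by (metis abs_ge_zero power2_abs power_mono)
  have vn: "v \<le> real n * d\<^sup>2" unfolding v_def using sum_mono[of ?I "\<lambda>a. (y a)\<^sup>2" "\<lambda>_. d\<^sup>2"] y2 by simp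
  define u where "u = v / (2 * real n)"
  have u: "0 \<le> u" "u \<le> d\<^sup>2" using v0 vn n d0 unfolding u_def by (auto simp: divide_simps mult_ac intro: order.trans[OF vn])
  define Q where "Q x = 1 + (\<i> * complex_of_real x + - ((complex_of_real x)\<^sup>2 / 2))" for x :: real
  have q: "cmod (iexp (y a) - Q (y a)) \<le> d ^ 3" if "a \<in> ?I" for a
  proof -
    have "(\<i> * z) * (\<i> * z) = - (z * z)" for z
    proof -
      have "(\<i> * z) * (\<i> * z) = (\<i> * \<i>) * (z * z)" by (simp only: mult_ac)
      then show ?thesis by simp
    qed
    then have "(\<Sum>k\<le>2. (\<i> * complex_of_real (y a)) ^ k / fact k) = Q (y a)"
      by (simp add: Q_def numeral_2_eq_2 power2_eq_square)
    then have "cmod (iexp (y a) - Q (y a)) \<le> \<bar>y a\<bar> ^ 3 / fact 3"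
      using iexp_approx1[of "y a" 2] by (simp add: numeral_3_eq_3 numeral_2_eq_2)
    also have "\<dots> \<le> \<bar>y a\<bar> ^ 3" by (simp add: fact_numeral)
    also have "\<dots> \<le> d ^ 3" using d[OF that] by (simp add: power_mono)
    finally show ?thesis .
  qed
  have Qa: "avg ?I (\<lambda>a. Q (y a)) = of_real (1 - u)"
  proof -
    have "(\<Sum>a\<in>?I. Q (y a)) = of_nat n + (\<i> * complex_of_real (\<Sum>a\<in>?I. y a) - complex_of_real v / 2)"
      unfolding Q_def v_def by (simp add: sum.distrib sum_subtractf sum_distrib_left sum_divide_distrib)
    then have "(\<Sum>a\<in>?I. Q (y a)) = of_nat n - complex_of_real v / 2" by (simp only: m) simp
    then show ?thesis using n by (simp add: avg_def u_def field_simps)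
  qed
  have "cmod (avg ?I (\<lambda>a. iexp (y a)) - of_real (exp (- u)))
    \<le> cmod (avg ?I (\<lambda>a. iexp (y a)) - of_real (1 - u)) + cmod (of_real (1 - u) - of_real (exp (- u)))"
    using norm_triangle_ineq[of "avg ?I (\<lambda>a. iexp (y a)) - of_real (1 - u)" "of_real (1 - u) - of_real (exp (- u))"]
    by simp
  also have "cmod (avg ?I (\<lambda>a. iexp (y a)) - of_real (1 - u)) \<le> d ^ 3"
  proof -
    have "cmod (avg ?I (\<lambda>a. iexp (y a)) - of_real (1 - u)) = cmod (avg ?I (\<lambda>a. iexp (y a) - Q (y a)))"
      by (simp only: avg_diff Qa)
    also have "\<dots> \<le> avg ?I (\<lambda>a. cmod (iexp (y a) - Q (y a)))" by (rule norm_avg_le)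
    also have "\<dots> \<le> d ^ 3" by (rule avg_le_bound[OF I]) (rule q)
    finally show ?thesis .
  qed
  also have "cmod (of_real (1 - u) - of_real (exp (- u))) \<le> d ^ 4"
  proof -
    have "cmod (of_real (1 - u) - of_real (exp (- u))) = \<bar>exp (- u) - (1 - u)\<bar>"
      by (metis abs_minus_commute norm_of_real of_real_diff)
    also have "\<dots> \<le> u\<^sup>2" by (rule exp_minus_quadratic_bound[OF u(1)])
    also have "\<dots> \<le> (d\<^sup>2)\<^sup>2" using u by (rule power_mono[rotated])
    finally show ?thesis by (simp add: power_mult[symmetric])
  qed
  finally have 1: "cmod (avg ?I (\<lambda>a. iexp (y a)) - of_real (exp (- u))) \<le> d ^ 3 + d ^ 4" by simp
  have "(of_real (exp (- u)) :: complex) ^ n = of_real (exp (- v / 2))"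
    using n by (simp add: u_def exp_of_nat_mult[symmetric] of_real_power[symmetric] del: of_real_power)
  then have "cmod ((avg ?I (\<lambda>a. iexp (y a))) ^ n - of_real (exp (- v / 2)))
     = cmod ((avg ?I (\<lambda>a. iexp (y a))) ^ n - (of_real (exp (- u))) ^ n)" by simp
  also have "\<dots> \<le> real n * cmod (avg ?I (\<lambda>a. iexp (y a)) - of_real (exp (- u)))"
    by (rule norm_power_diff) (use cmod_avg_iexp_le[OF I] u in auto)
  also have "\<dots> \<le> real n * (d ^ 3 + d ^ 4)" by (rule mult_left_mono[OF 1]) simp
  finally show ?thesis by (simp add: v_def distrib_left)
qed

text \<open>A weighted sum of counts is a sum of values at n independent draws. The -1 in each
  weight subtracts the mean of b once per draw, which centres every factor.\<close>

lemma avg_resamples_iexp: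
  assumes n: "n \<ge> 1"
  shows "avg (resamples n) (\<lambda>e. iexp (\<Sum>a\<in>{1..n}. (draw_count n e a - 1) * b a))
    = (avg {1..n} (\<lambda>a. iexp (b a - avg {1..n} b))) ^ n"
proof -
  have "avg (resamples n) (\<lambda>e. iexp (\<Sum>a\<in>{1..n}. (draw_count n e a - 1) * b a))
    = avg (resamples n) (\<lambda>e. \<Prod>m\<in>{1..n}. iexp (b (e m) - avg {1..n} b))"
  proof (rule avg_cong)
    fix e assume e: "e \<in> resamples n"
    have "(\<Sum>a\<in>{1..n}. (draw_count n e a - 1) * b a) = (\<Sum>m\<in>{1..n}. b (e m) - avg {1..n} b)"
      using sum_draw_count[OF e, of b] n by (simp add: left_diff_distrib sum_subtractf avg_def)
    then show "iexp (\<Sum>a\<in>{1..n}. (draw_count n e a - 1) * b a) = (\<Prod>m\<in>{1..n}. iexp (b (e m) - avg {1..n} b))"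
      by (simp only: of_real_sum sum_distrib_left exp_sum finite_atLeastAtMost)
  qed
  also have "\<dots> = (\<Prod>m\<in>{1..n}. avg {1..n} (\<lambda>a. iexp (b a - avg {1..n} b)))"
    unfolding resamples_def by (rule avg_PiE_prod) auto
  finally show ?thesis by simp
qed

section \<open>Slice sums and conditional variances of the single-factor components\<close>

definition pair_avg :: "('k::finite \<Rightarrow> nat) \<Rightarrow> 'k \<Rightarrow> (('k \<Rightarrow> nat) \<Rightarrow> real) \<Rightarrow> real" where
  "pair_avg C i x = avg (obs_cells C) (\<lambda>j. avg (obs_cells C) (\<lambda>l. x j * x (l(i := j i))))"

definition slice_sum :: "('k::finite \<Rightarrow> nat) \<Rightarrow> 'k \<Rightarrow> (('k \<Rightarrow> nat) \<Rightarrow> real) \<Rightarrow> nat \<Rightarrow> real" where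
  "slice_sum C i x a = bscale C * (\<Sum>j\<in>slice C i a. x j)"

text \<open>Resampling coordinate i hits the value a with frequency 1 / C_i. A slice thus becomes an
  average over all cells with coordinate i overwritten, the shape in which \<open>pairf\<close> and
  \<open>pair_avg\<close> are written.\<close>

lemma sum_slice_eq_avg:
  assumes C: "\<And>i. C i \<ge> 1" and a: "a \<in> {1..C i}"
  shows "(\<Sum>j\<in>slice C i a. x j) = real (prodC C) / real (C i) * avg (obs_cells C) (\<lambda>l. x (l(i := a)))"
proof -
  have "(\<Sum>j\<in>slice C i a. x j) / real (prodC C) = avg (obs_cells C) (\<lambda>l. if l i = a then x l else 0)"
    unfolding avg_def card_obs_cells slice_def
    by (simp add: sum.inter_filter finite_obs_cells)
  also have "\<dots> = avg (obs_cells C) (\<lambda>l. avg {1..C i} (\<lambda>e. if (l(i := e)) i = a then x (l(i := e)) else 0))"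
    unfolding obs_cells_PiE
    by (rule avg_PiE_resample[where B="\<lambda>i. {1..C i}" and g="\<lambda>l. if l i = a then x l else 0", symmetric])
       (use a in auto)
  also have "\<dots> = avg (obs_cells C) (\<lambda>l. x (l(i := a)) * (1 / real (C i)))"
  proof (rule avg_cong)
    fix l
    have "(\<Sum>e\<in>{1..C i}. if (l(i := e)) i = a then x (l(i := e)) else 0) = (\<Sum>e\<in>{1..C i}. if e = a then x (l(i := a)) else 0)"
      by (intro sum.cong) auto
    then show "avg {1..C i} (\<lambda>e. if (l(i := e)) i = a then x (l(i := e)) else 0) = x (l(i := a)) * (1 / real (C i))"
      using a by (simp add: avg_def)
  qed
  finally show ?thesis using prodC_pos[of C] C unfolding avg_mult_right by (simp add: field_simps)
qed

lemma slice_sum_square_sum: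
  assumes C: "\<And>i. C i \<ge> 1"
  shows "(\<Sum>a\<in>{1..C i}. (slice_sum C i x a)\<^sup>2) = real (minC C) / real (C i) * pair_avg C i x"
proof -
  let ?O = "obs_cells C" and ?I = "{1..C i}" and ?b = "slice_sum C i x"
  have Cs: "real (prodC C) > 0" using prodC_pos[of C, OF C] by simp
  have sc: "(bscale C)\<^sup>2 * (real (prodC C))\<^sup>2 = real (minC C)"
    using Cs by (simp add: bscale_def power_divide)
  have "(\<Sum>a\<in>?I. (?b a)\<^sup>2) = (bscale C)\<^sup>2 * (\<Sum>a\<in>?I. \<Sum>j\<in>slice C i a. x j * (\<Sum>l\<in>slice C i a. x l))"
    by (simp add: slice_sum_def power_mult_distrib sum_distrib_left sum_distrib_right power2_eq_square mult_ac)
  also have "(\<Sum>a\<in>?I. \<Sum>j\<in>slice C i a. x j * (\<Sum>l\<in>slice C i a. x l))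
     = (\<Sum>a\<in>?I. \<Sum>j\<in>slice C i a. x j * (real (prodC C) / real (C i) * avg ?O (\<lambda>l. x (l(i := j i)))))"
  proof (intro sum.cong refl)
    fix a j assume a: "a \<in> ?I" and j: "j \<in> slice C i a"
    then have "j i = a" by (simp add: slice_def)
    then show "x j * (\<Sum>l\<in>slice C i a. x l) = x j * (real (prodC C) / real (C i) * avg ?O (\<lambda>l. x (l(i := j i))))"
      using sum_slice_eq_avg[where C=C and i=i and a=a and x=x, OF C a] by simp
  qed
  also have "\<dots> = (\<Sum>j\<in>?O. x j * (real (prodC C) / real (C i) * avg ?O (\<lambda>l. x (l(i := j i)))))"
    by (rule sum_slices)
  also have "\<dots> = (real (prodC C))\<^sup>2 / real (C i) * pair_avg C i x"
  proof -
    have "(\<Sum>j\<in>?O. x j * avg ?O (\<lambda>l. x (l(i := j i)))) = real (prodC C) * pair_avg C i x"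
      unfolding pair_avg_def avg_mult_left using Cs
      by (subst avg_def[of ?O "\<lambda>j. x j * avg ?O (\<lambda>l. x (l(i := j i)))"]) (simp add: card_obs_cells)
    moreover have "(\<Sum>j\<in>?O. x j * (real (prodC C) / real (C i) * avg ?O (\<lambda>l. x (l(i := j i)))))
      = real (prodC C) / real (C i) * (\<Sum>j\<in>?O. x j * avg ?O (\<lambda>l. x (l(i := j i))))"
      unfolding sum_distrib_left by (intro sum.cong refl) simp
    ultimately show ?thesis by (simp add: power2_eq_square)
  qed
  finally show ?thesis unfolding sc[symmetric] by simp
qed

text \<open>The left side is the conditional variance of the component of {i}. The ratio minC / C_i
  is where the limit \<lambda>_i enters, and the bracket is the empirical counterpart of the
  covariance between two cells sharing coordinate i.\<close>

lemma slice_sum_variance: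
  assumes C: "\<And>i. C i \<ge> 1"
  shows "(\<Sum>a\<in>{1..C i}. (slice_sum C i x a - avg {1..C i} (slice_sum C i x))\<^sup>2)
    = real (minC C) / real (C i) * (pair_avg C i x - (avg (obs_cells C) x)\<^sup>2)"
proof -
  let ?O = "obs_cells C" and ?I = "{1..C i}" and ?b = "slice_sum C i x"
  have I: "finite ?I" "?I \<noteq> {}" "card ?I = C i" using C[of i] by auto
  have Ci: "real (C i) > 0" using C[of i] by simp
  have Cs: "real (prodC C) > 0" using prodC_pos[of C, OF C] by simp
  have sc: "(bscale C)\<^sup>2 * (real (prodC C))\<^sup>2 = real (minC C)"
    using Cs by (simp add: bscale_def power_divide)
  have "(\<Sum>a\<in>?I. (?b a - avg ?I ?b)\<^sup>2) = (\<Sum>a\<in>?I. (?b a)\<^sup>2 - 2 * avg ?I ?b * ?b a + (avg ?I ?b)\<^sup>2)"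
    by (intro sum.cong refl) (simp add: power2_diff)
  also have "\<dots> = (\<Sum>a\<in>?I. (?b a)\<^sup>2) - 2 * avg ?I ?b * (\<Sum>a\<in>?I. ?b a) + real (C i) * (avg ?I ?b)\<^sup>2"
    by (simp add: sum.distrib sum_subtractf sum_distrib_left)
  also have "(\<Sum>a\<in>?I. ?b a) = real (C i) * avg ?I ?b" using Ci by (simp add: avg_def)
  finally have 1: "(\<Sum>a\<in>?I. (?b a - avg ?I ?b)\<^sup>2) = (\<Sum>a\<in>?I. (?b a)\<^sup>2) - real (C i) * (avg ?I ?b)\<^sup>2"
    by (simp add: power2_eq_square)
  have "avg ?I ?b = bscale C * (\<Sum>j\<in>?O. x j) / real (C i)"
    by (simp add: avg_def slice_sum_def sum_distrib_left[symmetric] sum_slices[unfolded One_nat_def])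
  also have "(\<Sum>j\<in>?O. x j) = real (prodC C) * avg ?O x"
    using Cs by (simp add: avg_def card_obs_cells)
  finally have avgb: "avg ?I ?b = bscale C * (real (prodC C) * avg ?O x) / real (C i)" .
  have 2: "real (C i) * (avg ?I ?b)\<^sup>2 = real (minC C) / real (C i) * (avg ?O x)\<^sup>2"
    unfolding avgb sc[symmetric] using Ci by (simp add: power2_eq_square)
  note 3 = slice_sum_square_sum[where C=C and i=i and x=x, OF C]
  show ?thesis unfolding 1 2 3 by (simp add: right_diff_distrib)
qed

text \<open>Supplies the uniform smallness of order 1 / sqrt C_i that
  \<open>charfun_power_approx\<close> asks for. The normalization causes no loss because minC is at
  most C_i.\<close>

lemma slice_sum_bound:
  assumes C: "\<And>i. C i \<ge> 1" and a: "a \<in> {1..C i}" and B: "\<And>j. \<bar>x j\<bar> \<le> B"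
  shows "\<bar>slice_sum C i x a\<bar> \<le> B / sqrt (real (C i))"
proof -
  have B0: "B \<ge> 0" using B[of undefined] by linarith
  have Ci: "real (C i) > 0" using C[of i] by simp
  have Cs: "real (prodC C) > 0" using prodC_pos[of C, OF C] by simp
  have "\<bar>avg (obs_cells C) (\<lambda>l. x (l(i := a)))\<bar> \<le> avg (obs_cells C) (\<lambda>l. \<bar>x (l(i := a))\<bar>)"
    using norm_avg_le[of "obs_cells C" "\<lambda>l. x (l(i := a))"] by simp
  also have "\<dots> \<le> B" by (rule avg_le_bound) (use finite_obs_cells[of C] obs_cells_nonempty[of C, OF C] B in auto)
  finally have 1: "\<bar>avg (obs_cells C) (\<lambda>l. x (l(i := a)))\<bar> \<le> B" .
  have "\<bar>slice_sum C i x a\<bar> = sqrt (real (minC C)) / real (C i) * \<bar>avg (obs_cells C) (\<lambda>l. x (l(i := a)))\<bar>"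
    unfolding slice_sum_def sum_slice_eq_avg[where C=C and i=i and a=a and x=x, OF C a] using Cs Ci by (simp add: bscale_def abs_mult)
  also have "\<dots> \<le> sqrt (real (C i)) / real (C i) * B"
    using Ci minC_le[of C i] 1 B0 by (intro mult_mono divide_right_mono) auto
  also have "\<dots> = B / sqrt (real (C i))"
    using Ci by (simp add: field_simps real_sqrt_mult_self flip: power2_eq_square) 
  finally show ?thesis .
qed

lemma bcomponent_singleton: "bcomponent C {i} D x = (\<Sum>a\<in>{1..C i}. (draw_count (C i) (D i) a - 1) * slice_sum C i x a)"
proof -
  have "bcomponent C {i} D x = bscale C * (\<Sum>a\<in>{1..C i}. \<Sum>j\<in>slice C i a. wdev C D i (j i) * x j)"
    unfolding bcomponent_def sum_slices by simp
  also have "\<dots> = bscale C * (\<Sum>a\<in>{1..C i}. \<Sum>j\<in>slice C i a. (draw_count (C i) (D i) a - 1) * x j)"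
    by (intro arg_cong[where f="\<lambda>y. bscale C * y"] sum.cong refl) (simp add: slice_def wdev_def)
  finally show ?thesis by (simp add: slice_sum_def sum_distrib_left mult_ac)
qed

text \<open>Components of different singletons depend on the draws of different coordinates, so the
  joint characteristic function factorizes, and each factor is an n-th power.\<close>

lemma avg_iexp_main:
  fixes x :: "('k::finite \<Rightarrow> nat) \<Rightarrow> real"
  assumes C: "\<And>i. C i \<ge> 1"
  shows "avg (draws C) (\<lambda>D. iexp (\<Sum>i\<in>UNIV. bcomponent C {i} D x))
    = (\<Prod>i\<in>UNIV. (avg {1..C i} (\<lambda>a. iexp (slice_sum C i x a - avg {1..C i} (slice_sum C i x)))) ^ C i)"
proof -
  have "avg (draws C) (\<lambda>D. iexp (\<Sum>i\<in>UNIV. bcomponent C {i} D x))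
    = avg (draws C) (\<lambda>D. \<Prod>i\<in>UNIV. iexp (\<Sum>a\<in>{1..C i}. (draw_count (C i) (D i) a - 1) * slice_sum C i x a))"
    unfolding bcomponent_singleton by (simp only: of_real_sum sum_distrib_left exp_sum finite)
  also have "\<dots> = (\<Prod>i\<in>UNIV. avg (resamples (C i)) (\<lambda>e. iexp (\<Sum>a\<in>{1..C i}. (draw_count (C i) e a - 1) * slice_sum C i x a)))"
    by (rule avg_draws_prod)
  finally show ?thesis by (simp only: avg_resamples_iexp C)
qed

text \<open>Every C_i is at least minC: the first factor of the product absorbs minC, and a second
  one leaves an extra 1 / minC. Hence every component stays bounded and those with at least two
  factors vanish.\<close>

lemma minC_prod_le:
  fixes C :: "'k::finite \<Rightarrow> nat"
  assumes C: "\<And>i. C i \<ge> 1"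
  shows "A \<noteq> {} \<Longrightarrow> real (minC C) * (\<Prod>i\<in>A. 2 / real (C i)) \<le> 2 ^ CARD('k)"
    and "card A \<ge> 2 \<Longrightarrow> real (minC C) * (\<Prod>i\<in>A. 2 / real (C i)) \<le> 2 ^ CARD('k) / real (minC C)"
proof -
  define m where "m = real (minC C)"
  have m: "m \<ge> 1" using minC_ge_iff[of 1 C] C by (simp add: m_def)
  have "(\<Prod>i\<in>A. 2 / real (C i)) \<le> (\<Prod>i\<in>A. 2 / m)"
    using C m minC_le[of C] unfolding m_def by (intro prod_mono) (auto intro!: divide_left_mono mult_pos_pos simp: Suc_le_eq)
  also have "\<dots> = 2 ^ card A / m ^ card A" by (simp add: power_divide)
  finally have "m * (\<Prod>i\<in>A. 2 / real (C i)) \<le> m * (2 ^ card A / m ^ card A)"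
    using m by (intro mult_left_mono) auto
  also have "\<dots> \<le> m * (2 ^ CARD('k) / m ^ card A)"
    using m by (intro mult_left_mono divide_right_mono power_increasing card_mono) auto
  finally have 1: "m * (\<Prod>i\<in>A. 2 / real (C i)) \<le> m * (2 ^ CARD('k) / m ^ card A)" .
  show "real (minC C) * (\<Prod>i\<in>A. 2 / real (C i)) \<le> 2 ^ CARD('k)" if "A \<noteq> {}"
  proof -
    have "card A \<ge> 1" using that by (simp add: Suc_le_eq card_gt_0_iff)
    then have "m ^ 1 \<le> m ^ card A" using m by (intro power_increasing) auto
    then have "m * (2 ^ CARD('k) / m ^ card A) \<le> 2 ^ CARD('k)" using m by (simp add: field_simps)
    with 1 show ?thesis by (simp add: m_def)
  qed
  show "real (minC C) * (\<Prod>i\<in>A. 2 / real (C i)) \<le> 2 ^ CARD('k) / real (minC C)" if "card A \<ge> 2"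
  proof -
    have "m ^ 2 \<le> m ^ card A" using m that by (intro power_increasing) auto
    then have "m * (2 ^ CARD('k) / m ^ card A) \<le> m * (2 ^ CARD('k) / m ^ 2)" using m
      by (intro mult_left_mono divide_left_mono) auto
    also have "\<dots> = 2 ^ CARD('k) / m" using m by (simp add: power2_eq_square)
    finally show ?thesis using 1 by (simp add: m_def)
  qed
qed

lemma (in prob_space) square_integral_le:
  fixes f :: "'a \<Rightarrow> real"
  assumes "integrable M (\<lambda>x. (f x)\<^sup>2)" "f \<in> borel_measurable M"
  shows "integrable M f" "(\<integral>x. f x \<partial>M)\<^sup>2 \<le> (\<integral>x. (f x)\<^sup>2 \<partial>M)"
proof -
  show i: "integrable M f"
    using square_integrable_imp_integrable[OF assms(2)] assms(1) by simp
  show "(\<integral>x. f x \<partial>M)\<^sup>2 \<le> (\<integral>x. (f x)\<^sup>2 \<partial>M)"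
    using variance_eq[OF i] assms variance_positive[of f] by simp
qed

lemma (in prob_space) integral_sqrt_le:
  fixes f :: "'a \<Rightarrow> real"
  assumes "integrable M f" "\<And>x. f x \<ge> 0"
  shows "integrable M (\<lambda>x. sqrt (f x))" "(\<integral>x. sqrt (f x) \<partial>M) \<le> sqrt (\<integral>x. f x \<partial>M)"
proof -
  have [measurable]: "f \<in> borel_measurable M" using assms by auto
  note * = square_integral_le[of "\<lambda>x. sqrt (f x)"]
  show "integrable M (\<lambda>x. sqrt (f x))" by (rule *) (use assms in auto)
  show "(\<integral>x. sqrt (f x) \<partial>M) \<le> sqrt (\<integral>x. f x \<partial>M)"
    by (rule real_le_rsqrt) (use *(2) assms in auto)
qed

lemma (in prob_space) integral_avg_abs_bcomponent_le:
  fixes X :: "('k::finite \<Rightarrow> nat) \<Rightarrow> 'a \<Rightarrow> real"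
  assumes C: "\<And>i. C i \<ge> 1"
    and Xm: "\<And>j. j \<in> obs_cells C \<Longrightarrow> X j \<in> borel_measurable M"
    and Xi: "\<And>j. j \<in> obs_cells C \<Longrightarrow> integrable M (\<lambda>\<omega>. (X j \<omega>)\<^sup>2)"
    and q: "\<And>j. j \<in> obs_cells C \<Longrightarrow> (\<integral>\<omega>. (X j \<omega>)\<^sup>2 \<partial>M) \<le> q"
  shows "integrable M (\<lambda>\<omega>. avg (draws C) (\<lambda>D. \<bar>bcomponent C A D (\<lambda>j. X j \<omega>)\<bar>))"
    and "(\<integral>\<omega>. avg (draws C) (\<lambda>D. \<bar>bcomponent C A D (\<lambda>j. X j \<omega>)\<bar>) \<partial>M)
      \<le> sqrt (q * (real (minC C) * (\<Prod>i\<in>A. 2 / real (C i))))"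
proof -
  note * = integral_bcomponent_square_le[of C X M q A, OF C Xm Xi q]
  have "integrable M (X j)" if "j \<in> obs_cells C" for j
    using square_integral_le[OF Xi[OF that] Xm[OF that]] by simp
  then have i1: "integrable M (\<lambda>\<omega>. \<bar>bcomponent C A D (\<lambda>j. X j \<omega>)\<bar>)" for D
    unfolding bcomponent_def by (intro integrable_abs integrable_mult_right Bochner_Integration.integrable_sum) auto
  then show i2: "integrable M (\<lambda>\<omega>. avg (draws C) (\<lambda>D. \<bar>bcomponent C A D (\<lambda>j. X j \<omega>)\<bar>))"
    by (rule integrable_avg)
  let ?S = "\<lambda>\<omega>. avg (draws C) (\<lambda>D. (bcomponent C A D (\<lambda>j. X j \<omega>))\<^sup>2)"
  have S0: "?S \<omega> \<ge> 0" for \<omega> by (rule avg_nonneg) simp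
  have "(\<integral>\<omega>. avg (draws C) (\<lambda>D. \<bar>bcomponent C A D (\<lambda>j. X j \<omega>)\<bar>) \<partial>M) \<le> (\<integral>\<omega>. sqrt (?S \<omega>) \<partial>M)"
    by (intro integral_mono i2 integral_sqrt_le(1) *(1) S0 avg_abs_le_sqrt finite_draws draws_nonempty)
  also have "\<dots> \<le> sqrt (\<integral>\<omega>. ?S \<omega> \<partial>M)" by (intro integral_sqrt_le(2) *(1) S0)
  also have "\<dots> \<le> sqrt (q * (real (minC C) * (\<Prod>i\<in>A. 2 / real (C i))))"
    using *(2) by (intro real_sqrt_le_mono) (simp add: mult.assoc)
  finally show "(\<integral>\<omega>. avg (draws C) (\<lambda>D. \<bar>bcomponent C A D (\<lambda>j. X j \<omega>)\<bar>) \<partial>M)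
      \<le> sqrt (q * (real (minC C) * (\<Prod>i\<in>A. 2 / real (C i))))" .
qed

lemma abs_exp_minus_diff_le:
  assumes "0 \<le> (x::real)" "0 \<le> y"
  shows "\<bar>exp (- x) - exp (- y)\<bar> \<le> \<bar>x - y\<bar>"
proof -
  have *: "exp (- x) - exp (- y) \<le> y - x" if "0 \<le> x" "x \<le> y" for x y :: real
  proof -
    have "exp (- x) - exp (- y) = exp (- x) * (1 - exp (- (y - x)))"
      by (simp add: right_diff_distrib exp_add[symmetric])
    also have "\<dots> \<le> 1 * (1 - exp (- (y - x)))" using that by (intro mult_right_mono) auto
    also have "\<dots> \<le> y - x" unfolding mult_1 using exp_ge_add_one_self[of "- (y - x)"] by linarith
    finally show ?thesis .
  qed
  show ?thesis
  proof (cases "x \<le> y")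
    case True
    then have "exp (- y) \<le> exp (- x)" by simp
    then show ?thesis using *[OF assms(1) True] True by simp
  next
    case False
    then have "exp (- x) \<le> exp (- y)" by simp
    then show ?thesis using *[of y x] assms False by simp
  qed
qed

lemma cmod_avg_iexp_diff_le:
  "cmod (avg A (\<lambda>a. iexp (f a)) - avg A (\<lambda>a. iexp (g a))) \<le> avg A (\<lambda>a. \<bar>f a - g a\<bar>)"
proof -
  have "cmod (avg A (\<lambda>a. iexp (f a)) - avg A (\<lambda>a. iexp (g a))) \<le> avg A (\<lambda>a. cmod (iexp (f a) - iexp (g a)))"
    unfolding avg_diff[symmetric] by (rule norm_avg_le)
  also have "\<dots> \<le> avg A (\<lambda>a. \<bar>f a - g a\<bar>)" by (rule avg_mono) (rule cmod_iexp_diff_le)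
  finally show ?thesis .
qed

text \<open>Both products consist of factors in the unit disc, so their distance is at most the sum
  of the factorwise distances. Centring a slice sum at most doubles its bound B / sqrt n, which
  explains 8 = 2^3 and 16 = 2^4.\<close>

lemma avg_iexp_main_approx:
  fixes x :: "('k::finite \<Rightarrow> nat) \<Rightarrow> real" and w :: "'k \<Rightarrow> real"
  assumes C: "\<And>i. C i \<ge> 1" and B: "\<And>j. \<bar>x j\<bar> \<le> B" and w: "\<And>i. w i \<ge> 0"
  shows "cmod (avg (draws C) (\<lambda>D. iexp (\<Sum>i\<in>UNIV. bcomponent C {i} D x)) - of_real (exp (- (\<Sum>i\<in>UNIV. w i) / 2)))
    \<le> (\<Sum>i\<in>UNIV. 8 * B ^ 3 / sqrt (real (C i)) + 16 * B ^ 4 / real (C i)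
        + \<bar>real (minC C) / real (C i) * (pair_avg C i x - (avg (obs_cells C) x)\<^sup>2) - w i\<bar>)"
proof -
  have B0: "B \<ge> 0" using B[of undefined] by linarith
  define y where "y i a = slice_sum C i x a - avg {1..C i} (slice_sum C i x)" for i a
  define v where "v i = (\<Sum>a\<in>{1..C i}. (y i a)\<^sup>2)" for i
  have v: "v i = real (minC C) / real (C i) * (pair_avg C i x - (avg (obs_cells C) x)\<^sup>2)" for i
    unfolding v_def y_def by (rule slice_sum_variance[OF C])
  have v0: "v i \<ge> 0" for i by (simp add: v_def sum_nonneg)
  have I: "finite {1..C i}" "{1..C i} \<noteq> {}" for i using C[of i] by auto
  let ?\<phi> = "\<lambda>i. (avg {1..C i} (\<lambda>a. iexp (y i a))) ^ C i"
  have E: "avg (draws C) (\<lambda>D. iexp (\<Sum>i\<in>UNIV. bcomponent C {i} D x)) = (\<Prod>i\<in>UNIV. ?\<phi> i)"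
    unfolding y_def by (rule avg_iexp_main[OF C])
  have W: "complex_of_real (exp (- (\<Sum>i\<in>UNIV. w i) / 2)) = (\<Prod>i\<in>UNIV. of_real (exp (- w i / 2)))"
    by (simp add: exp_sum[symmetric] sum_negf sum_divide_distrib flip: of_real_prod)
  have "cmod ((\<Prod>i\<in>UNIV. ?\<phi> i) - (\<Prod>i\<in>UNIV. of_real (exp (- w i / 2))))
    \<le> (\<Sum>i\<in>UNIV. cmod (?\<phi> i - of_real (exp (- w i / 2))))"
    by (rule norm_prod_diff) (use w cmod_avg_iexp_le[OF I] in \<open>auto simp: norm_power intro!: power_le_one\<close>)
  also have "\<dots> \<le> (\<Sum>i\<in>UNIV. 8 * B ^ 3 / sqrt (real (C i)) + 16 * B ^ 4 / real (C i) + \<bar>v i - w i\<bar>)"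
  proof (rule sum_mono)
    fix i
    define n where "n = C i"
    have n: "n \<ge> 1" using C by (simp add: n_def)
    have sb: "\<bar>slice_sum C i x a\<bar> \<le> B / sqrt n" if "a \<in> {1..n}" for a
      using slice_sum_bound[of C a i x B] C B that by (simp add: n_def)
    have ab: "\<bar>avg {1..n} (slice_sum C i x)\<bar> \<le> B / sqrt n"
    proof -
      have "\<bar>avg {1..n} (slice_sum C i x)\<bar> \<le> avg {1..n} (\<lambda>a. \<bar>slice_sum C i x a\<bar>)"
        using norm_avg_le[of "{1..n}" "slice_sum C i x"] by simp
      also have "\<dots> \<le> B / sqrt n" by (rule avg_le_bound) (use I[of i] sb in \<open>auto simp: n_def\<close>)
      finally show ?thesis .
    qed
    have yb: "\<bar>y i a\<bar> \<le> 2 * B / sqrt n" if "a \<in> {1..n}" for a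
      using sb[OF that] ab unfolding y_def n_def[symmetric] by (simp add: abs_le_iff)
    have ys: "(\<Sum>a\<in>{1..n}. y i a) = 0"
      unfolding y_def n_def[symmetric] using n by (simp add: sum_subtractf avg_def)
    have "cmod ((avg {1..n} (\<lambda>a. iexp (y i a))) ^ n - of_real (exp (- (\<Sum>a\<in>{1..n}. (y i a)\<^sup>2) / 2)))
      \<le> real n * (2 * B / sqrt n) ^ 3 + real n * (2 * B / sqrt n) ^ 4"
      by (rule charfun_power_approx[OF n ys yb])
    also have "real n * (2 * B / sqrt n) ^ 3 = 8 * B ^ 3 / sqrt n"
      using n by (simp add: power_divide power_mult_distrib field_simps power3_eq_cube)
    also have "real n * (2 * B / sqrt n) ^ 4 = 16 * B ^ 4 / n"
    proof -
      have "sqrt n ^ 4 = (sqrt n * sqrt n) * (sqrt n * sqrt n)" by (simp only: power4_eq_xxxx mult.assoc)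
      then have "sqrt n ^ 4 = real n ^ 2" by (simp add: power2_eq_square)
      then show ?thesis using n by (simp add: power_divide power_mult_distrib power2_eq_square)
    qed
    finally have 1: "cmod (?\<phi> i - of_real (exp (- v i / 2))) \<le> 8 * B ^ 3 / sqrt (real (C i)) + 16 * B ^ 4 / real (C i)"
      by (simp add: n_def v_def)
    have "cmod (complex_of_real (exp (- v i / 2)) - of_real (exp (- w i / 2))) = \<bar>exp (- (v i / 2)) - exp (- (w i / 2))\<bar>"
      by (metis minus_divide_left norm_of_real of_real_diff)
    also have "\<dots> \<le> \<bar>v i / 2 - w i / 2\<bar>" by (rule abs_exp_minus_diff_le) (use v0 w in auto)
    also have "\<dots> \<le> \<bar>v i - w i\<bar>" by linarith
    finally show "cmod (?\<phi> i - of_real (exp (- w i / 2))) \<le> 8 * B ^ 3 / sqrt (real (C i)) + 16 * B ^ 4 / real (C i) + \<bar>v i - w i\<bar>"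
      using 1 norm_triangle_ineq[of "?\<phi> i - of_real (exp (- v i / 2))" "complex_of_real (exp (- v i / 2)) - of_real (exp (- w i / 2))"]
      by simp
  qed
  finally show ?thesis unfolding E W v .
qed

lemma filterlim_minC_imp:
  assumes "filterlim (\<lambda>n. minC (Cs n)) at_top sequentially"
  shows "filterlim (\<lambda>n. Cs n i) at_top sequentially"
  by (rule filterlim_at_top_mono[OF assms]) (simp add: minC_le)

lemma eventually_minC_ge:
  assumes "filterlim (\<lambda>n. minC (Cs n)) at_top sequentially"
  shows "eventually (\<lambda>n. \<forall>i. m \<le> Cs n i) sequentially"
  using assms unfolding filterlim_at_top minC_ge_iff[symmetric] by blast

lemma inverse_real_tendsto_0:
  assumes "filterlim (f::nat \<Rightarrow> nat) at_top sequentially"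
  shows "(\<lambda>n. c / real (f n)) \<longlonglongrightarrow> 0" "(\<lambda>n. c / sqrt (real (f n))) \<longlonglongrightarrow> 0"
proof -
  have 1: "filterlim (\<lambda>n. real (f n)) at_top sequentially"
    using filterlim_compose[OF filterlim_real_sequentially assms] .
  then show "(\<lambda>n. c / real (f n)) \<longlonglongrightarrow> 0"
    by (intro tendsto_divide_0[OF tendsto_const] filterlim_at_top_imp_at_infinity)
  show "(\<lambda>n. c / sqrt (real (f n))) \<longlonglongrightarrow> 0"
    by (intro tendsto_divide_0[OF tendsto_const] filterlim_at_top_imp_at_infinity filterlim_compose[OF sqrt_at_top 1])
qed

section \<open>The conditional central limit theorem for a single function\<close>

context dissociated_array
begin

text \<open>Equality of integrals does not transfer integrability, because a non-integrable function
  has integral 0 by convention; equality of laws does.\<close>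

lemma distr_cell:
  assumes j: "j \<in> Cells"
  shows "distr M cellspace (cell j) = distr M cellspace (cell one_cell)"
proof (rule measure_eqI)
  fix A assume "A \<in> sets (distr M cellspace (cell j))"
  then have A: "A \<in> sets cellspace" by simp
  have "(\<integral>\<omega>. indicator A (cell j \<omega>) \<partial>M) = (\<integral>\<omega>. indicator A (cell one_cell \<omega>) \<partial>M :: real)"
    by (rule integral_cell[OF _ j]) (use A in measurable)
  moreover have "(\<integral>\<omega>. indicator A (cell j \<omega>) \<partial>M) = measure M (cell j -` A \<inter> space M)" for j
  proof -
    have "(\<integral>\<omega>. indicator A (cell j \<omega>) \<partial>M) = (\<integral>\<omega>. indicator (cell j -` A \<inter> space M) \<omega> \<partial>M :: real)"
      by (rule Bochner_Integration.integral_cong) (auto simp: indicator_def)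
    also have "\<dots> = measure M (cell j -` A \<inter> space M)"
      using measurable_sets[OF measurable_cell A, of j] by simp
    finally show ?thesis by simp
  qed
  ultimately show "emeasure (distr M cellspace (cell j)) A = emeasure (distr M cellspace (cell one_cell)) A"
    using A by (simp add: emeasure_distr emeasure_eq_measure)
qed simp

lemma integrable_cell:
  fixes g :: "_ \<Rightarrow> real"
  assumes g: "g \<in> borel_measurable cellspace" and j: "j \<in> Cells" and i: "integrable M (\<lambda>\<omega>. g (cell one_cell \<omega>))"
  shows "integrable M (\<lambda>\<omega>. g (cell j \<omega>))"
  using integrable_distr_eq[OF measurable_cell g, of j] integrable_distr_eq[OF measurable_cell g, of one_cell] i
  by (simp add: distr_cell[OF j])

definition Vlim :: "('k \<Rightarrow> real) \<Rightarrow> (nat \<times> (nat \<Rightarrow> 'v) \<Rightarrow> real) \<Rightarrow> real" where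
  "Vlim lam g = (\<Sum>i\<in>UNIV. lam i * cov M (\<lambda>\<omega>. g (cell one_cell \<omega>)) (\<lambda>\<omega>. g (cell (two_cell i) \<omega>)))"

text \<open>The pair law of large numbers is used twice, for the product of the two values and for
  the first value alone. The overall mean is bounded by B, so its squared error costs a factor 2 B,
  and B^2 + 2 B^2 is rounded up to 4 B^2.\<close>

lemma slice_variance_lln:
  fixes i :: 'k and g :: "nat \<times> (nat \<Rightarrow> 'v) \<Rightarrow> real"
  assumes g [measurable]: "g \<in> borel_measurable cellspace" and b: "\<And>x. \<bar>g x\<bar> \<le> B" and C: "\<And>i. C i \<ge> 1"
  defines "\<theta> \<equiv> cov M (\<lambda>\<omega>. g (cell one_cell \<omega>)) (\<lambda>\<omega>. g (cell (two_cell i) \<omega>))"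
  defines "v \<equiv> \<lambda>\<omega>. real (minC C) / real (C i) * (pair_avg C i (\<lambda>j. g (cell j \<omega>)) - (avg (obs_cells C) (\<lambda>j. g (cell j \<omega>)))\<^sup>2)"
  shows "integrable M v" and "(\<integral>\<omega>. \<bar>v \<omega> - l * \<theta>\<bar> \<partial>M) \<le>
    4 * B\<^sup>2 * sqrt (24 * (\<Sum>c\<in>UNIV. 1 / real (C c))) + \<bar>real (minC C) / real (C i) - l\<bar> * \<bar>\<theta>\<bar>"
proof -
  let ?O = "obs_cells C"
  note fO = finite_obs_cells[of C] and nO = obs_cells_nonempty[of C, OF C]
  have B0: "B \<ge> 0" using b[of undefined] by linarith
  define r where "r = real (minC C) / real (C i)"
  have r: "0 \<le> r" "r \<le> 1" using minC_le[of C i] C[of i] by (auto simp: r_def)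
  define \<theta>1 where "\<theta>1 = (\<integral>\<omega>. g (cell one_cell \<omega>) * g (cell (two_cell i) \<omega>) \<partial>M)"
  define \<mu> where "\<mu> = (\<integral>\<omega>. g (cell one_cell \<omega>) \<partial>M)"
  have \<theta>: "\<theta> = \<theta>1 - \<mu>\<^sup>2"
    unfolding \<theta>_def cov_def \<theta>1_def \<mu>_def by (simp add: integral_cell[OF g special_cells(2)] power2_eq_square)
  define PP where "PP \<omega> = pair_avg C i (\<lambda>j. g (cell j \<omega>))" for \<omega>
  define m where "m \<omega> = avg ?O (\<lambda>j. g (cell j \<omega>))" for \<omega>
  define S where "S = (\<Sum>c\<in>UNIV. 1 / real (C c))"
  have gj [measurable]: "(\<lambda>\<omega>. g (cell j \<omega>)) \<in> borel_measurable M" for j by measurable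
  have ig: "integrable M (\<lambda>\<omega>. g (cell j \<omega>))" for j
    by (rule integrable_const_bound[where B=B]) (use b in auto)
  have gg: "\<bar>g x * g y\<bar> \<le> B\<^sup>2" for x y
    using mult_mono[OF b[of x] b[of y]] B0 by (simp add: abs_mult power2_eq_square)
  have igg: "integrable M (\<lambda>\<omega>. g (cell j \<omega>) * g (cell j' \<omega>))" for j j'
    by (rule integrable_const_bound[where B="B\<^sup>2"]) (use gg in auto)
  have iPP: "integrable M PP" unfolding PP_def pair_avg_def by (intro integrable_avg igg)
  have im: "integrable M m" unfolding m_def by (intro integrable_avg ig)
  have [measurable]: "m \<in> borel_measurable M" "PP \<in> borel_measurable M" using im iPP by auto
  have avgb: "\<bar>avg ?O f\<bar> \<le> K" if "\<And>j. \<bar>f j\<bar> \<le> K" for f :: "('k \<Rightarrow> nat) \<Rightarrow> real" and K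
    using norm_avg_le[of ?O f] avg_le_bound[OF fO nO, of "\<lambda>j. \<bar>f j\<bar>" K] that by simp
  have mb: "\<bar>m \<omega>\<bar> \<le> B" for \<omega> unfolding m_def by (rule avgb) (rule b)
  have PPb: "\<bar>PP \<omega>\<bar> \<le> B\<^sup>2" for \<omega> unfolding PP_def pair_avg_def by (intro avgb gg)
  have \<mu>b: "\<bar>\<mu>\<bar> \<le> B"
  proof -
    have "\<bar>\<mu>\<bar> \<le> (\<integral>\<omega>. \<bar>g (cell one_cell \<omega>)\<bar> \<partial>M)" unfolding \<mu>_def by (rule integral_abs_bound)
    also have "\<dots> \<le> (\<integral>\<omega>. B \<partial>M)" by (intro integral_mono integrable_abs ig) (auto simp: b)
    finally show ?thesis by (simp add: prob_space)
  qed
  have im2: "integrable M (\<lambda>\<omega>. (m \<omega>)\<^sup>2)"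
    by (rule integrable_const_bound[where B="B\<^sup>2"]) (use power_mono[OF mb abs_ge_zero, of _ 2] in auto)
  have v: "v = (\<lambda>\<omega>. r * (PP \<omega> - (m \<omega>)\<^sup>2))" unfolding v_def r_def PP_def m_def ..
  show "integrable M v" unfolding v using iPP im2 by auto
  have L1: "(\<integral>\<omega>. \<bar>f \<omega>\<bar> \<partial>M) \<le> sqrt K" if "(\<integral>\<omega>. (f \<omega>)\<^sup>2 \<partial>M) \<le> K" "f \<in> borel_measurable M" "\<And>\<omega>. \<bar>f \<omega>\<bar> \<le> K'" for f :: "'a \<Rightarrow> real" and K K'
  proof -
    have "integrable M (\<lambda>\<omega>. (\<bar>f \<omega>\<bar>)\<^sup>2)"
      by (rule integrable_const_bound[where B="K'\<^sup>2"]) (use that(2) power_mono[OF that(3) abs_ge_zero, of _ 2] in auto)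
    from square_integral_le(2)[OF this] that show ?thesis by (intro real_le_rsqrt) simp
  qed
  have "(\<integral>\<omega>. (avg ?O (\<lambda>j. avg ?O (\<lambda>j'. pairf (\<lambda>x y. g x * g y) i j j' \<omega>)) - \<theta>1)\<^sup>2 \<partial>M) \<le> 4 * (B\<^sup>2)\<^sup>2 * (6 * S)"
    unfolding \<theta>1_def S_def by (rule pairf_lln[OF _ gg C]) measurable
  then have "(\<integral>\<omega>. (PP \<omega> - \<theta>1)\<^sup>2 \<partial>M) \<le> (B\<^sup>2)\<^sup>2 * (24 * S)"
    by (simp add: PP_def pair_avg_def pairf_def)
  moreover have "\<bar>PP \<omega> - \<theta>1\<bar> \<le> B\<^sup>2 + \<bar>\<theta>1\<bar>" for \<omega> using PPb[of \<omega>] by linarith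
  ultimately have PPL: "(\<integral>\<omega>. \<bar>PP \<omega> - \<theta>1\<bar> \<partial>M) \<le> sqrt ((B\<^sup>2)\<^sup>2 * (24 * S))"
    by (intro L1) auto
  \<comment> \<open>For a pair function that ignores its second argument, the pair law reduces to a
    law of large numbers for the plain cell average.\<close>
  have "(\<integral>\<omega>. (avg ?O (\<lambda>j. avg ?O (\<lambda>j'. pairf (\<lambda>x y. g x) i j j' \<omega>)) - \<mu>)\<^sup>2 \<partial>M) \<le> 4 * B\<^sup>2 * (6 * S)"
    unfolding \<mu>_def S_def by (rule pairf_lln[OF _ b C]) measurable
  then have "(\<integral>\<omega>. (m \<omega> - \<mu>)\<^sup>2 \<partial>M) \<le> B\<^sup>2 * (24 * S)"
    by (simp add: m_def pairf_def avg_const[OF fO nO])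
  moreover have "\<bar>m \<omega> - \<mu>\<bar> \<le> B + \<bar>\<mu>\<bar>" for \<omega> using mb[of \<omega>] by linarith
  ultimately have mL: "(\<integral>\<omega>. \<bar>m \<omega> - \<mu>\<bar> \<partial>M) \<le> sqrt (B\<^sup>2 * (24 * S))"
    by (intro L1) auto
  have "(\<integral>\<omega>. \<bar>v \<omega> - l * \<theta>\<bar> \<partial>M) \<le> (\<integral>\<omega>. \<bar>PP \<omega> - \<theta>1\<bar> + 2 * B * \<bar>m \<omega> - \<mu>\<bar> + \<bar>r - l\<bar> * \<bar>\<theta>\<bar> \<partial>M)"
  proof (rule integral_mono)
    show "integrable M (\<lambda>\<omega>. \<bar>v \<omega> - l * \<theta>\<bar>)" unfolding v using iPP im2 by auto
    show "integrable M (\<lambda>\<omega>. \<bar>PP \<omega> - \<theta>1\<bar> + 2 * B * \<bar>m \<omega> - \<mu>\<bar> + \<bar>r - l\<bar> * \<bar>\<theta>\<bar>)" using iPP im by auto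
    fix \<omega>
    have "\<bar>(m \<omega>)\<^sup>2 - \<mu>\<^sup>2\<bar> = \<bar>m \<omega> - \<mu>\<bar> * \<bar>m \<omega> + \<mu>\<bar>"
      by (simp add: abs_mult[symmetric] power2_eq_square algebra_simps)
    also have "\<dots> \<le> \<bar>m \<omega> - \<mu>\<bar> * (2 * B)" using mb[of \<omega>] \<mu>b by (intro mult_left_mono) auto
    finally have 1: "\<bar>(m \<omega>)\<^sup>2 - \<mu>\<^sup>2\<bar> \<le> 2 * B * \<bar>m \<omega> - \<mu>\<bar>" by (simp add: mult_ac)
    have "v \<omega> - l * \<theta> = r * ((PP \<omega> - \<theta>1) - ((m \<omega>)\<^sup>2 - \<mu>\<^sup>2)) + (r - l) * \<theta>"
      unfolding v \<theta> by (simp add: algebra_simps)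
    then have "\<bar>v \<omega> - l * \<theta>\<bar> \<le> \<bar>r * ((PP \<omega> - \<theta>1) - ((m \<omega>)\<^sup>2 - \<mu>\<^sup>2))\<bar> + \<bar>(r - l) * \<theta>\<bar>"
      using abs_triangle_ineq by metis
    also have "\<dots> = r * \<bar>(PP \<omega> - \<theta>1) - ((m \<omega>)\<^sup>2 - \<mu>\<^sup>2)\<bar> + \<bar>r - l\<bar> * \<bar>\<theta>\<bar>" using r by (simp add: abs_mult)
    also have "\<dots> \<le> 1 * \<bar>(PP \<omega> - \<theta>1) - ((m \<omega>)\<^sup>2 - \<mu>\<^sup>2)\<bar> + \<bar>r - l\<bar> * \<bar>\<theta>\<bar>"
      using r by (intro add_right_mono mult_right_mono) auto
    also have "\<dots> \<le> \<bar>PP \<omega> - \<theta>1\<bar> + 2 * B * \<bar>m \<omega> - \<mu>\<bar> + \<bar>r - l\<bar> * \<bar>\<theta>\<bar>" unfolding mult_1 using 1 by linarith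
    finally show "\<bar>v \<omega> - l * \<theta>\<bar> \<le> \<bar>PP \<omega> - \<theta>1\<bar> + 2 * B * \<bar>m \<omega> - \<mu>\<bar> + \<bar>r - l\<bar> * \<bar>\<theta>\<bar>" .
  qed
  also have "\<dots> = (\<integral>\<omega>. \<bar>PP \<omega> - \<theta>1\<bar> \<partial>M) + 2 * B * (\<integral>\<omega>. \<bar>m \<omega> - \<mu>\<bar> \<partial>M) + \<bar>r - l\<bar> * \<bar>\<theta>\<bar>"
    using iPP im by (simp add: prob_space)
  also have "\<dots> \<le> sqrt ((B\<^sup>2)\<^sup>2 * (24 * S)) + 2 * B * sqrt (B\<^sup>2 * (24 * S)) + \<bar>r - l\<bar> * \<bar>\<theta>\<bar>"
    using B0 by (intro add_mono PPL mult_left_mono mL) auto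
  also have "\<dots> = 3 * B\<^sup>2 * sqrt (24 * S) + \<bar>r - l\<bar> * \<bar>\<theta>\<bar>"
    using B0 by (simp add: real_sqrt_mult power2_eq_square)
  also have "\<dots> \<le> 4 * B\<^sup>2 * sqrt (24 * S) + \<bar>r - l\<bar> * \<bar>\<theta>\<bar>"
    by (intro add_right_mono mult_right_mono) (auto simp: S_def sum_nonneg)
  finally show "(\<integral>\<omega>. \<bar>v \<omega> - l * \<theta>\<bar> \<partial>M) \<le>
    4 * B\<^sup>2 * sqrt (24 * (\<Sum>c\<in>UNIV. 1 / real (C c))) + \<bar>real (minC C) / real (C i) - l\<bar> * \<bar>\<theta>\<bar>"
    unfolding S_def r_def .
qed

definition bchar :: "('k \<Rightarrow> nat) \<Rightarrow> (nat \<times> (nat \<Rightarrow> 'v) \<Rightarrow> real) \<Rightarrow> 'a \<Rightarrow> complex" where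
  "bchar C g \<omega> = avg (draws C) (\<lambda>D. iexp (bstat C D (\<lambda>j. g (cell j \<omega>))))"

lemma measurable_bstat [measurable]:
  assumes [measurable]: "g \<in> borel_measurable cellspace"
  shows "(\<lambda>\<omega>. bstat C D (\<lambda>j. g (cell j \<omega>))) \<in> borel_measurable M"
  unfolding bstat_def by measurable

lemma measurable_bchar [measurable]:
  assumes [measurable]: "g \<in> borel_measurable cellspace"
  shows "bchar C g \<in> borel_measurable M"
  unfolding bchar_def[abs_def] by (intro measurable_avg) measurable

lemma cmod_bchar_le: "cmod (bchar C g \<omega>) \<le> 1"
  unfolding bchar_def by (rule cmod_avg_iexp_le) (auto simp: finite_draws draws_nonempty)

text \<open>Components with at least two factors are removed in mean. The remaining characteristic
  function is Gaussian up to Taylor errors and the fluctuation of the conditional variances.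
  Nonnegativity of the limit variance is part of the claim because the truncation argument later
  needs it for each truncated function.\<close>

lemma bounded_bootstrap_clt:
  fixes Cs :: "nat \<Rightarrow> 'k \<Rightarrow> nat" and g :: "nat \<times> (nat \<Rightarrow> 'v) \<Rightarrow> real"
  assumes g [measurable]: "g \<in> borel_measurable cellspace" and b: "\<And>x. \<bar>g x\<bar> \<le> B"
    and C_lim: "filterlim (\<lambda>n. minC (Cs n)) at_top sequentially"
    and C_ratio: "\<And>i. (\<lambda>n. real (minC (Cs n)) / real (Cs n i)) \<longlonglongrightarrow> lam i"
  shows "(\<lambda>n. \<integral>\<omega>. cmod (bchar (Cs n) g \<omega> - of_real (exp (- Vlim lam g / 2))) \<partial>M) \<longlonglongrightarrow> 0"
    and "Vlim lam g \<ge> 0"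
proof -
  let ?d = "\<lambda>n \<omega>. cmod (bchar (Cs n) g \<omega> - of_real (exp (- Vlim lam g / 2)))"
  let ?A = "{A::'k set. card A \<ge> 2}" and ?X = "\<lambda>\<omega> j. g (cell j \<omega>)"
  let ?b = "\<lambda>n A \<omega>. avg (draws (Cs n)) (\<lambda>D. \<bar>bcomponent (Cs n) A D (?X \<omega>)\<bar>)"
  let ?r = "\<lambda>n i. 8 * B ^ 3 / sqrt (real (Cs n i)) + 16 * B ^ 4 / real (Cs n i)"
  have B0: "B \<ge> 0" using b[of undefined] by linarith
  define \<theta> where "\<theta> i = cov M (\<lambda>\<omega>. g (cell one_cell \<omega>)) (\<lambda>\<omega>. g (cell (two_cell i) \<omega>))" for i
  define w where "w i = lam i * \<theta> i" for i
  have V: "Vlim lam g = (\<Sum>i\<in>UNIV. w i)" by (simp add: Vlim_def w_def \<theta>_def)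
  define v where "v n i \<omega> = real (minC (Cs n)) / real (Cs n i) * (pair_avg (Cs n) i (\<lambda>j. g (cell j \<omega>)) - (avg (obs_cells (Cs n)) (\<lambda>j. g (cell j \<omega>)))\<^sup>2)"
    for n i \<omega>
  have Ci: "filterlim (\<lambda>n. Cs n i) at_top sequentially" for i by (rule filterlim_minC_imp[OF C_lim])
  have ev1: "eventually (\<lambda>n. \<forall>i. 1 \<le> Cs n i) sequentially" by (rule eventually_minC_ge[OF C_lim])
  define e where "e n i = 4 * B\<^sup>2 * sqrt (24 * (\<Sum>c\<in>UNIV. 1 / real (Cs n c))) + \<bar>real (minC (Cs n)) / real (Cs n i) - lam i\<bar> * \<bar>\<theta> i\<bar>" for n i
  have e0: "(\<lambda>n. e n i) \<longlonglongrightarrow> 0" for i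
  proof -
    have "(\<lambda>n. e n i) \<longlonglongrightarrow> 4 * B\<^sup>2 * sqrt (24 * (\<Sum>c\<in>(UNIV::'k set). 0)) + \<bar>lam i - lam i\<bar> * \<bar>\<theta> i\<bar>"
      unfolding e_def by (intro tendsto_intros inverse_real_tendsto_0(1)[OF Ci] C_ratio)
    then show ?thesis by simp
  qed
  have iv: "integrable M (v n i)" and ve: "(\<integral>\<omega>. \<bar>v n i \<omega> - w i\<bar> \<partial>M) \<le> e n i" if "\<forall>i. 1 \<le> Cs n i" for n i
    unfolding v_def w_def e_def \<theta>_def by (rule slice_variance_lln[OF g b]; use that in simp)+
  have v0: "v n i \<omega> \<ge> 0" if "\<forall>i. 1 \<le> Cs n i" for n i \<omega>
  proof -
    have "0 \<le> (\<Sum>a\<in>{1..Cs n i}. (slice_sum (Cs n) i (\<lambda>j. g (cell j \<omega>)) a - avg {1..Cs n i} (slice_sum (Cs n) i (\<lambda>j. g (cell j \<omega>))))\<^sup>2)"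
      by (rule sum_nonneg) simp
    also have "\<dots> = v n i \<omega>" unfolding v_def by (rule slice_sum_variance) (use that in blast)
    finally show ?thesis .
  qed
  \<comment> \<open>Each w i is the limit in mean of conditional variances, which are sums of
    squares.\<close>
  have w0: "w i \<ge> 0" for i
  proof -
    have "eventually (\<lambda>n. - w i \<le> e n i) sequentially"
      using ev1
    proof eventually_elim
      case (elim n)
      have "- w i = (\<integral>\<omega>. - w i \<partial>M)" by (simp add: prob_space)
      also have "\<dots> \<le> (\<integral>\<omega>. \<bar>v n i \<omega> - w i\<bar> \<partial>M)"
      proof (rule integral_mono)
        show "integrable M (\<lambda>\<omega>. \<bar>v n i \<omega> - w i\<bar>)" using iv[OF elim, of i] by auto
        fix \<omega> show "- w i \<le> \<bar>v n i \<omega> - w i\<bar>" using v0[OF elim, of i \<omega>] by linarith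
      qed simp
      also have "\<dots> \<le> e n i" by (rule ve[OF elim])
      finally show ?case .
    qed
    then have "- w i \<le> 0" by (intro tendsto_lowerbound[OF e0]) auto
    then show ?thesis by simp
  qed
  then show "Vlim lam g \<ge> 0" unfolding V by (rule sum_nonneg)
  \<comment> \<open>The first sum bounds the components with at least two factors. In the second,
    \<open>?r\<close> is the Taylor error and \<open>e\<close> the error of the conditional
    variance.\<close>
  define bnd where "bnd n = (\<Sum>A\<in>?A. sqrt (B\<^sup>2 * (2 ^ CARD('k) / real (minC (Cs n)))))
      + (\<Sum>i\<in>UNIV. ?r n i + e n i)" for n
  have "bnd \<longlonglongrightarrow> (\<Sum>A\<in>?A. sqrt (B\<^sup>2 * 0)) + (\<Sum>i\<in>(UNIV::'k set). 0 + 0 + 0)"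
    unfolding bnd_def by (intro tendsto_intros inverse_real_tendsto_0[OF Ci] inverse_real_tendsto_0[OF C_lim] e0)
  then have bnd0: "bnd \<longlonglongrightarrow> 0" by simp
  have "eventually (\<lambda>n. (\<integral>\<omega>. ?d n \<omega> \<partial>M) \<le> bnd n) sequentially"
    using ev1
  proof eventually_elim
    case (elim n)
    then have C: "Cs n i \<ge> 1" for i by blast
    define main where "main \<omega> = avg (draws (Cs n)) (\<lambda>D. iexp (\<Sum>i\<in>UNIV. bcomponent (Cs n) {i} D (?X \<omega>)))" for \<omega>
    have gj: "(\<lambda>\<omega>. g (cell j \<omega>)) \<in> borel_measurable M" for j by measurable
    have gi: "integrable M (\<lambda>\<omega>. (g (cell j \<omega>))\<^sup>2)" for j
      by (rule integrable_const_bound[where B="B\<^sup>2"]) (use power_mono[OF b abs_ge_zero, of _ 2] in auto)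
    have gq: "(\<integral>\<omega>. (g (cell j \<omega>))\<^sup>2 \<partial>M) \<le> B\<^sup>2" for j
    proof -
      have "(\<integral>\<omega>. (g (cell j \<omega>))\<^sup>2 \<partial>M) \<le> (\<integral>\<omega>. B\<^sup>2 \<partial>M)"
        by (rule integral_mono[OF gi]) (use power_mono[OF b abs_ge_zero, of _ 2] in auto)
      then show ?thesis by (simp add: prob_space)
    qed
    note Bc = integral_avg_abs_bcomponent_le[of "Cs n" "\<lambda>j \<omega>. g (cell j \<omega>)" "B\<^sup>2", OF C gj gi gq]
    have split: "bstat (Cs n) D x - (\<Sum>i\<in>UNIV. bcomponent (Cs n) {i} D x) = (\<Sum>A\<in>?A. bcomponent (Cs n) A D x)" for D x
    proof -
      have U: "UNIV - {{}} = ?A \<union> (\<lambda>i. {i}) ` (UNIV :: 'k set)"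
      proof -
        have "A = {} \<or> card A \<ge> 2 \<or> (\<exists>i. A = {i})" for A :: "'k set"
        proof -
          have "card A = 0 \<or> card A = 1 \<or> card A \<ge> 2" by linarith
          then show ?thesis by (auto simp: card_1_singleton_iff)
        qed
        then show ?thesis by auto
      qed
      have "bstat (Cs n) D x = (\<Sum>A\<in>?A. bcomponent (Cs n) A D x) + (\<Sum>A\<in>(\<lambda>i. {i}) ` UNIV. bcomponent (Cs n) A D x)"
        unfolding bstat_expand U by (rule sum.union_disjoint) auto
      also have "(\<Sum>A\<in>(\<lambda>i. {i}) ` UNIV. bcomponent (Cs n) A D x) = (\<Sum>i\<in>UNIV. bcomponent (Cs n) {i} D x)"
        by (subst sum.reindex) auto
      finally show ?thesis by simp
    qed
    have d1: "cmod (bchar (Cs n) g \<omega> - main \<omega>) \<le> (\<Sum>A\<in>?A. ?b n A \<omega>)" for \<omega>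
    proof -
      have "cmod (bchar (Cs n) g \<omega> - main \<omega>) \<le> avg (draws (Cs n)) (\<lambda>D. \<bar>bstat (Cs n) D (?X \<omega>) - (\<Sum>i\<in>UNIV. bcomponent (Cs n) {i} D (?X \<omega>))\<bar>)"
        unfolding bchar_def main_def by (rule cmod_avg_iexp_diff_le)
      also have "\<dots> \<le> avg (draws (Cs n)) (\<lambda>D. \<Sum>A\<in>?A. \<bar>bcomponent (Cs n) A D (?X \<omega>)\<bar>)"
        unfolding split by (rule avg_mono) (rule sum_abs)
      finally show ?thesis by (simp add: avg_sum)
    qed
    have d2: "cmod (main \<omega> - of_real (exp (- Vlim lam g / 2))) \<le>
       (\<Sum>i\<in>UNIV. ?r n i + \<bar>v n i \<omega> - w i\<bar>)" for \<omega>
      unfolding main_def V v_def by (rule avg_iexp_main_approx[OF C b w0])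
    have ivw: "integrable M (\<lambda>\<omega>. \<bar>v n i \<omega> - w i\<bar>)" for i using iv[OF elim, of i] by auto
    have "(\<integral>\<omega>. ?d n \<omega> \<partial>M)
      \<le> (\<integral>\<omega>. (\<Sum>A\<in>?A. ?b n A \<omega>) +
         (\<Sum>i\<in>UNIV. ?r n i + \<bar>v n i \<omega> - w i\<bar>) \<partial>M)"
    proof (rule integral_mono)
      have "cmod (of_real (exp (- Vlim lam g / 2))) \<le> 1" using \<open>Vlim lam g \<ge> 0\<close> by simp
      then have "?d n \<omega> \<le> 2" for \<omega>
        using norm_triangle_ineq4[of "bchar (Cs n) g \<omega>" "of_real (exp (- Vlim lam g / 2))"] cmod_bchar_le[of "Cs n" g \<omega>] by linarith
      then show "integrable M (\<lambda>\<omega>. ?d n \<omega>)"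
        by (intro integrable_const_bound[where B=2]) auto
      show "integrable M (\<lambda>\<omega>. (\<Sum>A\<in>?A. ?b n A \<omega>) +
         (\<Sum>i\<in>UNIV. ?r n i + \<bar>v n i \<omega> - w i\<bar>))"
        using Bc(1) ivw by (intro Bochner_Integration.integrable_add Bochner_Integration.integrable_sum) auto
      fix \<omega>
      show "?d n \<omega> \<le> (\<Sum>A\<in>?A. ?b n A \<omega>) +
         (\<Sum>i\<in>UNIV. ?r n i + \<bar>v n i \<omega> - w i\<bar>)"
        using d1[of \<omega>] d2[of \<omega>] norm_triangle_ineq[of "bchar (Cs n) g \<omega> - main \<omega>" "main \<omega> - of_real (exp (- Vlim lam g / 2))"]
        by simp
    qed
    also have "\<dots> = (\<Sum>A\<in>?A. \<integral>\<omega>. ?b n A \<omega> \<partial>M) +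
         (\<Sum>i\<in>UNIV. ?r n i + (\<integral>\<omega>. \<bar>v n i \<omega> - w i\<bar> \<partial>M))"
      using Bc(1) ivw by (simp add: prob_space)
    also have "\<dots> \<le> bnd n"
      unfolding bnd_def
    proof (intro add_mono sum_mono order_refl ve[OF elim])
      fix A :: "'k set" assume "A \<in> ?A"
      then have "sqrt (B\<^sup>2 * (real (minC (Cs n)) * (\<Prod>i\<in>A. 2 / real ((Cs n) i)))) \<le> sqrt (B\<^sup>2 * (2 ^ CARD('k) / real (minC (Cs n))))"
        using minC_prod_le(2)[of "Cs n" A] C by (intro real_sqrt_le_mono mult_left_mono) auto
      with Bc(2)[of A] show "(\<integral>\<omega>. ?b n A \<omega> \<partial>M) \<le> sqrt (B\<^sup>2 * (2 ^ CARD('k) / real (minC (Cs n))))"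
        by linarith
    qed
    finally show ?case .
  qed
  then show "(\<lambda>n. \<integral>\<omega>. ?d n \<omega> \<partial>M) \<longlonglongrightarrow> 0"
    by (intro tendsto_sandwich[OF _ _ tendsto_const bnd0]) auto
qed

text \<open>Truncation. The difference between g and its truncation is controlled in mean square
  uniformly in the sample sizes, so the level b can be fixed first and n sent to infinity
  afterwards. Boundedness is what the fourth-order law of large numbers and the Taylor expansion
  require.\<close>

theorem bootstrap_clt:
  fixes Cs :: "nat \<Rightarrow> 'k \<Rightarrow> nat" and g :: "nat \<times> (nat \<Rightarrow> 'v) \<Rightarrow> real"
  assumes g [measurable]: "g \<in> borel_measurable cellspace" and g2: "integrable M (\<lambda>\<omega>. (g (cell one_cell \<omega>))\<^sup>2)"
    and C_lim: "filterlim (\<lambda>n. minC (Cs n)) at_top sequentially"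
    and C_ratio: "\<And>i. (\<lambda>n. real (minC (Cs n)) / real (Cs n i)) \<longlonglongrightarrow> lam i"
  shows "(\<lambda>n. \<integral>\<omega>. cmod (bchar (Cs n) g \<omega> - of_real (exp (- Vlim lam g / 2))) \<partial>M) \<longlonglongrightarrow> 0"
    and "Vlim lam g \<ge> 0"
proof -
  define t where "t b x = max (- real b) (min (real b) (g x))" for b x
  let ?S = "UNIV - {{}::'k set}"
  let ?d = "\<lambda>C \<omega>. cmod (bchar C g \<omega> - of_real (exp (- Vlim lam g / 2)))"
  let ?dt = "\<lambda>b C \<omega>. cmod (bchar C (t b) \<omega> - of_real (exp (- Vlim lam (t b) / 2)))"
  let ?e = "\<lambda>b. \<bar>exp (- Vlim lam (t b) / 2) - exp (- Vlim lam g / 2)\<bar>"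
  have t [measurable]: "t b \<in> borel_measurable cellspace" for b unfolding t_def[abs_def] by measurable
  have tb: "\<bar>t b x\<bar> \<le> real b" for b x by (auto simp: t_def)
  have tg: "\<bar>t b x\<bar> \<le> \<bar>g x\<bar>" "\<bar>g x - t b x\<bar> \<le> \<bar>g x\<bar>" for b x by (auto simp: t_def)
  have tlim: "(\<lambda>b. t b x) \<longlonglongrightarrow> g x" for x
  proof (rule tendsto_eventually)
    obtain b0 :: nat where "\<bar>g x\<bar> \<le> real b0" using real_arch_simple by blast
    then show "eventually (\<lambda>b. t b x = g x) sequentially"
      by (intro eventually_sequentiallyI[of b0]) (auto simp: t_def)
  qed
  have [measurable]: "(\<lambda>\<omega>. g (cell j \<omega>)) \<in> borel_measurable M" for j by measurable
  have ig2: "integrable M (\<lambda>\<omega>. (g (cell j \<omega>))\<^sup>2)" if "j \<in> Cells" for j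
    by (rule integrable_cell[OF _ that g2]) measurable
  have ig: "integrable M (\<lambda>\<omega>. g (cell j \<omega>))" if "j \<in> Cells" for j
    by (rule square_integral_le(1)[OF ig2[OF that]]) simp
  define q where "q b = (\<integral>\<omega>. (g (cell one_cell \<omega>) - t b (cell one_cell \<omega>))\<^sup>2 \<partial>M)" for b
  have q0: "q \<longlonglongrightarrow> 0"
  proof -
    have "q \<longlonglongrightarrow> (\<integral>\<omega>. 0 \<partial>M)" unfolding q_def
    proof (rule integral_dominated_convergence[where w="\<lambda>\<omega>. (g (cell one_cell \<omega>))\<^sup>2"])
      show "AE \<omega> in M. (\<lambda>b. (g (cell one_cell \<omega>) - t b (cell one_cell \<omega>))\<^sup>2) \<longlonglongrightarrow> 0"
      proof (rule AE_I2)
        fix \<omega>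
        have "(\<lambda>b. (g (cell one_cell \<omega>) - t b (cell one_cell \<omega>))\<^sup>2) \<longlonglongrightarrow> (g (cell one_cell \<omega>) - g (cell one_cell \<omega>))\<^sup>2"
          by (intro tendsto_intros tlim)
        then show "(\<lambda>b. (g (cell one_cell \<omega>) - t b (cell one_cell \<omega>))\<^sup>2) \<longlonglongrightarrow> 0" by simp
      qed
      show "AE \<omega> in M. norm ((g (cell one_cell \<omega>) - t b (cell one_cell \<omega>))\<^sup>2) \<le> (g (cell one_cell \<omega>))\<^sup>2" for b
        using power_mono[OF tg(2) abs_ge_zero, of _ _ 2] by auto
    qed (use g2 in auto)
    then show ?thesis by simp
  qed
  \<comment> \<open>Dominated convergence, with the products and values of the untruncated function
    as dominating functions; their integrability comes from the second moment of one cell.\<close>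
  have Vt: "(\<lambda>b. Vlim lam (t b)) \<longlonglongrightarrow> Vlim lam g"
    unfolding Vlim_def cov_def
  proof (intro tendsto_intros)
    fix i
    show "(\<lambda>b. \<integral>\<omega>. t b (cell one_cell \<omega>) * t b (cell (two_cell i) \<omega>) \<partial>M) \<longlonglongrightarrow> (\<integral>\<omega>. g (cell one_cell \<omega>) * g (cell (two_cell i) \<omega>) \<partial>M)"
    proof (rule integral_dominated_convergence[where w="\<lambda>\<omega>. \<bar>g (cell one_cell \<omega>) * g (cell (two_cell i) \<omega>)\<bar>"])
      show "integrable M (\<lambda>\<omega>. \<bar>g (cell one_cell \<omega>) * g (cell (two_cell i) \<omega>)\<bar>)"
        by (intro integrable_abs integrable_mult_squares ig2 special_cells) auto
      show "AE \<omega> in M. (\<lambda>b. t b (cell one_cell \<omega>) * t b (cell (two_cell i) \<omega>)) \<longlonglongrightarrow> g (cell one_cell \<omega>) * g (cell (two_cell i) \<omega>)"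
        by (intro AE_I2 tendsto_intros tlim)
      show "AE \<omega> in M. norm (t b (cell one_cell \<omega>) * t b (cell (two_cell i) \<omega>)) \<le> \<bar>g (cell one_cell \<omega>) * g (cell (two_cell i) \<omega>)\<bar>" for b
        unfolding real_norm_def abs_mult by (intro AE_I2 mult_mono tg) auto
    qed auto
    have "(\<lambda>b. \<integral>\<omega>. t b (cell j \<omega>) \<partial>M) \<longlonglongrightarrow> (\<integral>\<omega>. g (cell j \<omega>) \<partial>M)" if "j \<in> Cells" for j
      by (rule integral_dominated_convergence[where w="\<lambda>\<omega>. \<bar>g (cell j \<omega>)\<bar>"])
         (use ig[OF that] tg tlim in auto)
    from this[OF special_cells(1)] this[OF special_cells(2)]
    show "(\<lambda>b. \<integral>\<omega>. t b (cell one_cell \<omega>) \<partial>M) \<longlonglongrightarrow> (\<integral>\<omega>. g (cell one_cell \<omega>) \<partial>M)"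
      "(\<lambda>b. \<integral>\<omega>. t b (cell (two_cell i) \<omega>) \<partial>M) \<longlonglongrightarrow> (\<integral>\<omega>. g (cell (two_cell i) \<omega>) \<partial>M)" by auto
  qed
  note bdd = bounded_bootstrap_clt[where lam=lam, OF t tb C_lim C_ratio]
  show V0: "Vlim lam g \<ge> 0" by (rule tendsto_lowerbound[OF Vt]) (use bdd(2) in auto)
  define c where "c b = (\<Sum>A\<in>?S. sqrt (q b * 2 ^ CARD('k))) + ?e b" for b
  have "c \<longlonglongrightarrow> (\<Sum>A\<in>?S. sqrt (0 * 2 ^ CARD('k))) + \<bar>exp (- Vlim lam g / 2) - exp (- Vlim lam g / 2)\<bar>"
    unfolding c_def by (intro tendsto_intros q0 Vt) auto
  then have c0: "c \<longlonglongrightarrow> 0" by simp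
  \<comment> \<open>The constant \<open>c b\<close> does not depend on C: every component of the
    truncation error is bounded through the first part of \<open>minC_prod_le\<close>.\<close>
  have main: "(\<integral>\<omega>. ?d C \<omega> \<partial>M)
    \<le> c b + (\<integral>\<omega>. ?dt b C \<omega> \<partial>M)" if "\<forall>i. 1 \<le> C i" for C b
  proof -
    have C: "1 \<le> C i" for i using that by blast
    have OC: "j \<in> Cells" if "j \<in> obs_cells C" for j using that by (auto simp: obs_cells_def Cells_def)
    let ?X = "\<lambda>j \<omega>. g (cell j \<omega>) - t b (cell j \<omega>)"
    let ?a = "\<lambda>A \<omega>. avg (draws C) (\<lambda>D. \<bar>bcomponent C A D (\<lambda>j. ?X j \<omega>)\<bar>)"
    have Xi: "integrable M (\<lambda>\<omega>. (?X j \<omega>)\<^sup>2)" if "j \<in> Cells" for j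
    proof (rule Bochner_Integration.integrable_bound[OF ig2[OF that]])
      show "AE \<omega> in M. norm ((?X j \<omega>)\<^sup>2) \<le> norm ((g (cell j \<omega>))\<^sup>2)"
        using power_mono[OF tg(2) abs_ge_zero, of _ _ 2] by auto
    qed simp
    have Xq: "(\<integral>\<omega>. (?X j \<omega>)\<^sup>2 \<partial>M) \<le> q b" if "j \<in> Cells" for j
      using integral_cell[of "\<lambda>x. (g x - t b x)\<^sup>2", OF _ that] by (simp add: q_def)
    have Bc: "integrable M (\<lambda>\<omega>. ?a A \<omega>)"
       "(\<integral>\<omega>. ?a A \<omega> \<partial>M) \<le> sqrt (q b * (real (minC C) * (\<Prod>i\<in>A. 2 / real (C i))))" for A
      by (rule integral_avg_abs_bcomponent_le[of C ?X, OF C _ Xi[OF OC] Xq[OF OC]]; simp)+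
    have d1: "cmod (bchar C g \<omega> - bchar C (t b) \<omega>) \<le> (\<Sum>A\<in>?S. ?a A \<omega>)" for \<omega>
    proof -
      have "cmod (bchar C g \<omega> - bchar C (t b) \<omega>) \<le> avg (draws C) (\<lambda>D. \<bar>bstat C D (\<lambda>j. g (cell j \<omega>)) - bstat C D (\<lambda>j. t b (cell j \<omega>))\<bar>)"
        unfolding bchar_def by (rule cmod_avg_iexp_diff_le)
      also have "\<dots> = avg (draws C) (\<lambda>D. \<bar>\<Sum>A\<in>?S. bcomponent C A D (\<lambda>j. ?X j \<omega>)\<bar>)"
        by (simp only: bstat_expand[symmetric] bstat_diff)
      also have "\<dots> \<le> avg (draws C) (\<lambda>D. \<Sum>A\<in>?S. \<bar>bcomponent C A D (\<lambda>j. ?X j \<omega>)\<bar>)"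
        by (rule avg_mono) (rule sum_abs)
      finally show ?thesis by (simp add: avg_sum)
    qed
    have ic: "integrable M (\<lambda>\<omega>. cmod (bchar C h \<omega> - of_real (exp (- v / 2))))" if "h \<in> borel_measurable cellspace" "v \<ge> 0" for h v
    proof -
      have "cmod (of_real (exp (- v / 2))) \<le> 1" using that by simp
      then have "cmod (bchar C h \<omega> - of_real (exp (- v / 2))) \<le> 2" for \<omega>
        using norm_triangle_ineq4[of "bchar C h \<omega>" "of_real (exp (- v / 2))"] cmod_bchar_le[of C h \<omega>] by linarith
      then show ?thesis using that by (intro integrable_const_bound[where B=2]) auto
    qed
    have "(\<integral>\<omega>. ?d C \<omega> \<partial>M)
      \<le> (\<integral>\<omega>. (\<Sum>A\<in>?S. ?a A \<omega>) +
          (?dt b C \<omega> + ?e b) \<partial>M)"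
    proof (rule integral_mono)
      show "integrable M (\<lambda>\<omega>. ?d C \<omega>)" by (rule ic[OF g V0])
      show "integrable M (\<lambda>\<omega>. (\<Sum>A\<in>?S. ?a A \<omega>) +
          (?dt b C \<omega> + ?e b))"
        using Bc(1) ic[OF t bdd(2)] by (intro Bochner_Integration.integrable_add Bochner_Integration.integrable_sum) auto
      fix \<omega>
      have "cmod (complex_of_real (exp (- Vlim lam (t b) / 2)) - of_real (exp (- Vlim lam g / 2))) = ?e b"
        by (metis norm_of_real of_real_diff)
      moreover have "cmod (x - z) \<le> cmod (x - y) + (cmod (y - y') + cmod (y' - z))" for x y y' z
        using norm_triangle_ineq[of "x - y" "y - z"] norm_triangle_ineq[of "y - y'" "y' - z"] by simp
      ultimately show "?d C \<omega> \<le> (\<Sum>A\<in>?S. ?a A \<omega>) +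
          (?dt b C \<omega> + ?e b)"
        using d1[of \<omega>] by (smt (verit))
    qed
    also have "\<dots> = (\<Sum>A\<in>?S. \<integral>\<omega>. ?a A \<omega> \<partial>M) +
          ((\<integral>\<omega>. ?dt b C \<omega> \<partial>M) + ?e b)"
      using Bc(1) ic[OF t bdd(2)] by (simp add: prob_space)
    also have "(\<Sum>A\<in>?S. \<integral>\<omega>. ?a A \<omega> \<partial>M) \<le> (\<Sum>A\<in>?S. sqrt (q b * 2 ^ CARD('k)))"
    proof (rule sum_mono)
      fix A :: "'k set" assume "A \<in> ?S"
      then have "sqrt (q b * (real (minC C) * (\<Prod>i\<in>A. 2 / real (C i)))) \<le> sqrt (q b * 2 ^ CARD('k))"
        using minC_prod_le(1)[of C A] C by (intro real_sqrt_le_mono mult_left_mono) (auto simp: q_def)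
      with Bc(2)[of A] show "(\<integral>\<omega>. ?a A \<omega> \<partial>M) \<le> sqrt (q b * 2 ^ CARD('k))"
        by linarith
    qed
    finally show ?thesis by (simp add: c_def)
  qed
  show "(\<lambda>n. \<integral>\<omega>. ?d (Cs n) \<omega> \<partial>M) \<longlonglongrightarrow> 0"
  proof (rule tendstoI)
    fix e :: real assume e: "e > 0"
    obtain b where b: "c b < e / 2"
      using order_tendstoD(2)[OF c0, of "e/2"] e by (auto simp: eventually_sequentially)
    have "eventually (\<lambda>n. (\<integral>\<omega>. ?dt b (Cs n) \<omega> \<partial>M) < e / 2) sequentially"
      using order_tendstoD(2)[OF bdd(1)[of b], of "e/2"] e by simp
    then show "eventually (\<lambda>n. dist (\<integral>\<omega>. ?d (Cs n) \<omega> \<partial>M) 0 < e) sequentially"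
      using eventually_minC_ge[OF C_lim, of 1]
    proof eventually_elim
      case (elim n)
      have "(\<integral>\<omega>. ?d (Cs n) \<omega> \<partial>M) < e"
        using main[OF elim(2), of b] elim(1) b by linarith
      moreover have "0 \<le> (\<integral>\<omega>. ?d (Cs n) \<omega> \<partial>M)" by simp
      ultimately show ?case by (simp only: dist_real_def diff_0_right abs_of_nonneg)
    qed
  qed
qed

end

subsection \<open>Gaussian smoothing\<close>

locale smoothing =
  fixes S :: "'s set" and \<sigma> :: real
  assumes finS: "finite S" and \<sigma>: "\<sigma> > 0"
begin

abbreviation L :: "('s \<Rightarrow> real) measure" where "L \<equiv> PiM S (\<lambda>_. lborel)"
abbreviation \<nu> :: "('s \<Rightarrow> real) measure" where "\<nu> \<equiv> PiM S (\<lambda>_. std_normal_distribution)"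

definition kern :: "('s \<Rightarrow> real) \<Rightarrow> ('s \<Rightarrow> real) \<Rightarrow> real" where
  "kern m x = (\<Prod>s\<in>S. normal_density (m s) \<sigma> (x s))"

lemma PSF: "product_sigma_finite (\<lambda>_::'s. lborel :: real measure)"
  by standard

lemma L_sigma_finite: "sigma_finite_measure L"
  by (rule product_sigma_finite.sigma_finite[OF PSF finS])

lemma prob_\<nu>: "prob_space \<nu>"
  by (intro prob_space_PiM prob_space_normal_density) simp

lemma kern_nonneg: "kern m x \<ge> 0"
  unfolding kern_def by (intro prod_nonneg) auto

lemma measurable_kern_L [measurable]: "kern m \<in> borel_measurable L"
  unfolding kern_def[abs_def] by measurable

lemma kern_integral: "integrable L (kern m)" "(\<integral>x. kern m x \<partial>L) = 1"
proof -
  interpret product_sigma_finite "\<lambda>_::'s. lborel :: real measure" by (rule PSF)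
  show "integrable L (kern m)" unfolding kern_def[abs_def]
    by (rule product_integrable_prod[OF finS]) (use \<sigma> in auto)
  show "(\<integral>x. kern m x \<partial>L) = 1" unfolding kern_def
    by (subst product_integral_prod[OF finS]) (use \<sigma> in auto)
qed

text \<open>The integrand is again a product over S with a single modified factor, so the integral
  splits. That factor gives \<sigma> sqrt (2 / pi), and all others integrate to 1.\<close>

lemma kern_moment:
  assumes s0: "s0 \<in> S"
  shows "integrable L (\<lambda>x. kern m x * \<bar>x s0 - m s0\<bar>)" "(\<integral>x. kern m x * \<bar>x s0 - m s0\<bar> \<partial>L) \<le> \<sigma>"
proof -
  interpret product_sigma_finite "\<lambda>_::'s. lborel :: real measure" by (rule PSF)
  define f where "f s u = normal_density (m s) \<sigma> u * (if s = s0 then \<bar>u - m s\<bar> else 1)" for s and u :: real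
  have eq: "kern m x * \<bar>x s0 - m s0\<bar> = (\<Prod>s\<in>S. f s (x s))" for x
  proof -
    have "(\<Prod>s\<in>S. f s (x s)) = (\<Prod>s\<in>S. normal_density (m s) \<sigma> (x s)) * (\<Prod>s\<in>S. if s = s0 then \<bar>x s - m s\<bar> else 1)"
      unfolding f_def by (rule prod.distrib)
    also have "(\<Prod>s\<in>S. if s = s0 then \<bar>x s - m s\<bar> else 1) = \<bar>x s0 - m s0\<bar>"
      using s0 finS by (simp add: prod.delta)
    finally show ?thesis by (simp add: kern_def)
  qed
  have fi: "integrable lborel (f s)" for s
    using integrable_normal_moment_abs[OF \<sigma>, of "m s" 1] \<sigma> by (cases "s = s0") (auto simp: f_def[abs_def])
  show "integrable L (\<lambda>x. kern m x * \<bar>x s0 - m s0\<bar>)" unfolding eq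
    by (rule product_integrable_prod[OF finS]) (rule fi)
  have "(\<integral>x. kern m x * \<bar>x s0 - m s0\<bar> \<partial>L) = (\<Prod>s\<in>S. \<integral>u. f s u \<partial>lborel)"
    unfolding eq by (rule product_integral_prod[OF finS]) (rule fi)
  also have "\<dots> = (\<Prod>s\<in>S. if s = s0 then (\<integral>u. f s0 u \<partial>lborel) else 1)"
    by (intro prod.cong refl) (use \<sigma> in \<open>auto simp: f_def\<close>)
  also have "\<dots> = (\<integral>u. f s0 u \<partial>lborel)" using s0 finS by (simp add: prod.delta)
  also have "\<dots> = \<sigma> * sqrt (2 / pi)"
    using integral_normal_moment_abs_odd[OF \<sigma>, of "m s0" 0] by (simp add: f_def)
  also have "\<dots> \<le> \<sigma> * 1"
    using \<sigma> pi_gt3 by (intro mult_left_mono) auto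
  finally show "(\<integral>x. kern m x * \<bar>x s0 - m s0\<bar> \<partial>L) \<le> \<sigma>" by simp
qed

text \<open>The domain is all of \<open>'s \<Rightarrow> real\<close>, although the Lipschitz bound
  forces H to ignore coordinates outside S. A functional of paths can thus be inserted without
  restricting the path to S.\<close>

definition bounded_lip :: "(('s \<Rightarrow> real) \<Rightarrow> real) \<Rightarrow> bool" where
  "bounded_lip H \<longleftrightarrow> (\<forall>x. \<bar>H x\<bar> \<le> 1) \<and> (\<forall>x y. \<bar>H x - H y\<bar> \<le> (\<Sum>s\<in>S. \<bar>x s - y s\<bar>))"

text \<open>H equals its own Lipschitz extension from the rational points, in the manner of McShane.
  This is an infimum of countably many measurable functions.\<close>

lemma bounded_lip_measurable [measurable]:
  assumes "bounded_lip H"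
  shows "H \<in> borel_measurable (PiM S (\<lambda>_. borel))"
proof -
  define R where "R = PiE S (\<lambda>_. \<rat> :: real set)"
  have cR: "countable R" unfolding R_def by (rule countable_PiE) (auto simp: finS countable_rat)
  have nR: "R \<noteq> {}" unfolding R_def by (auto simp: PiE_eq_empty_iff)
  let ?G = "\<lambda>r x. H r + (\<Sum>s\<in>S. \<bar>x s - r s\<bar>)"
  have lo: "H x \<le> ?G r x" for r x using assms unfolding bounded_lip_def by (metis abs_le_D1 diff_le_eq add.commute)
  have bdd: "bdd_below ((\<lambda>r. ?G r x) ` R)" for x using lo[of x] by (auto simp: bdd_below_def)
  have "H x = (INF r\<in>R. ?G r x)" for x
  proof (rule antisym)
    show "H x \<le> (INF r\<in>R. ?G r x)" by (rule cINF_greatest[OF nR]) (rule lo)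
    show "(INF r\<in>R. ?G r x) \<le> H x"
    proof (rule field_le_epsilon)
      fix e :: real assume e: "e > 0"
      \<comment> \<open>The error arises once in moving the argument of H and once in the distance
        term, hence the 2. The + 1 keeps the denominator positive when S is empty.\<close>
      define d where "d = e / (2 * (real (card S) + 1))"
      have d: "d > 0" using e by (simp add: d_def)
      have "\<exists>q\<in>\<rat>. \<bar>x s - q\<bar> < d" for s
        using Rats_dense_in_real[of "x s - d" "x s"] d by (smt (verit))
      then obtain q where q: "\<And>s. q s \<in> \<rat>" "\<And>s. \<bar>x s - q s\<bar> < d" by metis
      define r where "r = restrict q S"
      have rR: "r \<in> R" using q by (auto simp: r_def R_def)
      have rs: "(\<Sum>s\<in>S. \<bar>x s - r s\<bar>) \<le> real (card S) * d"
        using sum_bounded_above[of S "\<lambda>s. \<bar>x s - r s\<bar>" d] q by (auto simp: r_def less_imp_le)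
      have "(INF r\<in>R. ?G r x) \<le> ?G r x" by (rule cINF_lower[OF bdd rR])
      also have "H r \<le> H x + (\<Sum>s\<in>S. \<bar>x s - r s\<bar>)"
        using assms unfolding bounded_lip_def by (metis abs_le_D2 abs_minus_commute minus_diff_eq add.commute diff_le_eq)
      finally have "(INF r\<in>R. ?G r x) \<le> H x + 2 * (real (card S) * d)" using rs by simp
      also have "2 * (real (card S) * d) \<le> e" using e by (simp add: d_def field_simps)
      finally show "(INF r\<in>R. ?G r x) \<le> H x + e" by simp
    qed
  qed
  then have "H = (\<lambda>x. INF r\<in>R. ?G r x)" by (rule ext)
  also have "\<dots> \<in> borel_measurable (PiM S (\<lambda>_. borel))"
    by (rule borel_measurable_cINF[OF cR]) (measurable, rule bdd)
  finally show ?thesis .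
qed

lemma sets_L: "sets L = sets (PiM S (\<lambda>_. borel))"
  by (rule sets_PiM_cong) auto

lemma bounded_lip_measurable_L: "bounded_lip H \<Longrightarrow> H \<in> borel_measurable L"
  using bounded_lip_measurable measurable_cong_sets[OF sets_L refl] by blast

lemma bounded_lip_cong:
  assumes "bounded_lip H" "\<And>s. s \<in> S \<Longrightarrow> x s = y s"
  shows "H x = H y"
  using assms unfolding bounded_lip_def by (metis (no_types, lifting) abs_le_zero_iff abs_zero diff_self eq_iff_diff_eq_0 sum.neutral)

lemma bounded_lip_kern_integrable: "bounded_lip H \<Longrightarrow> integrable L (\<lambda>x. H x * kern m x)"
  by (rule Bochner_Integration.integrable_bound[OF kern_integral(1)[of m]])
     (use bounded_lip_measurable_L in \<open>auto simp: bounded_lip_def abs_mult kern_nonneg intro!: mult_left_le_one_le\<close>)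

lemma bounded_lip_smooth:
  assumes H: "bounded_lip H"
  shows "\<bar>(\<integral>x. H x * kern m x \<partial>L) - H m\<bar> \<le> real (card S) * \<sigma>"
proof -
  have [measurable]: "H \<in> borel_measurable L" by (rule bounded_lip_measurable_L[OF H])
  have i1: "integrable L (\<lambda>x. (H x - H m) * kern m x)"
    using bounded_lip_kern_integrable[OF H, of m] kern_integral(1)[of m] by (simp add: left_diff_distrib)
  have "(\<integral>x. H x * kern m x \<partial>L) - H m = (\<integral>x. (H x - H m) * kern m x \<partial>L)"
    using bounded_lip_kern_integrable[OF H, of m] kern_integral[of m] by (simp add: left_diff_distrib)
  also have "\<bar>\<dots>\<bar> \<le> (\<integral>x. \<bar>(H x - H m) * kern m x\<bar> \<partial>L)" by (rule integral_abs_bound)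
  also have "\<dots> \<le> (\<integral>x. (\<Sum>s\<in>S. kern m x * \<bar>x s - m s\<bar>) \<partial>L)"
  proof (rule integral_mono)
    show "integrable L (\<lambda>x. \<bar>(H x - H m) * kern m x\<bar>)" using i1 by simp
    show "integrable L (\<lambda>x. \<Sum>s\<in>S. kern m x * \<bar>x s - m s\<bar>)" by (intro Bochner_Integration.integrable_sum kern_moment)
    fix x
    have "\<bar>H x - H m\<bar> * kern m x \<le> (\<Sum>s\<in>S. \<bar>x s - m s\<bar>) * kern m x"
      using H kern_nonneg by (intro mult_right_mono) (auto simp: bounded_lip_def)
    then show "\<bar>(H x - H m) * kern m x\<bar> \<le> (\<Sum>s\<in>S. kern m x * \<bar>x s - m s\<bar>)"
      by (simp add: abs_mult kern_nonneg sum_distrib_left mult_ac)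
  qed
  also have "\<dots> = (\<Sum>s\<in>S. \<integral>x. kern m x * \<bar>x s - m s\<bar> \<partial>L)" by (intro Bochner_Integration.integral_sum kern_moment)
  also have "\<dots> \<le> (\<Sum>s\<in>S. \<sigma>)" by (intro sum_mono kern_moment)
  finally show ?thesis by simp
qed

text \<open>The peak value of the kernel: it is the prefactor of the Fourier representation and also
  a uniform bound for the smoothed densities.\<close>

definition c :: real where "c = (1 / sqrt (2 * pi * \<sigma>\<^sup>2)) ^ card S"

lemma c_nonneg: "c \<ge> 0" by (simp add: c_def)

text \<open>Up to normalization a Gaussian kernel is the characteristic function of a standard
  Gaussian vector. Representing the smoothed density by a characteristic function is therefore a
  matter of exchanging integrals.\<close>

lemma kern_fourier:
  "complex_of_real (kern m x) = of_real c * (\<integral>z. iexp (\<Sum>s\<in>S. z s * ((m s - x s) / \<sigma>)) \<partial>\<nu>)"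
proof -
  interpret product_sigma_finite "\<lambda>_::'s. std_normal_distribution"
    by (simp add: product_sigma_finite_def prob_space_imp_sigma_finite prob_space_normal_density)
  interpret P: prob_space std_normal_distribution by (intro prob_space_normal_density) simp
  have 1: "(\<integral>u. iexp (u * t) \<partial>std_normal_distribution) = of_real (exp (- t\<^sup>2 / 2))" for t
    using fun_cong[OF char_std_normal_distribution, of t] by (simp add: char_def mult.commute)
  have "(\<integral>z. iexp (\<Sum>s\<in>S. z s * ((m s - x s) / \<sigma>)) \<partial>\<nu>) = (\<integral>z. (\<Prod>s\<in>S. iexp (z s * ((m s - x s) / \<sigma>))) \<partial>\<nu>)"
    by (simp only: of_real_sum sum_distrib_left exp_sum[OF finS])
  also have "\<dots> = (\<Prod>s\<in>S. \<integral>u. iexp (u * ((m s - x s) / \<sigma>)) \<partial>std_normal_distribution)"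
    by (rule product_integral_prod[OF finS, of "\<lambda>s u. iexp (u * ((m s - x s) / \<sigma>))"])
       (rule P.integrable_const_bound[where B=1]; simp)
  also have "\<dots> = (\<Prod>s\<in>S. complex_of_real (exp (- ((m s - x s) / \<sigma>)\<^sup>2 / 2)))"
    unfolding 1 ..
  finally have 2: "(\<integral>z. iexp (\<Sum>s\<in>S. z s * ((m s - x s) / \<sigma>)) \<partial>\<nu>) = of_real (\<Prod>s\<in>S. exp (- ((m s - x s) / \<sigma>)\<^sup>2 / 2))"
    by simp
  have "kern m x = c * (\<Prod>s\<in>S. exp (- ((m s - x s) / \<sigma>)\<^sup>2 / 2))"
    unfolding kern_def c_def normal_density_def prod.distrib
    by (simp add: power_divide power2_commute mult.commute)
  then show ?thesis unfolding 2 by simp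
qed

text \<open>The density of Z plus independent centred Gaussian noise of standard deviation \<sigma>
  in every coordinate of S.\<close>

definition dens :: "'q measure \<Rightarrow> ('s \<Rightarrow> 'q \<Rightarrow> real) \<Rightarrow> ('s \<Rightarrow> real) \<Rightarrow> real" where
  "dens Q Z x = (\<integral>\<omega>. kern (\<lambda>s. Z s \<omega>) x \<partial>Q)"

definition charf :: "'q measure \<Rightarrow> ('s \<Rightarrow> 'q \<Rightarrow> real) \<Rightarrow> ('s \<Rightarrow> real) \<Rightarrow> complex" where
  "charf Q Z t = (\<integral>\<omega>. iexp (\<Sum>s\<in>S. t s * Z s \<omega>) \<partial>Q)"

lemma measurable_charf:
  assumes "prob_space Q" and Z [measurable]: "\<And>s. s \<in> S \<Longrightarrow> Z s \<in> borel_measurable Q"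
  shows "(\<lambda>z. charf Q Z (\<lambda>s. z s / \<sigma>)) \<in> borel_measurable \<nu>"
proof -
  interpret Q: prob_space Q by fact
  have [measurable]: "(\<lambda>z. z s) \<in> borel_measurable \<nu>" if "s \<in> S" for s
    using measurable_component_singleton[OF that, of "\<lambda>_. std_normal_distribution"] by simp
  show ?thesis unfolding charf_def by measurable
qed

lemma cmod_charf_le:
  assumes "prob_space Q"
  shows "cmod (charf Q Z t) \<le> 1"
proof -
  interpret Q: prob_space Q by fact
  have "cmod (charf Q Z t) \<le> (\<integral>\<omega>. cmod (iexp (\<Sum>s\<in>S. t s * Z s \<omega>)) \<partial>Q)" unfolding charf_def by (rule integral_norm_bound)
  then show ?thesis by (simp add: Q.prob_space)
qed

lemma dens_fourier:
  assumes "prob_space Q" and Z [measurable]: "\<And>s. s \<in> S \<Longrightarrow> Z s \<in> borel_measurable Q"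
  shows "complex_of_real (dens Q Z x) = of_real c * (\<integral>z. iexp (- (\<Sum>s\<in>S. z s * (x s / \<sigma>))) * charf Q Z (\<lambda>s. z s / \<sigma>) \<partial>\<nu>)"
proof -
  interpret Q: prob_space Q by fact
  interpret N: prob_space \<nu> by (rule prob_\<nu>)
  interpret P: pair_sigma_finite Q \<nu> ..
  interpret PP: pair_prob_space Q \<nu> ..
  have zm [measurable]: "(\<lambda>z. z s) \<in> borel_measurable \<nu>" if "s \<in> S" for s
    using measurable_component_singleton[OF that, of "\<lambda>_. std_normal_distribution"] by simp
  have "complex_of_real (dens Q Z x) = (\<integral>\<omega>. complex_of_real (kern (\<lambda>s. Z s \<omega>) x) \<partial>Q)"
    unfolding dens_def by simp
  also have "\<dots> = of_real c * (\<integral>\<omega>. (\<integral>z. iexp (\<Sum>s\<in>S. z s * ((Z s \<omega> - x s) / \<sigma>)) \<partial>\<nu>) \<partial>Q)"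
    unfolding kern_fourier by simp
  also have "(\<integral>\<omega>. (\<integral>z. iexp (\<Sum>s\<in>S. z s * ((Z s \<omega> - x s) / \<sigma>)) \<partial>\<nu>) \<partial>Q) = (\<integral>z. (\<integral>\<omega>. iexp (\<Sum>s\<in>S. z s * ((Z s \<omega> - x s) / \<sigma>)) \<partial>Q) \<partial>\<nu>)"
  proof (rule P.Fubini_integral[symmetric], rule PP.integrable_const_bound[where B=1])
    show "AE p in Q \<Otimes>\<^sub>M \<nu>. cmod (case p of (\<omega>, z) \<Rightarrow> iexp (\<Sum>s\<in>S. z s * ((Z s \<omega> - x s) / \<sigma>))) \<le> 1"
      by (rule AE_I2) (simp only: case_prod_beta norm_exp_i_times order_refl)
    show "(\<lambda>(\<omega>, z). iexp (\<Sum>s\<in>S. z s * ((Z s \<omega> - x s) / \<sigma>))) \<in> borel_measurable (Q \<Otimes>\<^sub>M \<nu>)"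
      by measurable
  qed
  also have "\<dots> = (\<integral>z. iexp (- (\<Sum>s\<in>S. z s * (x s / \<sigma>))) * charf Q Z (\<lambda>s. z s / \<sigma>) \<partial>\<nu>)"
  proof (rule Bochner_Integration.integral_cong[OF refl])
    fix z :: "'s \<Rightarrow> real"
    have "iexp (\<Sum>s\<in>S. z s * ((Z s \<omega> - x s) / \<sigma>)) = iexp (- (\<Sum>s\<in>S. z s * (x s / \<sigma>))) * iexp (\<Sum>s\<in>S. z s / \<sigma> * Z s \<omega>)" for \<omega>
      unfolding exp_add[symmetric]
      by (simp add: diff_divide_distrib right_diff_distrib sum_subtractf algebra_simps)
    then show "(\<integral>\<omega>. iexp (\<Sum>s\<in>S. z s * ((Z s \<omega> - x s) / \<sigma>)) \<partial>Q) = iexp (- (\<Sum>s\<in>S. z s * (x s / \<sigma>))) * charf Q Z (\<lambda>s. z s / \<sigma>)"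
      unfolding charf_def by simp
  qed
  finally show ?thesis .
qed

text \<open>The frequencies are integrated against the probability measure \<open>\<nu>\<close>, not
  against Lebesgue measure. The integrand is at most 2, so pointwise convergence of characteristic
  functions makes the bound tend to zero, uniformly in x.\<close>

lemma dens_diff_le:
  assumes Q: "prob_space Q" and Z [measurable]: "\<And>s. s \<in> S \<Longrightarrow> Z s \<in> borel_measurable Q"
    and Q': "prob_space Q'" and Z' [measurable]: "\<And>s. s \<in> S \<Longrightarrow> Z' s \<in> borel_measurable Q'"
  shows "\<bar>dens Q Z x - dens Q' Z' x\<bar> \<le> c * (\<integral>z. cmod (charf Q Z (\<lambda>s. z s / \<sigma>) - charf Q' Z' (\<lambda>s. z s / \<sigma>)) \<partial>\<nu>)"
proof -
  interpret N: prob_space \<nu> by (rule prob_\<nu>)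
  have zm [measurable]: "(\<lambda>z. z s) \<in> borel_measurable \<nu>" if "s \<in> S" for s
    using measurable_component_singleton[OF that, of "\<lambda>_. std_normal_distribution"] by simp
  note [measurable] = measurable_charf[OF Q Z] measurable_charf[OF Q' Z']
  let ?e = "\<lambda>z. iexp (- (\<Sum>s\<in>S. z s * (x s / \<sigma>)))"
  have i: "integrable \<nu> (\<lambda>z. ?e z * charf Q Z (\<lambda>s. z s / \<sigma>))" "integrable \<nu> (\<lambda>z. ?e z * charf Q' Z' (\<lambda>s. z s / \<sigma>))"
    by (rule N.integrable_const_bound[where B=1]; simp add: norm_mult cmod_charf_le Q Q')+
  have "complex_of_real (dens Q Z x - dens Q' Z' x) = of_real c * (\<integral>z. ?e z * (charf Q Z (\<lambda>s. z s / \<sigma>) - charf Q' Z' (\<lambda>s. z s / \<sigma>)) \<partial>\<nu>)"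
    using i by (simp add: dens_fourier[OF Q Z] dens_fourier[OF Q' Z'] right_diff_distrib)
  then have "cmod (complex_of_real (dens Q Z x - dens Q' Z' x)) = c * cmod (\<integral>z. ?e z * (charf Q Z (\<lambda>s. z s / \<sigma>) - charf Q' Z' (\<lambda>s. z s / \<sigma>)) \<partial>\<nu>)"
    by (simp only: norm_mult norm_of_real abs_of_nonneg c_nonneg)
  also have "\<dots> \<le> c * (\<integral>z. cmod (?e z * (charf Q Z (\<lambda>s. z s / \<sigma>) - charf Q' Z' (\<lambda>s. z s / \<sigma>))) \<partial>\<nu>)"
    by (intro mult_left_mono integral_norm_bound c_nonneg)
  finally show ?thesis by (simp only: norm_mult norm_of_real norm_exp_i_times mult_1)
qed

lemma measurable_kern_pair:
  assumes Z [measurable]: "\<And>s. s \<in> S \<Longrightarrow> Z s \<in> borel_measurable Q"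
  shows "(\<lambda>(\<omega>, x). kern (\<lambda>s. Z s \<omega>) x) \<in> borel_measurable (Q \<Otimes>\<^sub>M L)"
  unfolding kern_def normal_density_def by measurable

lemma dens_props:
  assumes Q: "prob_space Q" and Z [measurable]: "\<And>s. s \<in> S \<Longrightarrow> Z s \<in> borel_measurable Q"
  shows "dens Q Z x \<ge> 0" "integrable L (dens Q Z)" "(\<integral>x. dens Q Z x \<partial>L) = 1"
    and "bounded_lip H \<Longrightarrow> integrable L (\<lambda>x. H x * dens Q Z x)"
    and "bounded_lip H \<Longrightarrow> \<bar>(\<integral>\<omega>. H (\<lambda>s. Z s \<omega>) \<partial>Q) - (\<integral>x. H x * dens Q Z x \<partial>L)\<bar> \<le> real (card S) * \<sigma>"
proof -
  interpret Q: prob_space Q by fact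
  interpret L: sigma_finite_measure L by (rule L_sigma_finite)
  interpret P: pair_sigma_finite Q L ..
  note [measurable] = measurable_kern_pair[OF Z]
  have pos: "dens Q Z x \<ge> 0" for x unfolding dens_def by (intro Bochner_Integration.integral_nonneg kern_nonneg)
  then show "dens Q Z x \<ge> 0" .
  \<comment> \<open>The constant 1 as a test function yields the integrability and the total mass of
    the density from the general statements about H.\<close>
  have k1: "bounded_lip (\<lambda>_. 1)" by (simp add: bounded_lip_def sum_nonneg)
  have intP: "integrable (Q \<Otimes>\<^sub>M L) (\<lambda>(\<omega>, x). H x * kern (\<lambda>s. Z s \<omega>) x)" if H: "bounded_lip H" for H
  proof (rule P.Fubini_integrable)
    have [measurable]: "H \<in> borel_measurable L" by (rule bounded_lip_measurable_L[OF H])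
    show m: "(\<lambda>(\<omega>, x). H x * kern (\<lambda>s. Z s \<omega>) x) \<in> borel_measurable (Q \<Otimes>\<^sub>M L)" by measurable
    have "integrable L (\<lambda>x. norm (H x * kern (\<lambda>s. Z s \<omega>) x))" for \<omega> using bounded_lip_kern_integrable[OF H] by simp
    then have b: "(\<integral>x. norm (H x * kern (\<lambda>s. Z s \<omega>) x) \<partial>L) \<le> 1" for \<omega>
    proof -
      have "(\<integral>x. norm (H x * kern (\<lambda>s. Z s \<omega>) x) \<partial>L) \<le> (\<integral>x. kern (\<lambda>s. Z s \<omega>) x \<partial>L)"
        using H kern_nonneg[of "\<lambda>s. Z s \<omega>"]
        by (intro integral_mono kern_integral \<open>integrable L (\<lambda>x. norm (H x * kern (\<lambda>s. Z s \<omega>) x))\<close>)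
           (auto simp: bounded_lip_def abs_mult intro!: mult_left_le_one_le)
      then show ?thesis by (simp add: kern_integral)
    qed
    show "integrable Q (\<lambda>\<omega>. \<integral>x. norm (case (\<omega>, x) of (\<omega>, x) \<Rightarrow> H x * kern (\<lambda>s. Z s \<omega>) x) \<partial>L)"
      by (rule Q.integrable_const_bound[where B=1]) (use b in auto)
    show "AE \<omega> in Q. integrable L (\<lambda>x. case (\<omega>, x) of (\<omega>, x) \<Rightarrow> H x * kern (\<lambda>s. Z s \<omega>) x)"
      using bounded_lip_kern_integrable[OF H] by simp
  qed
  have Hd: "H x * dens Q Z x = (\<integral>\<omega>. H x * kern (\<lambda>s. Z s \<omega>) x \<partial>Q)" for H x
    unfolding dens_def by simp
  show intH: "integrable L (\<lambda>x. H x * dens Q Z x)" if "bounded_lip H" for H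
    unfolding Hd using P.integrable_snd[OF intP[OF that]] by simp
  show "integrable L (dens Q Z)" using intH[OF k1] by simp
  have Fub: "(\<integral>x. H x * dens Q Z x \<partial>L) = (\<integral>\<omega>. (\<integral>x. H x * kern (\<lambda>s. Z s \<omega>) x \<partial>L) \<partial>Q)" if "bounded_lip H" for H
    unfolding Hd by (rule P.Fubini_integral[OF intP[OF that]])
  show "(\<integral>x. dens Q Z x \<partial>L) = 1" using Fub[OF k1] by (simp add: kern_integral Q.prob_space)
  show "\<bar>(\<integral>\<omega>. H (\<lambda>s. Z s \<omega>) \<partial>Q) - (\<integral>x. H x * dens Q Z x \<partial>L)\<bar> \<le> real (card S) * \<sigma>" if H: "bounded_lip H" for H
  proof -
    have Hm: "(\<lambda>\<omega>. H (\<lambda>s. Z s \<omega>)) \<in> borel_measurable Q"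
    proof -
      have "(\<lambda>\<omega>. H (\<lambda>s\<in>S. Z s \<omega>)) \<in> borel_measurable Q"
        by (rule measurable_compose[OF _ bounded_lip_measurable[OF H]]) (intro measurable_restrict Z)
      moreover have "H (\<lambda>s\<in>S. Z s \<omega>) = H (\<lambda>s. Z s \<omega>)" for \<omega> by (rule bounded_lip_cong[OF H]) simp
      ultimately show ?thesis by simp
    qed
    have i1: "integrable Q (\<lambda>\<omega>. H (\<lambda>s. Z s \<omega>))"
      by (rule Q.integrable_const_bound[where B=1]) (use H Hm in \<open>auto simp: bounded_lip_def\<close>)
    have i2: "integrable Q (\<lambda>\<omega>. \<integral>x. H x * kern (\<lambda>s. Z s \<omega>) x \<partial>L)" using P.integrable_fst[OF intP[OF H]] by simp
    have "(\<integral>\<omega>. H (\<lambda>s. Z s \<omega>) \<partial>Q) - (\<integral>x. H x * dens Q Z x \<partial>L) = (\<integral>\<omega>. H (\<lambda>s. Z s \<omega>) - (\<integral>x. H x * kern (\<lambda>s. Z s \<omega>) x \<partial>L) \<partial>Q)"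
      unfolding Fub[OF H] using i1 i2 by simp
    also have "\<bar>\<dots>\<bar> \<le> (\<integral>\<omega>. \<bar>H (\<lambda>s. Z s \<omega>) - (\<integral>x. H x * kern (\<lambda>s. Z s \<omega>) x \<partial>L)\<bar> \<partial>Q)" by (rule integral_abs_bound)
    also have "\<dots> \<le> (\<integral>\<omega>. real (card S) * \<sigma> \<partial>Q)"
      using bounded_lip_smooth[OF H] i1 i2 by (intro integral_mono) (auto simp: abs_minus_commute)
    finally show ?thesis by (simp add: Q.prob_space)
  qed
qed

text \<open>Both densities have mass 1, so the integral of |p - q| is twice the integral of the
  positive part of q - p. The two smoothing errors account for the other term.\<close>

lemma bounded_lip_compare:
  assumes Q: "prob_space Q" and Z: "\<And>s. s \<in> S \<Longrightarrow> Z s \<in> borel_measurable Q"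
    and Q': "prob_space Q'" and Z': "\<And>s. s \<in> S \<Longrightarrow> Z' s \<in> borel_measurable Q'" and H: "bounded_lip H"
  shows "\<bar>(\<integral>\<omega>. H (\<lambda>s. Z s \<omega>) \<partial>Q) - (\<integral>\<omega>. H (\<lambda>s. Z' s \<omega>) \<partial>Q')\<bar>
    \<le> 2 * real (card S) * \<sigma> + 2 * (\<integral>x. max 0 (dens Q' Z' x - dens Q Z x) \<partial>L)"
proof -
  let ?p = "dens Q Z" and ?q = "dens Q' Z'"
  have P: "\<And>x. ?p x \<ge> 0" "integrable L ?p" "(\<integral>x. ?p x \<partial>L) = 1" "integrable L (\<lambda>x. H x * ?p x)"
      "\<bar>(\<integral>\<omega>. H (\<lambda>s. Z s \<omega>) \<partial>Q) - (\<integral>x. H x * ?p x \<partial>L)\<bar> \<le> real (card S) * \<sigma>"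
    by (rule dens_props[OF Q Z]; (assumption | rule H))+
  have P': "\<And>x. ?q x \<ge> 0" "integrable L ?q" "(\<integral>x. ?q x \<partial>L) = 1" "integrable L (\<lambda>x. H x * ?q x)"
      "\<bar>(\<integral>\<omega>. H (\<lambda>s. Z' s \<omega>) \<partial>Q') - (\<integral>x. H x * ?q x \<partial>L)\<bar> \<le> real (card S) * \<sigma>"
    by (rule dens_props[OF Q' Z']; (assumption | rule H))+
  have im: "integrable L (\<lambda>x. max 0 (?q x - ?p x))" using P(2) P'(2) by auto
  have "(\<integral>x. H x * ?p x \<partial>L) - (\<integral>x. H x * ?q x \<partial>L) = (\<integral>x. H x * (?p x - ?q x) \<partial>L)"
    using P(4) P'(4) by (simp add: right_diff_distrib)
  also have "\<bar>\<dots>\<bar> \<le> (\<integral>x. \<bar>H x * (?p x - ?q x)\<bar> \<partial>L)" by (rule integral_abs_bound)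
  also have "\<dots> \<le> (\<integral>x. (?p x - ?q x) + 2 * max 0 (?q x - ?p x) \<partial>L)"
  proof (rule integral_mono)
    show "integrable L (\<lambda>x. \<bar>H x * (?p x - ?q x)\<bar>)" using P(4) P'(4) by (simp add: right_diff_distrib)
    show "integrable L (\<lambda>x. (?p x - ?q x) + 2 * max 0 (?q x - ?p x))" using P(2) P'(2) im by auto
    fix x
    have "\<bar>H x * (?p x - ?q x)\<bar> \<le> 1 * \<bar>?p x - ?q x\<bar>"
      unfolding abs_mult using H by (intro mult_right_mono) (auto simp: bounded_lip_def)
    also have "\<dots> = (?p x - ?q x) + 2 * max 0 (?q x - ?p x)" by (simp add: max_def)
    finally show "\<bar>H x * (?p x - ?q x)\<bar> \<le> (?p x - ?q x) + 2 * max 0 (?q x - ?p x)" .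
  qed
  also have "\<dots> = 2 * (\<integral>x. max 0 (?q x - ?p x) \<partial>L)"
    using P(2,3) P'(2,3) im by simp
  finally have 1: "\<bar>(\<integral>x. H x * ?p x \<partial>L) - (\<integral>x. H x * ?q x \<partial>L)\<bar> \<le> 2 * (\<integral>x. max 0 (?q x - ?p x) \<partial>L)" .
  show ?thesis using 1 P(5) P'(5) by linarith
qed

text \<open>Convergence of the random characteristic functions yields convergence of the smoothed laws in
  total variation; as in Scheffe's lemma only the positive part \<open>max 0 (q - p)\<close>,
  which is dominated by \<open>q\<close>, has to be controlled.\<close>

lemma smoothed_convergence:
  fixes M :: "'a measure" and A :: "nat \<Rightarrow> 'd set" and Z :: "nat \<Rightarrow> 'd \<Rightarrow> 's \<Rightarrow> 'a \<Rightarrow> real"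
  assumes M: "prob_space M" and A: "\<And>n. finite (A n)" "\<And>n. A n \<noteq> {}"
    and Z [measurable]: "\<And>n D s. s \<in> S \<Longrightarrow> Z n D s \<in> borel_measurable M"
    and Q: "prob_space Q" and G [measurable]: "\<And>s. s \<in> S \<Longrightarrow> G s \<in> borel_measurable Q"
    and conv: "\<And>t. (\<lambda>n. \<integral>\<omega>. cmod (avg (A n) (\<lambda>D. iexp (\<Sum>s\<in>S. t s * Z n D s \<omega>)) - charf Q G t) \<partial>M) \<longlonglongrightarrow> 0"
  defines "p \<equiv> \<lambda>n \<omega> x. avg (A n) (\<lambda>D. kern (\<lambda>s. Z n D s \<omega>) x)"
  shows "\<And>n. integrable M (\<lambda>\<omega>. \<integral>x. max 0 (dens Q G x - p n \<omega> x) \<partial>L)"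
    and "(\<lambda>n. \<integral>\<omega>. (\<integral>x. max 0 (dens Q G x - p n \<omega> x) \<partial>L) \<partial>M) \<longlonglongrightarrow> 0"
    and "\<And>n H \<omega>. bounded_lip H \<Longrightarrow> \<bar>avg (A n) (\<lambda>D. H (\<lambda>s. Z n D s \<omega>)) - (\<integral>\<omega>. H (\<lambda>s. G s \<omega>) \<partial>Q)\<bar>
      \<le> 2 * real (card S) * \<sigma> + 2 * (\<integral>x. max 0 (dens Q G x - p n \<omega> x) \<partial>L)"
proof -
  interpret M: prob_space M by fact
  interpret N: prob_space \<nu> by (rule prob_\<nu>)
  interpret L: sigma_finite_measure L by (rule L_sigma_finite)
  interpret P: pair_sigma_finite M L ..
  interpret PN: pair_sigma_finite M \<nu> ..
  interpret PPN: pair_prob_space M \<nu> ..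
  let ?q = "dens Q G"
  \<comment> \<open>At each fixed data point the average over draws is an integral over the uniform
    distribution, so the lemmas for general laws apply to the conditional law of the
    bootstrap.\<close>
  define U where "U n = measure_pmf (pmf_of_set (A n))" for n
  have U: "prob_space (U n)" "\<And>f. f \<in> borel_measurable (U n)" for n
    unfolding U_def by (auto simp: measure_pmf.prob_space_axioms)
  have Ui: "(\<integral>D. f D \<partial>U n) = avg (A n) f" for n and f :: "'d \<Rightarrow> 'z::{real_normed_field, banach, second_countable_topology}"
  proof -
    have "(\<integral>D. f D \<partial>U n) = (\<Sum>a\<in>A n. pmf (pmf_of_set (A n)) a *\<^sub>R f a)"
      unfolding U_def by (rule integral_measure_pmf[OF A(1)]) (use A in auto)
    also have "\<dots> = avg (A n) f" using A
      by (simp add: avg_def scaleR_conv_of_real sum_divide_distrib)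
    finally show ?thesis .
  qed
  have pd: "p n \<omega> x = dens (U n) (\<lambda>s D. Z n D s \<omega>) x" for n \<omega> x
    by (simp add: p_def dens_def Ui)
  have cd: "avg (A n) (\<lambda>D. iexp (\<Sum>s\<in>S. t s * Z n D s \<omega>)) = charf (U n) (\<lambda>s D. Z n D s \<omega>) t" for n \<omega> t
    by (simp add: charf_def Ui)
  have Gp: "\<And>x. ?q x \<ge> 0" "integrable L ?q" "(\<integral>x. ?q x \<partial>L) = 1"
    by (rule dens_props[OF Q G]; assumption)+
  note pp = dens_props[of "U n" "\<lambda>s D. Z n D s \<omega>" for n \<omega>, OF U(1) U(2), folded pd]
  show "\<bar>avg (A n) (\<lambda>D. H (\<lambda>s. Z n D s \<omega>)) - (\<integral>\<omega>. H (\<lambda>s. G s \<omega>) \<partial>Q)\<bar>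
      \<le> 2 * real (card S) * \<sigma> + 2 * (\<integral>x. max 0 (dens Q G x - p n \<omega> x) \<partial>L)" if "bounded_lip H" for n H \<omega>
    using bounded_lip_compare[of "U n" "\<lambda>s D. Z n D s \<omega>" Q G H, OF U(1) U(2) Q G that] by (simp add: Ui pd)
  have qm [measurable]: "?q \<in> borel_measurable L" using Gp(2) by auto
  have pm [measurable]: "(\<lambda>(\<omega>, x). p n \<omega> x) \<in> borel_measurable (M \<Otimes>\<^sub>M L)" for n
    unfolding p_def case_prod_beta'
    by (intro measurable_avg measurable_kern_pair[OF Z, unfolded case_prod_beta'])
  have mb: "\<bar>max 0 (?q x - p n \<omega> x)\<bar> \<le> ?q x" for n \<omega> x using Gp(1)[of x] pp(1)[of n \<omega> x] by simp
  have intL: "integrable L (\<lambda>x. max 0 (?q x - p n \<omega> x))" for n \<omega>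
    using Bochner_Integration.integrable_max[OF integrable_zero Bochner_Integration.integrable_diff[OF Gp(2) pp(2)[of n \<omega>]]]
    by (simp add: pd)
  have intP: "integrable (M \<Otimes>\<^sub>M L) (\<lambda>(\<omega>, x). max 0 (?q x - p n \<omega> x))" for n
  proof (rule P.Fubini_integrable)
    show "(\<lambda>(\<omega>, x). max 0 (?q x - p n \<omega> x)) \<in> borel_measurable (M \<Otimes>\<^sub>M L)" by measurable
    have "(\<integral>x. \<bar>max 0 (?q x - p n \<omega> x)\<bar> \<partial>L) \<le> (\<integral>x. ?q x \<partial>L)" for \<omega>
      using intL[of n \<omega>] Gp(2) mb by (intro integral_mono) auto
    then show "integrable M (\<lambda>\<omega>. \<integral>x. norm (case (\<omega>, x) of (\<omega>, x) \<Rightarrow> max 0 (?q x - p n \<omega> x)) \<partial>L)"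
      by (intro M.integrable_const_bound[where B=1]) (auto simp: Gp(3))
    show "AE \<omega> in M. integrable L (\<lambda>x. case (\<omega>, x) of (\<omega>, x) \<Rightarrow> max 0 (?q x - p n \<omega> x))" using intL by simp
  qed
  show "integrable M (\<lambda>\<omega>. \<integral>x. max 0 (?q x - p n \<omega> x) \<partial>L)" for n
    using P.integrable_fst[OF intP] by simp
  have intM: "integrable M (\<lambda>\<omega>. p n \<omega> x)" for n x
  proof -
    have [measurable]: "(\<lambda>\<omega>. p n \<omega> x) \<in> borel_measurable M"
      unfolding p_def kern_def normal_density_def by (intro measurable_avg) measurable
    have "normal_density a \<sigma> b \<le> 1 / sqrt (2 * pi * \<sigma>\<^sup>2)" for a b
      unfolding normal_density_def by (intro mult_left_le) auto
    then have "kern m x \<le> c" for m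
      unfolding kern_def c_def using prod_mono[of S "\<lambda>s. normal_density (m s) \<sigma> (x s)" "\<lambda>_. 1 / sqrt (2 * pi * \<sigma>\<^sup>2)"] by simp
    then have "p n \<omega> x \<le> c" for \<omega> unfolding p_def by (intro avg_le_bound A)
    then show ?thesis using pp(1) by (intro M.integrable_const_bound[where B=c]) auto
  qed
  \<comment> \<open>The outer dominated convergence in x has the fixed limit density as dominating
    function; the order of integration is exchanged back at the end.\<close>
  have "(\<lambda>n. \<integral>x. (\<integral>\<omega>. max 0 (?q x - p n \<omega> x) \<partial>M) \<partial>L) \<longlonglongrightarrow> (\<integral>x. 0 \<partial>L)"
  proof (rule integral_dominated_convergence[where w="?q"])
    show "(\<lambda>x. \<integral>\<omega>. max 0 (?q x - p n \<omega> x) \<partial>M) \<in> borel_measurable L" for n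
      using P.integrable_snd[OF intP, of n] by auto
    show "integrable L ?q" by (rule Gp)
    show "AE x in L. norm (\<integral>\<omega>. max 0 (?q x - p n \<omega> x) \<partial>M) \<le> ?q x" for n
    proof (rule AE_I2)
      fix x
      have "(\<integral>\<omega>. max 0 (?q x - p n \<omega> x) \<partial>M) \<le> (\<integral>\<omega>. ?q x \<partial>M)"
        using intM[of n x] mb[of x n] abs_le_D1 by (intro integral_mono) auto
      then show "norm (\<integral>\<omega>. max 0 (?q x - p n \<omega> x) \<partial>M) \<le> ?q x" by (simp add: M.prob_space)
    qed
    show "AE x in L. (\<lambda>n. \<integral>\<omega>. max 0 (?q x - p n \<omega> x) \<partial>M) \<longlonglongrightarrow> 0"
    proof (rule AE_I2)
      fix x
      let ?d = "\<lambda>n \<omega> z. cmod (charf (U n) (\<lambda>s D. Z n D s \<omega>) (\<lambda>s. z s / \<sigma>) - charf Q G (\<lambda>s. z s / \<sigma>))"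
      have zm [measurable]: "(\<lambda>z. z s) \<in> borel_measurable \<nu>" if "s \<in> S" for s
        using measurable_component_singleton[OF that, of "\<lambda>_. std_normal_distribution"] by simp
      note [measurable] = measurable_charf[OF Q G]
      have dm: "(\<lambda>(\<omega>, z). ?d n \<omega> z) \<in> borel_measurable (M \<Otimes>\<^sub>M \<nu>)" for n
        unfolding cd[symmetric] case_prod_beta'
        by (intro measurable_compose[OF _ borel_measurable_norm] borel_measurable_diff measurable_avg) measurable
      have db: "?d n \<omega> z \<le> 2" for n \<omega> z
        using norm_triangle_ineq4[of "charf (U n) (\<lambda>s D. Z n D s \<omega>) (\<lambda>s. z s / \<sigma>)" "charf Q G (\<lambda>s. z s / \<sigma>)"]
          cmod_charf_le[OF U(1)[of n], of "\<lambda>s D. Z n D s \<omega>" "\<lambda>s. z s / \<sigma>"] cmod_charf_le[OF Q, of G "\<lambda>s. z s / \<sigma>"] by linarith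
      have intd: "integrable (M \<Otimes>\<^sub>M \<nu>) (\<lambda>(\<omega>, z). ?d n \<omega> z)" for n
        by (rule PPN.integrable_const_bound[where B=2]) (use dm db in auto)
      have ub: "(\<integral>\<omega>. max 0 (?q x - p n \<omega> x) \<partial>M) \<le> c * (\<integral>z. (\<integral>\<omega>. ?d n \<omega> z \<partial>M) \<partial>\<nu>)" for n
      proof -
        have "(\<integral>\<omega>. max 0 (?q x - p n \<omega> x) \<partial>M) \<le> (\<integral>\<omega>. c * (\<integral>z. ?d n \<omega> z \<partial>\<nu>) \<partial>M)"
        proof (rule integral_mono)
          show "integrable M (\<lambda>\<omega>. max 0 (?q x - p n \<omega> x))" using intM[of n x] by auto
          show "integrable M (\<lambda>\<omega>. c * (\<integral>z. ?d n \<omega> z \<partial>\<nu>))" using PN.integrable_fst[OF intd] by simp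
          fix \<omega>
          have "max 0 (?q x - p n \<omega> x) \<le> \<bar>p n \<omega> x - ?q x\<bar>" by simp
          also have "\<dots> \<le> c * (\<integral>z. ?d n \<omega> z \<partial>\<nu>)" unfolding pd by (rule dens_diff_le[OF U(1) U(2) Q G])
          finally show "max 0 (?q x - p n \<omega> x) \<le> c * (\<integral>z. ?d n \<omega> z \<partial>\<nu>)" .
        qed
        also have "\<dots> = c * (\<integral>\<omega>. (\<integral>z. ?d n \<omega> z \<partial>\<nu>) \<partial>M)" by simp
        also have "(\<integral>\<omega>. (\<integral>z. ?d n \<omega> z \<partial>\<nu>) \<partial>M) = (\<integral>z. (\<integral>\<omega>. ?d n \<omega> z \<partial>M) \<partial>\<nu>)"
          by (rule PN.Fubini_integral[symmetric]) (use intd in auto)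
        finally show ?thesis .
      qed
      \<comment> \<open>The inner dominated convergence over the frequencies, with the constant 2:
        here the assumed mean convergence at each frequency is used.\<close>
      have "(\<lambda>n. \<integral>z. (\<integral>\<omega>. ?d n \<omega> z \<partial>M) \<partial>\<nu>) \<longlonglongrightarrow> (\<integral>z. 0 \<partial>\<nu>)"
      proof (rule integral_dominated_convergence[where w="\<lambda>_. 2"])
        show "(\<lambda>z. \<integral>\<omega>. ?d n \<omega> z \<partial>M) \<in> borel_measurable \<nu>" for n
          using PN.integrable_snd[OF intd, of n] by auto
        show "AE z in \<nu>. (\<lambda>n. \<integral>\<omega>. ?d n \<omega> z \<partial>M) \<longlonglongrightarrow> 0"
          using conv unfolding cd by simp
        show "AE z in \<nu>. norm (\<integral>\<omega>. ?d n \<omega> z \<partial>M) \<le> 2" for n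
        proof (rule AE_I2)
          fix z
          show "norm (\<integral>\<omega>. ?d n \<omega> z \<partial>M) \<le> 2"
          \<comment> \<open>If the section at z is not integrable, its integral is 0 by convention
            and the bound holds as well.\<close>
          proof (cases "integrable M (\<lambda>\<omega>. ?d n \<omega> z)")
            case True
            then have "(\<integral>\<omega>. ?d n \<omega> z \<partial>M) \<le> (\<integral>\<omega>. 2 \<partial>M)" using db by (intro integral_mono) auto
            then show ?thesis by (simp add: M.prob_space)
          qed (simp add: not_integrable_integral_eq)
        qed
      qed auto
      then have "(\<lambda>n. c * (\<integral>z. (\<integral>\<omega>. ?d n \<omega> z \<partial>M) \<partial>\<nu>)) \<longlonglongrightarrow> c * (\<integral>z. 0 \<partial>\<nu>)"
        by (rule tendsto_mult_left)
      then have lim: "(\<lambda>n. c * (\<integral>z. (\<integral>\<omega>. ?d n \<omega> z \<partial>M) \<partial>\<nu>)) \<longlonglongrightarrow> 0" by simp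
      show "(\<lambda>n. \<integral>\<omega>. max 0 (?q x - p n \<omega> x) \<partial>M) \<longlonglongrightarrow> 0"
      proof (rule tendsto_sandwich[OF _ _ tendsto_const lim])
        show "eventually (\<lambda>n. 0 \<le> (\<integral>\<omega>. max 0 (?q x - p n \<omega> x) \<partial>M)) sequentially"
          by (intro always_eventually allI Bochner_Integration.integral_nonneg) simp
        show "eventually (\<lambda>n. (\<integral>\<omega>. max 0 (?q x - p n \<omega> x) \<partial>M) \<le> c * (\<integral>z. (\<integral>\<omega>. ?d n \<omega> z \<partial>M) \<partial>\<nu>)) sequentially"
          by (intro always_eventually allI ub)
      qed
    qed
  qed auto
  moreover have "(\<integral>x. (\<integral>\<omega>. max 0 (?q x - p n \<omega> x) \<partial>M) \<partial>L) = (\<integral>\<omega>. (\<integral>x. max 0 (?q x - p n \<omega> x) \<partial>L) \<partial>M)" for n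
    by (rule P.Fubini_integral) (use intP in auto)
  ultimately show "(\<lambda>n. \<integral>\<omega>. (\<integral>x. max 0 (?q x - p n \<omega> x) \<partial>L) \<partial>M) \<longlonglongrightarrow> 0" by simp
qed

end

subsection \<open>Entropy nets and compact partitions\<close>

lemma wnorm_le_imp:
  assumes "wnorm \<beta> Ys f \<le> ereal e" "y \<in> Ys"
  shows "\<bar>f y\<bar> \<le> e * (1 + (norm y)\<^sup>2) powr (- \<beta> / 2)"
proof -
  have p: "1 + (norm y)\<^sup>2 > 0" by (simp add: add_pos_nonneg)
  have "ereal (\<bar>f y\<bar> * (1 + (norm y)\<^sup>2) powr (\<beta> / 2)) \<le> wnorm \<beta> Ys f"
    unfolding wnorm_def by (rule SUP_upper) fact
  also note assms(1)
  finally have "\<bar>f y\<bar> * (1 + (norm y)\<^sup>2) powr (\<beta> / 2) \<le> e" by simp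
  then have "(\<bar>f y\<bar> * (1 + (norm y)\<^sup>2) powr (\<beta> / 2)) * (1 + (norm y)\<^sup>2) powr (- \<beta> / 2) \<le> e * (1 + (norm y)\<^sup>2) powr (- \<beta> / 2)"
    by (rule mult_right_mono) simp
  moreover have "(1 + (norm y)\<^sup>2) powr (\<beta> / 2) * (1 + (norm y)\<^sup>2) powr (- \<beta> / 2) = 1"
    using p by (simp add: powr_add[symmetric])
  ultimately show ?thesis by (simp add: mult.assoc)
qed

lemma covnum_antimono:
  assumes "e \<le> e'"
  shows "covnum \<beta> Ys F e' \<le> covnum \<beta> Ys F e"
  unfolding covnum_def
proof (rule Inf_superset_mono, clarify)
  fix S assume S: "finite S" "S \<subseteq> F" "\<forall>f\<in>F. \<exists>s\<in>S. wnorm \<beta> Ys (\<lambda>y. f y - s y) \<le> ereal e"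
  have "x \<le> ereal e'" if "x \<le> ereal e" for x using that assms by (meson ereal_less_eq(3) order_trans)
  then have "\<forall>f\<in>F. \<exists>s\<in>S. wnorm \<beta> Ys (\<lambda>y. f y - s y) \<le> ereal e'" using S(3) by blast
  then show "\<exists>S'. enat (card S) = enat (card S') \<and> finite S' \<and> S' \<subseteq> F \<and> (\<forall>f\<in>F. \<exists>s\<in>S'. wnorm \<beta> Ys (\<lambda>y. f y - s y) \<le> ereal e')"
    using S by blast
qed

lemma covnum_attained:
  assumes "covnum \<beta> Ys F e \<noteq> \<infinity>"
  obtains T where "finite T" "T \<subseteq> F" "\<And>f. f \<in> F \<Longrightarrow> \<exists>s\<in>T. wnorm \<beta> Ys (\<lambda>y. f y - s y) \<le> ereal e"
    "covnum \<beta> Ys F e = enat (card T)"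
proof -
  let ?X = "{enat (card S) | S. finite S \<and> S \<subseteq> F \<and> (\<forall>f\<in>F. \<exists>s\<in>S. wnorm \<beta> Ys (\<lambda>y. f y - s y) \<le> ereal e)}"
  have "?X \<noteq> {}"
  proof
    assume "?X = {}"
    then have "covnum \<beta> Ys F e = Inf {}" unfolding covnum_def by (simp only:)
    then show False using assms by (simp add: Inf_enat_def)
  qed
  then obtain k where "k \<in> ?X" by (meson all_not_in_conv)
  then have "Inf ?X \<in> ?X" by (rule wellorder_InfI)
  then have "covnum \<beta> Ys F e \<in> ?X" unfolding covnum_def .
  then show ?thesis by (elim CollectE exE conjE) (rule that, blast+)
qed

lemma sqrtlog_mono:
  assumes "1 \<le> a" "a \<le> b"
  shows "sqrtlog a \<le> sqrtlog b"
proof (cases b)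
  case (enat m)
  then obtain n where n: "a = enat n" using assms by (cases a) auto
  with assms enat have "1 \<le> n" "n \<le> m" by (auto simp: one_enat_def)
  then show ?thesis by (simp add: sqrtlog_def enat n ennreal_leI ln_mono)
qed (simp add: sqrtlog_def)

text \<open>On the interval from 2^-(q+1) to 2^-q, of length 2^-(q+1), the antitone g is at least
  its value at the right end. The sum is thus the integral of a step function below g.\<close>

lemma sum_dyadic_le:
  fixes g :: "real \<Rightarrow> ennreal"
  assumes g: "\<And>e e'. 0 < e \<Longrightarrow> e \<le> e' \<Longrightarrow> g e' \<le> g e"
  shows "(\<Sum>q<Q. g ((1/2) ^ q) * ennreal ((1/2) ^ Suc q)) \<le> (\<integral>\<^sup>+e\<in>{0<..}. g e \<partial>lborel)"
proof -
  define I where "I q = {(1/2) ^ Suc q <.. (1/2) ^ q :: real}" for q :: nat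
  \<comment> \<open>The indicator on the right records that the first Q intervals leave the points
    up to 2^-Q untouched. This makes the induction go through one interval at a time.\<close>
  have pt: "(\<Sum>q<Q. g ((1/2) ^ q) * indicator (I q) e) \<le> g e * indicator {(1/2) ^ Q <..} e" for Q e
  proof (induction Q)
    case (Suc Q)
    show ?case
    proof (cases "e > (1/2) ^ Q")
      case True
      moreover have "(1/2::real) ^ Suc Q \<le> (1/2) ^ Q" by (rule power_decreasing) auto
      ultimately have "e > (1/2) ^ Suc Q" by linarith
      moreover have "e \<notin> I Q" using True by (auto simp: I_def)
      ultimately show ?thesis using Suc.IH True by simp
    next
      case False
      then have "(\<Sum>q<Q. g ((1/2) ^ q) * indicator (I q) e) = 0" using Suc.IH by (simp add: le_zero_eq)
      moreover have "g ((1/2) ^ Q) * indicator (I Q) e \<le> g e * indicator {(1/2) ^ Suc Q <..} e"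
      proof (cases "e \<in> I Q")
        case True
        then have "0 < e" "e \<le> (1/2) ^ Q" unfolding I_def by (auto intro: less_trans[rotated])
        then show ?thesis using g True by (auto simp: I_def)
      qed simp
      ultimately show ?thesis by simp
    qed
  qed simp
  have em: "emeasure lborel (I q) = ennreal ((1/2) ^ Suc q)" for q
    by (simp add: I_def field_simps)
  have "(\<Sum>q<Q. g ((1/2) ^ q) * ennreal ((1/2) ^ Suc q)) = (\<Sum>q<Q. \<integral>\<^sup>+e. g ((1/2) ^ q) * indicator (I q) e \<partial>lborel)"
    unfolding em[symmetric] by (intro sum.cong refl nn_integral_cmult_indicator[symmetric]) (simp add: I_def)
  also have "\<dots> = (\<integral>\<^sup>+e. (\<Sum>q<Q. g ((1/2) ^ q) * indicator (I q) e) \<partial>lborel)"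
    by (rule nn_integral_sum[symmetric]) (simp add: I_def)
  also have "\<dots> \<le> (\<integral>\<^sup>+e\<in>{0<..}. g e \<partial>lborel)"
  proof (rule nn_integral_mono)
    fix e :: real
    have "indicator {(1/2) ^ Q <..} e \<le> (indicator {0<..} e :: ennreal)"
      by (auto simp: indicator_def intro: less_trans[rotated])
    then show "(\<Sum>q<Q. g ((1/2) ^ q) * indicator (I q) e) \<le> g e * indicator {0<..} e"
      using pt[where Q=Q and e=e] by (meson mult_left_mono order_trans zero_le)
  qed
  finally show ?thesis .
qed

text \<open>Each f is sent to a centre of a minimal covering at radius K / 2^q. The net cardinality
  is then at most the covering number, and the dyadic lower sums of the entropy integral bound the
  series.\<close>

lemma entropy_nets:
  assumes F: "F \<noteq> {}" and K: "K \<ge> 0"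
    and ent: "(\<integral>\<^sup>+ \<epsilon>\<in>{0<..}. sqrtlog (covnum \<beta> Ys F (\<epsilon> * K)) \<partial>lborel) < \<infinity>"
  obtains net where "chain F net K"
    "\<And>q f y. f \<in> F \<Longrightarrow> y \<in> Ys \<Longrightarrow> \<bar>f y - net q f y\<bar> \<le> K / 2 ^ q * (1 + (norm y)\<^sup>2) powr (- \<beta> / 2)"
proof -
  define g where "g e = sqrtlog (covnum \<beta> Ys F (e * K))" for e
  define J where "J = (\<integral>\<^sup>+ e\<in>{0<..}. g e \<partial>lborel)"
  have J: "J < \<infinity>" using ent by (simp add: J_def g_def)
  have one: "1 \<le> covnum \<beta> Ys F e" for e
  proof (cases "covnum \<beta> Ys F e = \<infinity>")
    case False
    then obtain T where T: "finite T" "\<And>f. f \<in> F \<Longrightarrow> \<exists>s\<in>T. wnorm \<beta> Ys (\<lambda>y. f y - s y) \<le> ereal e"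
      "covnum \<beta> Ys F e = enat (card T)" by (rule covnum_attained) blast
    then have "T \<noteq> {}" using F by blast
    then show ?thesis using T by (simp add: one_enat_def Suc_le_eq card_gt_0_iff)
  qed simp
  have gm: "g e' \<le> g e" if "0 < e" "e \<le> e'" for e e'
    unfolding g_def by (rule sqrtlog_mono[OF one]) (use that K in \<open>auto intro!: covnum_antimono mult_right_mono\<close>)
  have part: "(\<Sum>q<Q. g ((1/2) ^ q) * ennreal ((1/2) ^ Suc q)) \<le> J" for Q
    unfolding J_def by (rule sum_dyadic_le) (rule gm)
  \<comment> \<open>A single infinite covering number would make a term of the dyadic sum, hence the
    entropy integral, infinite.\<close>
  have fin: "covnum \<beta> Ys F (K / 2 ^ q) \<noteq> \<infinity>" for q
  proof
    assume inf: "covnum \<beta> Ys F (K / 2 ^ q) = \<infinity>"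
    have "g ((1/2) ^ q) = \<infinity>" using inf by (simp add: g_def sqrtlog_def power_one_over field_simps)
    then have "g ((1/2) ^ q) * ennreal ((1/2) ^ Suc q) = \<infinity>" by (simp add: ennreal_top_mult)
    moreover have "g ((1/2) ^ q) * ennreal ((1/2) ^ Suc q) \<le> (\<Sum>q<Suc q. g ((1/2) ^ q) * ennreal ((1/2) ^ Suc q))"
      by (rule member_le_sum[where f="\<lambda>q. g ((1/2) ^ q) * ennreal ((1/2) ^ Suc q)"]) auto
    ultimately show False using part[of "Suc q"] J by (simp add: top_unique)
  qed
  have "\<exists>T. finite T \<and> T \<subseteq> F \<and> (\<forall>f\<in>F. \<exists>s\<in>T. wnorm \<beta> Ys (\<lambda>y. f y - s y) \<le> ereal (K / 2 ^ q)) \<and>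
     covnum \<beta> Ys F (K / 2 ^ q) = enat (card T)" for q
    by (rule covnum_attained[OF fin[of q]]) blast
  then obtain T where T: "\<And>q. finite (T q)" "\<And>q. T q \<subseteq> F"
    "\<And>q f. f \<in> F \<Longrightarrow> \<exists>s\<in>T q. wnorm \<beta> Ys (\<lambda>y. f y - s y) \<le> ereal (K / 2 ^ q)"
    "\<And>q. covnum \<beta> Ys F (K / 2 ^ q) = enat (card (T q))"
    by metis
  define net where "net q f = (SOME s. s \<in> T q \<and> wnorm \<beta> Ys (\<lambda>y. f y - s y) \<le> ereal (K / 2 ^ q))" for q f
  have net: "net q f \<in> T q \<and> wnorm \<beta> Ys (\<lambda>y. f y - net q f y) \<le> ereal (K / 2 ^ q)" if "f \<in> F" for q f
  proof -
    have "\<exists>s. s \<in> T q \<and> wnorm \<beta> Ys (\<lambda>y. f y - s y) \<le> ereal (K / 2 ^ q)" using T(3)[OF that, of q] by blast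
    from someI_ex[OF this] show ?thesis unfolding net_def .
  qed
  have sub: "net q ` F \<subseteq> T q" for q using net by auto
  have fin_net: "finite (net q ` F)" for q by (rule finite_subset[OF sub T(1)])
  have c1: "1 \<le> card (net q ` F)" for q using fin_net F by (simp add: Suc_le_eq card_gt_0_iff)
  \<comment> \<open>The factor 2 reconciles the interval lengths 2^-(q+1) with the weights 2^-q of
    the chaining series.\<close>
  have bound: "(\<Sum>q<Q. sqrt (ln (real (card (net q ` F)))) / 2 ^ q) \<le> 2 * enn2real J" for Q
  proof -
    have tm: "ennreal (sqrt (ln (real (card (net q ` F)))) / 2 ^ Suc q) \<le> g ((1/2) ^ q) * ennreal ((1/2) ^ Suc q)" for q
    proof -
      have "g ((1/2) ^ q) = ennreal (sqrt (ln (real (card (T q)))))"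
        using T(4)[of q] by (simp add: g_def sqrtlog_def power_one_over field_simps)
      moreover have "sqrt (ln (real (card (net q ` F)))) \<le> sqrt (ln (real (card (T q))))"
        using card_mono[OF T(1) sub, of q] c1[of q] by (intro real_sqrt_le_mono ln_mono) auto
      moreover have "0 \<le> ln (real (card (T q)))" using card_mono[OF T(1) sub, of q] c1[of q] by (intro ln_ge_zero) auto
      ultimately show ?thesis
        by (simp add: ennreal_mult'[symmetric] ennreal_leI power_one_over divide_right_mono)
    qed
    have "ennreal (\<Sum>q<Q. sqrt (ln (real (card (net q ` F)))) / 2 ^ Suc q) = (\<Sum>q<Q. ennreal (sqrt (ln (real (card (net q ` F)))) / 2 ^ Suc q))"
      by (rule sum_ennreal[symmetric]) (use c1 in \<open>auto intro!: divide_nonneg_nonneg ln_ge_zero\<close>)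
    also have "\<dots> \<le> J" by (rule order_trans[OF sum_mono part[of Q]]) (rule tm)
    also have "J = ennreal (enn2real J)" using J by simp
    finally have "(\<Sum>q<Q. sqrt (ln (real (card (net q ` F)))) / 2 ^ Suc q) \<le> enn2real J"
      by (subst (asm) ennreal_le_iff) auto
    then show ?thesis by (simp add: sum_distrib_left[symmetric] sum_divide_distrib[symmetric] mult.commute[of 2] flip: divide_divide_eq_left)
  qed
  have "chain F net K"
  proof
    show "summable (\<lambda>q. sqrt (ln (real (card (net q ` F)))) / 2 ^ q)"
      by (rule summableI_nonneg_bounded[OF _ bound]) (use c1 in \<open>auto intro!: divide_nonneg_nonneg ln_ge_zero\<close>)
    show "net q f \<in> F" if "f \<in> F" for q f using net[OF that, of q] T(2)[of q] by blast
  qed (use F K fin_net in auto)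
  moreover have "\<bar>f y - net q f y\<bar> \<le> K / 2 ^ q * (1 + (norm y)\<^sup>2) powr (- \<beta> / 2)" if "f \<in> F" "y \<in> Ys" for q f y
    using wnorm_le_imp[OF conjunct2[OF net[OF that(1), of q]] that(2)] by simp
  ultimately show ?thesis by (rule that)
qed

section \<open>The supremum distance, total boundedness and finite partitions of F\<close>

lemma supdist_ge:
  assumes "z \<in> linf F" "z' \<in> linf F" "f \<in> F"
  shows "\<bar>z f - z' f\<bar> \<le> supdist F z z'"
proof -
  obtain a b where a: "\<And>f. f \<in> F \<Longrightarrow> \<bar>z f\<bar> \<le> a" and b: "\<And>f. f \<in> F \<Longrightarrow> \<bar>z' f\<bar> \<le> b"
    using assms(1,2) unfolding linf_def bdd_above_def by auto
  have "bdd_above (insert 0 ((\<lambda>f. \<bar>z f - z' f\<bar>) ` F))"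
    unfolding bdd_above_insert
  proof (rule bdd_aboveI2[where M="a + b"])
    fix f assume "f \<in> F" then show "\<bar>z f - z' f\<bar> \<le> a + b" using a[of f] b[of f] by linarith
  qed
  then show ?thesis unfolding supdist_def using assms(3) by (intro cSup_upper) auto
qed

lemma supdist_le: "0 \<le> c \<Longrightarrow> (\<And>f. f \<in> F \<Longrightarrow> \<bar>z f - z' f\<bar> \<le> c) \<Longrightarrow> supdist F z z' \<le> c"
  unfolding supdist_def by (rule cSup_least) auto

text \<open>Both distances on the right end at z, which fits two terms of a subsequence close to a
  common limit.\<close>

lemma supdist_triangle:
  assumes "x \<in> linf F" "y \<in> linf F" "z \<in> linf F"
  shows "supdist F x y \<le> supdist F x z + supdist F y z"
proof (cases "F = {}")
  case False
  then obtain f where f: "f \<in> F" by auto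
  show ?thesis
  proof (rule supdist_le)
    show "0 \<le> supdist F x z + supdist F y z"
      using supdist_ge[OF assms(1,3) f] supdist_ge[OF assms(2,3) f] by linarith
    fix g assume g: "g \<in> F"
    show "\<bar>x g - y g\<bar> \<le> supdist F x z + supdist F y z"
      using supdist_ge[OF assms(1,3) g] supdist_ge[OF assms(2,3) g] by linarith
  qed
qed (simp add: supdist_def)

text \<open>Compactness is sequential here. If no finite set is e-dense, recursion produces an
  e-separated sequence in K, which contradicts the convergence of a subsequence.\<close>

lemma linf_compact_totally_bounded:
  assumes K: "linf_compact F K" and e: "e > 0"
  shows "\<exists>Z. finite Z \<and> Z \<subseteq> K \<and> (\<forall>z\<in>K. \<exists>z'\<in>Z. supdist F z z' < e)"
proof (rule ccontr)
  assume contr: "\<not> (\<exists>Z. finite Z \<and> Z \<subseteq> K \<and> (\<forall>z\<in>K. \<exists>z'\<in>Z. supdist F z z' < e))"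
  have no: "\<exists>z\<in>K. \<forall>z'\<in>Z. \<not> supdist F z z' < e" if "finite Z" "Z \<subseteq> K" for Z
  proof (rule ccontr)
    assume "\<not> (\<exists>z\<in>K. \<forall>z'\<in>Z. \<not> supdist F z z' < e)"
    then have "\<forall>z\<in>K. \<exists>z'\<in>Z. supdist F z z' < e" by auto
    then have "\<exists>Z. finite Z \<and> Z \<subseteq> K \<and> (\<forall>z\<in>K. \<exists>z'\<in>Z. supdist F z z' < e)"
      by (intro exI[of _ Z] conjI that)
    with contr show False by (rule notE)
  qed
  have "\<exists>s. \<forall>n::nat. s n \<in> K \<and> (\<forall>m<n. \<not> supdist F (s n) (s m) < e)"
  proof (rule dependent_wellorder_choice)
    fix n :: nat and s assume s: "\<And>m. m < n \<Longrightarrow> s m \<in> K \<and> (\<forall>k<m. \<not> supdist F (s m) (s k) < e)"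
    have "\<exists>z\<in>K. \<forall>z'\<in>s ` {..<n}. \<not> supdist F z z' < e" by (rule no) (use s in auto)
    then show "\<exists>r. r \<in> K \<and> (\<forall>m<n. \<not> supdist F r (s m) < e)" by auto
  qed auto
  then obtain s where s: "\<And>n::nat. s n \<in> K" "\<And>n m. m < n \<Longrightarrow> \<not> supdist F (s n) (s m) < e" by blast
  have KF: "K \<subseteq> linf F" using K by (simp add: linf_compact_def)
  obtain r z where r: "strict_mono (r :: nat \<Rightarrow> nat)" "z \<in> K" "(\<lambda>n. supdist F (s (r n)) z) \<longlonglongrightarrow> 0"
    using K s(1) unfolding linf_compact_def by blast
  then obtain n0 where n0: "\<And>n. n \<ge> n0 \<Longrightarrow> supdist F (s (r n)) z < e / 2"
    using order_tendstoD(2)[OF r(3), of "e/2"] e by (auto simp: eventually_sequentially)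
  have "supdist F (s (r (Suc n0))) (s (r n0)) \<le> supdist F (s (r (Suc n0))) z + supdist F (s (r n0)) z"
    by (rule supdist_triangle) (use s(1) r(2) KF in auto)
  also have "\<dots> < e" using n0[of n0] n0[of "Suc n0"] by simp
  finally show False using s(2)[of "r n0" "r (Suc n0)"] r(1) by (simp add: strict_mono_def)
qed

text \<open>Tightness of the limit replaces chaining for the Gaussian process: the finite partition is chosen
  to refine a given one and to be fine for the semimetric induced by a compact set of paths.\<close>

lemma compact_refining_partition:
  fixes net :: "('v \<Rightarrow> real) \<Rightarrow> 'n"
  assumes K: "linf_compact F K" and e: "e > 0" and fin: "finite (net ` F)"
  obtains \<pi> where "finite (\<pi> ` F)" "\<And>f. f \<in> F \<Longrightarrow> \<pi> f \<in> F" "\<And>f. f \<in> F \<Longrightarrow> net (\<pi> f) = net f"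
    "\<And>z f. z \<in> K \<Longrightarrow> f \<in> F \<Longrightarrow> \<bar>z f - z (\<pi> f)\<bar> \<le> e"
proof -
  have e3: "e / 3 > 0" using e by simp
  obtain Z where Z: "finite Z" "Z \<subseteq> K" "\<And>z. z \<in> K \<Longrightarrow> \<exists>z'\<in>Z. supdist F z z' < e / 3"
    using linf_compact_totally_bounded[OF K e3] by blast
  have KF: "K \<subseteq> linf F" using K by (simp add: linf_compact_def)
  \<comment> \<open>Functions with equal keys share their net point, and every path of the finite
    set Z takes values at them in the same grid cell of mesh e / 3. Approximating a path of K by one
    of Z at both functions costs another e / 3 each. Boundedness of paths makes the set of keys
    finite.\<close>
  define key where "key f = (net f, \<lambda>z\<in>Z. \<lfloor>z f / (e / 3)\<rfloor>)" for f
  have "finite ((\<lambda>f. \<lfloor>z f / (e / 3)\<rfloor>) ` F)" if "z \<in> Z" for z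
  proof -
    have "z \<in> linf F" using that Z(2) KF by blast
    then obtain a where a: "\<And>f. f \<in> F \<Longrightarrow> \<bar>z f\<bar> \<le> a"
      unfolding linf_def bdd_above_def by auto
    have "(\<lambda>f. \<lfloor>z f / (e / 3)\<rfloor>) ` F \<subseteq> {\<lfloor>- a / (e / 3)\<rfloor>..\<lfloor>a / (e / 3)\<rfloor>}"
    proof clarsimp
      fix f assume "f \<in> F"
      then have "- a \<le> z f" "z f \<le> a" using a[of f] by auto
      then have "- a / (e / 3) \<le> z f / (e / 3)" "z f / (e / 3) \<le> a / (e / 3)"
        using e3 by - (rule divide_right_mono, assumption, simp)+
      then have "\<lfloor>- a / (e / 3)\<rfloor> \<le> \<lfloor>z f / (e / 3)\<rfloor>" "\<lfloor>z f / (e / 3)\<rfloor> \<le> \<lfloor>a / (e / 3)\<rfloor>" by (auto intro: floor_mono)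
      then show "\<lfloor>- (a * 3 / e)\<rfloor> \<le> \<lfloor>z f * 3 / e\<rfloor> \<and> \<lfloor>z f * 3 / e\<rfloor> \<le> \<lfloor>a * 3 / e\<rfloor>" by simp
    qed
    then show ?thesis by (rule finite_subset) simp
  qed
  then have "finite (net ` F \<times> PiE Z (\<lambda>z. (\<lambda>f. \<lfloor>z f / (e / 3)\<rfloor>) ` F))"
    using Z(1) fin by (intro finite_cartesian_product finite_PiE)
  moreover have "key ` F \<subseteq> net ` F \<times> PiE Z (\<lambda>z. (\<lambda>f. \<lfloor>z f / (e / 3)\<rfloor>) ` F)"
    by (auto simp: key_def simp del: divide_divide_eq_right)
  ultimately have fk: "finite (key ` F)" by (rule finite_subset[rotated])
  \<comment> \<open>The chosen representative depends on f only through its key, so finitely many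
    keys give finitely many representatives.\<close>
  define \<pi> where "\<pi> f = (SOME g. g \<in> F \<and> key g = key f)" for f
  have \<pi>: "\<pi> f \<in> F \<and> key (\<pi> f) = key f" if "f \<in> F" for f
  proof -
    have "\<exists>g. g \<in> F \<and> key g = key f" using that by blast
    from someI_ex[OF this] show ?thesis unfolding \<pi>_def .
  qed
  have "\<pi> ` F = (\<lambda>k. SOME g. g \<in> F \<and> key g = k) ` (key ` F)" by (auto simp: \<pi>_def image_image)
  then have "finite (\<pi> ` F)" using fk by simp
  moreover have "\<bar>z f - z (\<pi> f)\<bar> \<le> e" if z: "z \<in> K" and f: "f \<in> F" for z f
  proof -
    obtain z' where z': "z' \<in> Z" "supdist F z z' < e / 3" using Z(3)[OF z] by blast
    have zz: "z \<in> linf F" "z' \<in> linf F" using z z' Z(2) KF by auto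
    have "snd (key (\<pi> f)) z' = snd (key f) z'" using \<pi>[OF f] by simp
    then have fl: "\<lfloor>z' (\<pi> f) / (e / 3)\<rfloor> = \<lfloor>z' f / (e / 3)\<rfloor>" using z' by (simp add: key_def del: divide_divide_eq_right)
    have "\<bar>z' f / (e / 3) - z' (\<pi> f) / (e / 3)\<bar> < 1"
      using fl floor_correct[of "z' f / (e / 3)"] floor_correct[of "z' (\<pi> f) / (e / 3)"] by linarith
    then have "\<bar>z' f - z' (\<pi> f)\<bar> < e / 3"
      using e by (simp only: diff_divide_distrib[symmetric] abs_divide) (simp add: divide_simps abs_if split: if_splits)
    moreover have "\<bar>z f - z' f\<bar> < e / 3" using supdist_ge[OF zz f] z'(2) by linarith
    moreover have "\<bar>z (\<pi> f) - z' (\<pi> f)\<bar> < e / 3" using supdist_ge[OF zz, of "\<pi> f"] \<pi>[OF f] z'(2) by auto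
    ultimately show ?thesis by linarith
  qed
  moreover have "net (\<pi> f) = net f" if "f \<in> F" for f using \<pi>[OF that] by (simp add: key_def)
  ultimately show ?thesis using \<pi> that by blast
qed

subsection \<open>Consistency of the bootstrap\<close>

lemma char_normal:
  assumes s: "s > 0"
  shows "(\<integral>x. iexp x \<partial>density lborel (normal_density 0 s)) = of_real (exp (- s\<^sup>2 / 2))"
proof -
  have "(\<integral>x. iexp x \<partial>density lborel (normal_density 0 s)) = (\<integral>x. normal_density 0 s x *\<^sub>R iexp x \<partial>lborel)"
    by (rule integral_density) auto
  also have "\<dots> = \<bar>s\<bar> *\<^sub>R (\<integral>u. normal_density 0 s (0 + s * u) *\<^sub>R iexp (0 + s * u) \<partial>lborel)"
    by (rule lborel_integral_real_affine) (use s in simp)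
  also have "\<dots> = (\<integral>u. \<bar>s\<bar> *\<^sub>R (normal_density 0 s (0 + s * u) *\<^sub>R iexp (0 + s * u)) \<partial>lborel)"
    by (simp only: scaleR_conv_of_real integral_mult_right_zero)
  also have "\<dots> = (\<integral>u. std_normal_density u *\<^sub>R iexp (s * u) \<partial>lborel)"
  proof (rule Bochner_Integration.integral_cong[OF refl])
    fix u
    have "\<bar>s\<bar> * normal_density 0 s (s * u) = std_normal_density u"
      using s by (simp add: normal_density_def real_sqrt_mult power_mult_distrib)
    then show "\<bar>s\<bar> *\<^sub>R (normal_density 0 s (0 + s * u) *\<^sub>R iexp (0 + s * u)) = std_normal_density u *\<^sub>R iexp (s * u)"
      by (simp only: scaleR_scaleR add_0)
  qed
  also have "\<dots> = (\<integral>u. iexp (s * u) \<partial>std_normal_distribution)"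
    by (rule integral_density[symmetric]) auto
  also have "\<dots> = of_real (exp (- s\<^sup>2 / 2))"
    using fun_cong[OF char_std_normal_distribution, of s] by (simp add: char_def)
  finally show ?thesis .
qed

lemma centered_normal_iexp:
  assumes P: "prob_space P" and X: "X \<in> borel_measurable P" and n: "centered_normal P X v"
  shows "(\<integral>\<omega>. iexp (X \<omega>) \<partial>P) = of_real (exp (- v / 2))"
proof -
  have v: "v \<ge> 0" using n by (simp add: centered_normal_def)
  have "(\<integral>\<omega>. iexp (X \<omega>) \<partial>P) = (\<integral>x. iexp x \<partial>distr P borel X)"
    by (rule integral_distr[symmetric]) (use X in auto)
  also have "\<dots> = of_real (exp (- v / 2))"
  proof (cases "v = 0")
    case True
    then have "(\<integral>x. iexp x \<partial>distr P borel X) = (\<integral>x. iexp x \<partial>return borel 0)"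
      using n by (simp add: centered_normal_def)
    also have "\<dots> = iexp 0" by (rule integral_return) auto
    finally show ?thesis using True by simp
  next
    case False
    then show ?thesis using n v char_normal[of "sqrt v"] by (simp add: centered_normal_def)
  qed
  finally show ?thesis .
qed

lemma boot_exp_avg: "boot_exp C N Y h \<omega> = avg (draws C) (\<lambda>D. h (Gstar C N Y D \<omega>))"
proof -
  have "boot_exp C N Y h \<omega> = (\<Sum>D\<in>draws C. pmf (pmf_of_set (draws C)) D *\<^sub>R h (Gstar C N Y D \<omega>))"
    unfolding boot_exp_def
    by (rule integral_measure_pmf[OF finite_draws]) (auto simp: set_pmf_of_set[OF draws_nonempty finite_draws])
  also have "\<dots> = avg (draws C) (\<lambda>D. h (Gstar C N Y D \<omega>))"
    using finite_draws[of C] draws_nonempty[of C] by (simp add: avg_def sum_divide_distrib)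
  finally show ?thesis .
qed

lemma abs_bcomponent_le: "\<bar>bcomponent C A D x\<bar> \<le> bscale C * (\<Sum>j\<in>obs_cells C. \<bar>\<Prod>i\<in>A. wdev C D i (j i)\<bar> * \<bar>x j\<bar>)"
proof -
  have "\<bar>bcomponent C A D x\<bar> = bscale C * \<bar>\<Sum>j\<in>obs_cells C. (\<Prod>i\<in>A. wdev C D i (j i)) * x j\<bar>"
    by (simp add: bcomponent_def abs_mult bscale_def)
  also have "\<dots> \<le> bscale C * (\<Sum>j\<in>obs_cells C. \<bar>(\<Prod>i\<in>A. wdev C D i (j i)) * x j\<bar>)"
    by (intro mult_left_mono sum_abs) (simp add: bscale_def)
  finally show ?thesis by (simp add: abs_mult)
qed

lemma abs_bstat_le: "\<bar>bstat C D x\<bar> \<le> bscale C * (\<Sum>j\<in>obs_cells C. \<bar>Wt C D j - 1\<bar> * \<bar>x j\<bar>)"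
proof -
  have "\<bar>bstat C D x\<bar> = bscale C * \<bar>\<Sum>j\<in>obs_cells C. (Wt C D j - 1) * x j\<bar>"
    by (simp add: bstat_def abs_mult bscale_def)
  also have "\<dots> \<le> bscale C * (\<Sum>j\<in>obs_cells C. \<bar>(Wt C D j - 1) * x j\<bar>)"
    by (intro mult_left_mono sum_abs) (simp add: bscale_def)
  finally show ?thesis by (simp add: abs_mult)
qed

section \<open>Function classes dominated by a weight with square-integrable cell sums\<close>

definition cell_fun :: "('v \<Rightarrow> real) \<Rightarrow> nat \<times> (nat \<Rightarrow> 'v) \<Rightarrow> real" where
  "cell_fun f = (\<lambda>(n, y). \<Sum>l=1..n. f (y l))"

lemma measurable_cell_fun:
  assumes [measurable]: "f \<in> borel_measurable borel"
  shows "cell_fun f \<in> borel_measurable (cellspace :: (nat \<times> (nat \<Rightarrow> 'v::topological_space)) measure)"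
  unfolding cellspace_def cell_fun_def
  by (rule measurable_pair_measure_countable1) (auto intro!: borel_measurable_sum)

lemma cell_fun_sum: "cell_fun (\<lambda>y. \<Sum>s\<in>S. t s * s y) x = (\<Sum>s\<in>S. t s * cell_fun s x)"
  unfolding cell_fun_def case_prod_beta sum_distrib_left by (rule sum.swap)

text \<open>\<rho> stands for the weight (1 + |y|^2)^(-\<beta>/2) and K for the weighted norm of the
  envelope. The cell sum of \<rho> is then a random Lipschitz constant of f \<mapsto>
  \<open>cellsum N Y f j\<close> with respect to the weighted sup norm, and R2 is its second moment
  condition.\<close>

locale bounded_class = dissociated_array M N Y
  for M :: "'a measure" and N :: "('k::finite \<Rightarrow> nat) \<Rightarrow> 'a \<Rightarrow> nat"
    and Y :: "nat \<Rightarrow> ('k \<Rightarrow> nat) \<Rightarrow> 'a \<Rightarrow> 'v::topological_space" +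
  fixes Ys :: "'v set" and F :: "('v \<Rightarrow> real) set" and \<rho> :: "'v \<Rightarrow> real" and K :: real
  assumes Y_in: "\<And>l j \<omega>. \<omega> \<in> space M \<Longrightarrow> Y l j \<omega> \<in> Ys"
    and F_meas: "\<And>f. f \<in> F \<Longrightarrow> f \<in> borel_measurable borel"
    and F_ne: "F \<noteq> {}" and K0: "K \<ge> 0"
    and env: "\<And>f y. f \<in> F \<Longrightarrow> y \<in> Ys \<Longrightarrow> \<bar>f y\<bar> \<le> K * \<rho> y"
    and \<rho>0: "\<And>y. \<rho> y \<ge> 0" and \<rho>m: "\<rho> \<in> borel_measurable borel"
    and R2: "integrable M (\<lambda>\<omega>. (cell_fun \<rho> (cell one_cell \<omega>))\<^sup>2)"
begin

definition R :: "('k \<Rightarrow> nat) \<Rightarrow> 'a \<Rightarrow> real" where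
  "R j \<omega> = cell_fun \<rho> (cell j \<omega>)"

lemma cellsum_eq: "cellsum N Y f j \<omega> = cell_fun f (cell j \<omega>)"
  by (simp add: cellsum_def cell_fun_def cell_def)

lemma R_nonneg: "R j \<omega> \<ge> 0"
  unfolding R_def cell_fun_def case_prod_beta by (intro sum_nonneg \<rho>0)

lemma cell_fun_meas: "f \<in> F \<Longrightarrow> cell_fun f \<in> borel_measurable cellspace"
  by (rule measurable_cell_fun) (rule F_meas)

lemma R_meas [measurable]: "R j \<in> borel_measurable M"
  unfolding R_def[abs_def] using measurable_cell_fun[OF \<rho>m] by measurable

lemma cellsum_le:
  assumes "\<omega> \<in> space M" "\<And>y. y \<in> Ys \<Longrightarrow> \<bar>f y\<bar> \<le> c * \<rho> y"
  shows "\<bar>cellsum N Y f j \<omega>\<bar> \<le> c * R j \<omega>"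
proof -
  have "\<bar>cellsum N Y f j \<omega>\<bar> \<le> (\<Sum>l=1..N j \<omega>. \<bar>f (Y l j \<omega>)\<bar>)" unfolding cellsum_def by (rule sum_abs)
  also have "\<dots> \<le> (\<Sum>l=1..N j \<omega>. c * \<rho> (Y l j \<omega>))" by (intro sum_mono assms Y_in)
  finally show ?thesis by (simp add: R_def cell_fun_def cell_def sum_distrib_left)
qed

lemma Gstar_linf:
  assumes "\<omega> \<in> space M"
  shows "Gstar C N Y D \<omega> \<in> linf F"
  unfolding linf_def mem_Collect_eq
proof (rule bdd_aboveI2)
  fix f assume f: "f \<in> F"
  have "\<bar>Gstar C N Y D \<omega> f\<bar> \<le> bscale C * (\<Sum>j\<in>obs_cells C. \<bar>Wt C D j - 1\<bar> * \<bar>cellsum N Y f j \<omega>\<bar>)"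
    unfolding Gstar_eq_bstat by (rule abs_bstat_le)
  also have "\<dots> \<le> bscale C * (\<Sum>j\<in>obs_cells C. \<bar>Wt C D j - 1\<bar> * (K * R j \<omega>))"
    by (intro mult_left_mono sum_mono cellsum_le[OF assms] env[OF f]) (auto simp: bscale_def)
  finally show "\<bar>Gstar C N Y D \<omega> f\<bar> \<le> bscale C * (\<Sum>j\<in>obs_cells C. \<bar>Wt C D j - 1\<bar> * (K * R j \<omega>))" .
qed

definition R_moment :: real where "R_moment = (\<integral>\<omega>. (R one_cell \<omega>)\<^sup>2 \<partial>M)"

lemma R_square:
  assumes "j \<in> Cells"
  shows "integrable M (\<lambda>\<omega>. (R j \<omega>)\<^sup>2)" "(\<integral>\<omega>. (R j \<omega>)\<^sup>2 \<partial>M) \<le> R_moment"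
proof -
  have [measurable]: "cell_fun \<rho> \<in> borel_measurable cellspace" by (rule measurable_cell_fun[OF \<rho>m])
  have m: "(\<lambda>x. (cell_fun \<rho> x)\<^sup>2) \<in> borel_measurable cellspace" by measurable
  show "integrable M (\<lambda>\<omega>. (R j \<omega>)\<^sup>2)" unfolding R_def by (rule integrable_cell[OF m assms R2])
  show "(\<integral>\<omega>. (R j \<omega>)\<^sup>2 \<partial>M) \<le> R_moment" unfolding R_moment_def R_def using integral_cell[OF m assms] by simp
qed

text \<open>For each component one coordinate of A is selected to be resampled in the chaining
  bound; every choice gives the same bound on the expectation. The result depends on the data
  only.\<close>

definition modulus_bound :: "('k \<Rightarrow> nat) \<Rightarrow> 'a \<Rightarrow> real" where
  "modulus_bound C \<omega> = (\<Sum>A\<in>UNIV - {{}::'k set}. sqrt (\<Sum>a\<in>{1..C (SOME i. i \<in> A)}. (slice_sum C (SOME i. i \<in> A) (\<lambda>j. R j \<omega>) a)\<^sup>2))"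

text \<open>The squared slice sums equal minC / C_i \<le> 1 times an average of products of two cell
  weights, and each such product has expectation at most the common second moment. The bound is
  therefore uniform in C.\<close>

lemma modulus_bound_integral:
  assumes C: "\<And>i. C i \<ge> 1"
  shows "integrable M (modulus_bound C)" "(\<integral>\<omega>. modulus_bound C \<omega> \<partial>M) \<le> real (card (UNIV - {{}::'k set})) * sqrt R_moment"
proof -
  have OC: "j \<in> Cells" if "j \<in> obs_cells C" for j using that by (auto simp: obs_cells_def Cells_def)
  let ?O = "obs_cells C"
  have q0: "R_moment \<ge> 0" by (simp add: R_moment_def)
  have one: "integrable M (\<lambda>\<omega>. sqrt (\<Sum>a\<in>{1..C i}. (slice_sum C i (\<lambda>j. R j \<omega>) a)\<^sup>2))"
    "(\<integral>\<omega>. sqrt (\<Sum>a\<in>{1..C i}. (slice_sum C i (\<lambda>j. R j \<omega>) a)\<^sup>2) \<partial>M) \<le> sqrt R_moment" for i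
  proof -
    have eq: "(\<Sum>a\<in>{1..C i}. (slice_sum C i (\<lambda>j. R j \<omega>) a)\<^sup>2) = real (minC C) / real (C i) * pair_avg C i (\<lambda>j. R j \<omega>)" for \<omega>
      by (rule slice_sum_square_sum[OF C])
    have lc: "l(i := j i) \<in> Cells" if "j \<in> ?O" "l \<in> ?O" for j l using that by (auto simp: obs_cells_def Cells_def)
    have iR: "integrable M (\<lambda>\<omega>. R j \<omega> * R l \<omega>)" if "j \<in> Cells" "l \<in> Cells" for j l
      using that by (intro integrable_mult_squares R_square R_meas)
    have ic: "integrable M (\<lambda>\<omega>. pair_avg C i (\<lambda>j. R j \<omega>))"
      unfolding pair_avg_def by (intro integrable_avg iR lc OC)
    have "(\<integral>\<omega>. pair_avg C i (\<lambda>j. R j \<omega>) \<partial>M) = avg ?O (\<lambda>j. \<integral>\<omega>. avg ?O (\<lambda>l. R j \<omega> * R (l(i := j i)) \<omega>) \<partial>M)"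
      unfolding pair_avg_def by (intro integral_avg integrable_avg iR lc OC)
    also have "\<dots> = avg ?O (\<lambda>j. avg ?O (\<lambda>l. \<integral>\<omega>. R j \<omega> * R (l(i := j i)) \<omega> \<partial>M))"
      by (intro avg_cong integral_avg iR lc OC)
    also have "\<dots> \<le> R_moment"
    proof (intro avg_le_bound finite_obs_cells obs_cells_nonempty C)
      fix j l assume o: "j \<in> ?O" "l \<in> ?O"
      have "(\<integral>\<omega>. R j \<omega> * R (l(i := j i)) \<omega> \<partial>M) \<le> (\<integral>\<omega>. \<bar>R j \<omega> * R (l(i := j i)) \<omega>\<bar> \<partial>M)"
        using iR[OF OC[OF o(1)] lc[OF o]] by (intro integral_mono) auto
      also have "\<dots> \<le> R_moment" by (intro integral_abs_mult_le R_square R_meas OC lc o)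
      finally show "(\<integral>\<omega>. R j \<omega> * R (l(i := j i)) \<omega> \<partial>M) \<le> R_moment" .
    qed
    finally have cq: "(\<integral>\<omega>. pair_avg C i (\<lambda>j. R j \<omega>) \<partial>M) \<le> R_moment" .
    have r: "real (minC C) / real (C i) \<le> 1" "0 \<le> real (minC C) / real (C i)"
      using minC_le[of C i] C[of i] by auto
    have i1: "integrable M (\<lambda>\<omega>. \<Sum>a\<in>{1..C i}. (slice_sum C i (\<lambda>j. R j \<omega>) a)\<^sup>2)" unfolding eq using ic by simp
    note sq = integral_sqrt_le[OF i1 sum_nonneg[OF zero_le_power2]]
    show "integrable M (\<lambda>\<omega>. sqrt (\<Sum>a\<in>{1..C i}. (slice_sum C i (\<lambda>j. R j \<omega>) a)\<^sup>2))" by (rule sq(1))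
    have "(\<integral>\<omega>. (\<Sum>a\<in>{1..C i}. (slice_sum C i (\<lambda>j. R j \<omega>) a)\<^sup>2) \<partial>M) = real (minC C) / real (C i) * (\<integral>\<omega>. pair_avg C i (\<lambda>j. R j \<omega>) \<partial>M)"
      unfolding eq by simp
    also have "\<dots> \<le> real (minC C) / real (C i) * R_moment" using cq r by (intro mult_left_mono) auto
    also have "\<dots> \<le> 1 * R_moment" using r q0 by (intro mult_right_mono) auto
    finally have "(\<integral>\<omega>. (\<Sum>a\<in>{1..C i}. (slice_sum C i (\<lambda>j. R j \<omega>) a)\<^sup>2) \<partial>M) \<le> R_moment" by simp
    then show "(\<integral>\<omega>. sqrt (\<Sum>a\<in>{1..C i}. (slice_sum C i (\<lambda>j. R j \<omega>) a)\<^sup>2) \<partial>M) \<le> sqrt R_moment"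
      using sq(2) real_sqrt_le_mono order_trans by blast
  qed
  show "integrable M (modulus_bound C)" unfolding modulus_bound_def[abs_def] by (intro Bochner_Integration.integrable_sum one)
  have "(\<integral>\<omega>. modulus_bound C \<omega> \<partial>M) = (\<Sum>A\<in>UNIV - {{}::'k set}. \<integral>\<omega>. sqrt (\<Sum>a\<in>{1..C (SOME i. i \<in> A)}. (slice_sum C (SOME i. i \<in> A) (\<lambda>j. R j \<omega>) a)\<^sup>2) \<partial>M)"
    unfolding modulus_bound_def by (intro Bochner_Integration.integral_sum one)
  also have "\<dots> \<le> (\<Sum>A\<in>UNIV - {{}::'k set}. sqrt R_moment)" by (intro sum_mono one)
  finally show "(\<integral>\<omega>. modulus_bound C \<omega> \<partial>M) \<le> real (card (UNIV - {{}::'k set})) * sqrt R_moment" by simp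
qed

text \<open>The components are chained separately and added. The second claim is recorded because a
  real supremum dominates its members only for a bounded family; the bound comes from the random
  Lipschitz constants and holds for every D.\<close>

lemma equicontinuity:
  assumes ch: "chain F net K" and C: "\<And>i. C i \<ge> 1" and \<omega>: "\<omega> \<in> space M"
    and net: "\<And>q f y. f \<in> F \<Longrightarrow> y \<in> Ys \<Longrightarrow> \<bar>f y - net q f y\<bar> \<le> K / 2 ^ q * \<rho> y"
  shows "avg (draws C) (\<lambda>D. sup_abs F (\<lambda>f. Gstar C N Y D \<omega> f - Gstar C N Y D \<omega> (net q0 f)))
    \<le> 2 * chain.tail F net K q0 * modulus_bound C \<omega>"
    and "\<And>D f. f \<in> F \<Longrightarrow> \<bar>Gstar C N Y D \<omega> f - Gstar C N Y D \<omega> (net q0 f)\<bar> \<le> sup_abs F (\<lambda>f. Gstar C N Y D \<omega> f - Gstar C N Y D \<omega> (net q0 f))"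
proof -
  interpret ch: chain F net K by (rule ch)
  let ?x = "\<lambda>f j. cellsum N Y f j \<omega>"
  let ?A = "UNIV - {{}::'k set}"
  have lip: "\<bar>?x f j - ?x (net q f) j\<bar> \<le> K / 2 ^ q * R j \<omega>" if f: "f \<in> F" for f j q
  proof -
    have "?x f j - ?x (net q f) j = cellsum N Y (\<lambda>y. f y - net q f y) j \<omega>"
      by (simp add: cellsum_def sum_subtractf)
    then show ?thesis using cellsum_le[OF \<omega>, of "\<lambda>y. f y - net q f y" "K / 2 ^ q" j] net[OF f] by simp
  qed
  define u where "u A D f = bcomponent C A D (?x f) - bcomponent C A D (?x (net q0 f))" for A D f
  define bd where "bd A D = bscale C * (\<Sum>j\<in>obs_cells C. \<bar>\<Prod>i\<in>A. wdev C D i (j i)\<bar> * (K / 2 ^ q0 * R j \<omega>))" for A D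
  have ubd: "\<bar>u A D f\<bar> \<le> bd A D" if f: "f \<in> F" for A D f
  proof -
    have "\<bar>u A D f\<bar> \<le> bscale C * (\<Sum>j\<in>obs_cells C. \<bar>\<Prod>i\<in>A. wdev C D i (j i)\<bar> * \<bar>?x f j - ?x (net q0 f) j\<bar>)"
      unfolding u_def bcomponent_diff[symmetric] by (rule abs_bcomponent_le)
    also have "\<dots> \<le> bd A D" unfolding bd_def
      by (intro mult_left_mono sum_mono lip[OF f]) (auto simp: bscale_def)
    finally show ?thesis .
  qed
  have G: "Gstar C N Y D \<omega> f - Gstar C N Y D \<omega> (net q0 f) = (\<Sum>A\<in>?A. u A D f)" for D f
    unfolding Gstar_eq_bstat bstat_expand u_def by (simp add: sum_subtractf)
  have Gbd: "\<bar>\<Sum>A\<in>?A. u A D f\<bar> \<le> (\<Sum>A\<in>?A. bd A D)" if "f \<in> F" for D f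
    by (rule order_trans[OF sum_abs]) (intro sum_mono ubd that)
  show "\<And>D f. f \<in> F \<Longrightarrow> \<bar>Gstar C N Y D \<omega> f - Gstar C N Y D \<omega> (net q0 f)\<bar> \<le> sup_abs F (\<lambda>f. Gstar C N Y D \<omega> f - Gstar C N Y D \<omega> (net q0 f))"
    unfolding G by (rule sup_abs_ge, assumption, rule Gbd)
  have s1: "sup_abs F (\<lambda>f. \<Sum>A\<in>?A. u A D f) \<le> (\<Sum>A\<in>?A. sup_abs F (u A D))" for D
  proof (rule sup_abs_le[OF F_ne])
    fix f assume f: "f \<in> F"
    have "\<bar>\<Sum>A\<in>?A. u A D f\<bar> \<le> (\<Sum>A\<in>?A. \<bar>u A D f\<bar>)" by (rule sum_abs)
    also have "\<dots> \<le> (\<Sum>A\<in>?A. sup_abs F (u A D))"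
      by (intro sum_mono sup_abs_ge[OF f ubd])
    finally show "\<bar>\<Sum>A\<in>?A. u A D f\<bar> \<le> (\<Sum>A\<in>?A. sup_abs F (u A D))" .
  qed
  have "avg (draws C) (\<lambda>D. sup_abs F (\<lambda>f. \<Sum>A\<in>?A. u A D f)) \<le> avg (draws C) (\<lambda>D. \<Sum>A\<in>?A. sup_abs F (u A D))"
    by (rule avg_mono) (rule s1)
  also have "\<dots> = (\<Sum>A\<in>?A. avg (draws C) (\<lambda>D. sup_abs F (u A D)))" by (rule avg_sum)
  also have "\<dots> \<le> (\<Sum>A\<in>?A. 2 * ch.tail q0 * sqrt (\<Sum>a\<in>{1..C (SOME i. i \<in> A)}. (slice_sum C (SOME i. i \<in> A) (\<lambda>j. R j \<omega>) a)\<^sup>2))"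
  proof (rule sum_mono)
    fix A :: "'k set" assume "A \<in> ?A"
    then have i: "(SOME i. i \<in> A) \<in> A" by (metis DiffD2 insertI1 some_in_eq)
    let ?i = "SOME i. i \<in> A"
    have "avg (draws C) (\<lambda>D. sup_abs F (u A D)) \<le> 2 * ch.tail q0 * (bscale C * sqrt (\<Sum>a\<in>{1..C ?i}. (\<Sum>j\<in>slice C ?i a. R j \<omega>)\<^sup>2))"
      unfolding u_def by (rule ch.bcomponent_chain[OF C i R_nonneg lip])
    also have "bscale C * sqrt (\<Sum>a\<in>{1..C ?i}. (\<Sum>j\<in>slice C ?i a. R j \<omega>)\<^sup>2) = sqrt (\<Sum>a\<in>{1..C ?i}. (slice_sum C ?i (\<lambda>j. R j \<omega>) a)\<^sup>2)"
    proof -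
      have "bscale C \<ge> 0" by (simp add: bscale_def)
      then show ?thesis by (simp add: slice_sum_def power_mult_distrib sum_distrib_left[symmetric] real_sqrt_mult)
    qed
    finally show "avg (draws C) (\<lambda>D. sup_abs F (u A D)) \<le> 2 * ch.tail q0 * sqrt (\<Sum>a\<in>{1..C ?i}. (slice_sum C ?i (\<lambda>j. R j \<omega>) a)\<^sup>2)" .
  qed
  finally show "avg (draws C) (\<lambda>D. sup_abs F (\<lambda>f. Gstar C N Y D \<omega> f - Gstar C N Y D \<omega> (net q0 f)))
    \<le> 2 * ch.tail q0 * modulus_bound C \<omega>"
    unfolding G modulus_bound_def sum_distrib_left .
qed

lemma cellsum_square:
  assumes f: "f \<in> F" and j: "j \<in> Cells"
  shows "integrable M (\<lambda>\<omega>. (cell_fun f (cell j \<omega>))\<^sup>2)" "(\<lambda>\<omega>. cell_fun f (cell j \<omega>)) \<in> borel_measurable M"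
proof -
  have [measurable]: "cell_fun f \<in> borel_measurable cellspace" by (rule cell_fun_meas[OF f])
  show "(\<lambda>\<omega>. cell_fun f (cell j \<omega>)) \<in> borel_measurable M" by measurable
  show "integrable M (\<lambda>\<omega>. (cell_fun f (cell j \<omega>))\<^sup>2)"
  proof (rule Bochner_Integration.integrable_bound[OF integrable_mult_right[OF R_square(1)[OF j], of "K\<^sup>2"]])
    show "AE \<omega> in M. norm ((cell_fun f (cell j \<omega>))\<^sup>2) \<le> norm (K\<^sup>2 * (R j \<omega>)\<^sup>2)"
    proof (rule AE_I2)
      fix \<omega> assume "\<omega> \<in> space M"
      then have "\<bar>cell_fun f (cell j \<omega>)\<bar> \<le> K * R j \<omega>"
        using cellsum_le[of \<omega> f K j] env[OF f] by (simp add: cellsum_eq)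
      from power_mono[OF this abs_ge_zero, of 2]
      show "norm ((cell_fun f (cell j \<omega>))\<^sup>2) \<le> norm (K\<^sup>2 * (R j \<omega>)\<^sup>2)" by (simp add: power_mult_distrib)
    qed
  qed measurable
qed

text \<open>Bilinearity of the covariance. Its integrals split because each member of F is dominated
  by K times the weight, whose cell sums are square integrable.\<close>

lemma Vlim_linear_combination:
  assumes S: "finite S" "S \<subseteq> F"
  shows "Vlim lam (cell_fun (\<lambda>y. \<Sum>s\<in>S. t s * s y)) = (\<Sum>f\<in>S. \<Sum>g\<in>S. t f * t g * Kcov M N Y lam f g)"
proof -
  have i1: "integrable M (\<lambda>\<omega>. cell_fun s (cell j \<omega>))" if "s \<in> S" "j \<in> Cells" for s j
    by (rule square_integral_le(1)[OF cellsum_square(1) cellsum_square(2)]) (use that S(2) in auto)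
  have i2: "integrable M (\<lambda>\<omega>. cell_fun s (cell j \<omega>) * cell_fun s' (cell j' \<omega>))" if "s \<in> S" "s' \<in> S" "j \<in> Cells" "j' \<in> Cells" for s s' j j'
    using that S(2) by (intro integrable_mult_squares cellsum_square) auto
  have cv: "cov M (\<lambda>\<omega>. cell_fun (\<lambda>y. \<Sum>s\<in>S. t s * s y) (cell one_cell \<omega>)) (\<lambda>\<omega>. cell_fun (\<lambda>y. \<Sum>s\<in>S. t s * s y) (cell (two_cell i) \<omega>))
    = (\<Sum>f\<in>S. \<Sum>g\<in>S. t f * t g * cov M (\<lambda>\<omega>. cell_fun f (cell one_cell \<omega>)) (\<lambda>\<omega>. cell_fun g (cell (two_cell i) \<omega>)))" for i
  proof -
    have "(\<integral>\<omega>. (\<Sum>s\<in>S. t s * cell_fun s (cell one_cell \<omega>)) * (\<Sum>s\<in>S. t s * cell_fun s (cell (two_cell i) \<omega>)) \<partial>M)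
      = (\<integral>\<omega>. (\<Sum>f\<in>S. \<Sum>g\<in>S. (t f * t g) * (cell_fun f (cell one_cell \<omega>) * cell_fun g (cell (two_cell i) \<omega>))) \<partial>M)"
      by (simp add: sum_product mult_ac)
    also have "\<dots> = (\<Sum>f\<in>S. \<Sum>g\<in>S. (t f * t g) * (\<integral>\<omega>. cell_fun f (cell one_cell \<omega>) * cell_fun g (cell (two_cell i) \<omega>) \<partial>M))"
      by (subst Bochner_Integration.integral_sum, intro Bochner_Integration.integrable_sum integrable_mult_right i2 special_cells, assumption+)
         (intro sum.cong refl, subst Bochner_Integration.integral_sum, intro integrable_mult_right i2 special_cells, assumption+, simp)
    finally have 1: "(\<integral>\<omega>. (\<Sum>s\<in>S. t s * cell_fun s (cell one_cell \<omega>)) * (\<Sum>s\<in>S. t s * cell_fun s (cell (two_cell i) \<omega>)) \<partial>M)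
       = (\<Sum>f\<in>S. \<Sum>g\<in>S. (t f * t g) * (\<integral>\<omega>. cell_fun f (cell one_cell \<omega>) * cell_fun g (cell (two_cell i) \<omega>) \<partial>M))" .
    have 2: "(\<integral>\<omega>. (\<Sum>s\<in>S. t s * cell_fun s (cell j \<omega>)) \<partial>M) = (\<Sum>s\<in>S. t s * (\<integral>\<omega>. cell_fun s (cell j \<omega>) \<partial>M))" if "j \<in> Cells" for j
      by (subst Bochner_Integration.integral_sum) (use i1 that in auto)
    show ?thesis unfolding cell_fun_sum cov_def 1 2[OF special_cells(1)] 2[OF special_cells(2)]
      by (simp add: right_diff_distrib sum_subtractf sum_product mult_ac)
  qed
  have "Vlim lam (cell_fun (\<lambda>y. \<Sum>s\<in>S. t s * s y))
    = (\<Sum>i\<in>UNIV. \<Sum>f\<in>S. \<Sum>g\<in>S. lam i * (t f * t g * cov M (\<lambda>\<omega>. cell_fun f (cell one_cell \<omega>)) (\<lambda>\<omega>. cell_fun g (cell (two_cell i) \<omega>))))"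
    unfolding Vlim_def cv sum_distrib_left ..
  also have "\<dots> = (\<Sum>f\<in>S. \<Sum>i\<in>UNIV. \<Sum>g\<in>S. lam i * (t f * t g * cov M (\<lambda>\<omega>. cell_fun f (cell one_cell \<omega>)) (\<lambda>\<omega>. cell_fun g (cell (two_cell i) \<omega>))))"
    by (rule sum.swap)
  also have "\<dots> = (\<Sum>f\<in>S. \<Sum>g\<in>S. \<Sum>i\<in>UNIV. lam i * (t f * t g * cov M (\<lambda>\<omega>. cell_fun f (cell one_cell \<omega>)) (\<lambda>\<omega>. cell_fun g (cell (two_cell i) \<omega>))))"
    by (intro sum.cong refl sum.swap)
  also have "\<dots> = (\<Sum>f\<in>S. \<Sum>g\<in>S. t f * t g * Kcov M N Y lam f g)"
    unfolding Kcov_def sum_distrib_left cellsum_eq[abs_def] by (simp add: mult_ac)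
  finally show ?thesis .
qed

text \<open>The Cramer-Wold device: the joint characteristic function at t is that of the single
  function y \<mapsto> \<Sum> t_s s(y), whose limit variance is the quadratic form prescribed for
  the Gaussian process.\<close>

lemma finite_dim_charf:
  assumes S: "finite S" "S \<subseteq> F"
    and C_lim: "filterlim (\<lambda>n. minC (Cs n)) at_top sequentially"
    and C_ratio: "\<And>i. (\<lambda>n. real (minC (Cs n)) / real (Cs n i)) \<longlonglongrightarrow> lam i"
    and G: "tight_gaussian P G F (Kcov M N Y lam)"
  shows "(\<lambda>n. \<integral>\<omega>. cmod (avg (draws (Cs n)) (\<lambda>D. iexp (\<Sum>s\<in>S. t s * Gstar (Cs n) N Y D \<omega> s))
     - (\<integral>\<omega>. iexp (\<Sum>s\<in>S. t s * G \<omega> s) \<partial>P)) \<partial>M) \<longlonglongrightarrow> 0"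
proof -
  let ?f = "\<lambda>y. \<Sum>s\<in>S. t s * s y"
  have fm: "?f \<in> borel_measurable borel" using F_meas S(2) by (intro borel_measurable_sum borel_measurable_times) auto
  have gi: "integrable M (\<lambda>\<omega>. (cell_fun ?f (cell one_cell \<omega>))\<^sup>2)"
  proof -
    have "(\<lambda>\<omega>. (cell_fun ?f (cell one_cell \<omega>))\<^sup>2) = (\<lambda>\<omega>. \<Sum>f\<in>S. \<Sum>g\<in>S. (t f * t g) * (cell_fun f (cell one_cell \<omega>) * cell_fun g (cell one_cell \<omega>)))"
      unfolding cell_fun_sum by (simp add: power2_eq_square sum_product mult_ac)
    moreover have "integrable M (\<lambda>\<omega>. cell_fun s (cell one_cell \<omega>) * cell_fun s' (cell one_cell \<omega>))" if "s \<in> S" "s' \<in> S" for s s'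
      using that S(2) by (intro integrable_mult_squares cellsum_square special_cells) auto
    ultimately show ?thesis by simp
  qed
  have P: "prob_space P" and Gm: "\<And>f. f \<in> F \<Longrightarrow> (\<lambda>\<omega>. G \<omega> f) \<in> borel_measurable P"
    and Gn: "centered_normal P (\<lambda>\<omega>. \<Sum>f\<in>S. t f * G \<omega> f) (\<Sum>f\<in>S. \<Sum>g\<in>S. t f * t g * Kcov M N Y lam f g)"
    using G S unfolding tight_gaussian_def by auto
  have "(\<lambda>\<omega>. \<Sum>s\<in>S. t s * G \<omega> s) \<in> borel_measurable P" using Gm S(2) by (intro borel_measurable_sum borel_measurable_times) auto
  from centered_normal_iexp[OF P this Gn]
  have 1: "(\<integral>\<omega>. iexp (\<Sum>s\<in>S. t s * G \<omega> s) \<partial>P) = of_real (exp (- Vlim lam (cell_fun ?f) / 2))"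
    unfolding Vlim_linear_combination[OF S] .
  have 2: "avg (draws C) (\<lambda>D. iexp (\<Sum>s\<in>S. t s * Gstar C N Y D \<omega> s)) = bchar C (cell_fun ?f) \<omega>" for C \<omega>
    unfolding bchar_def cell_fun_sum bstat_sum Gstar_eq_bstat cellsum_eq ..
  show ?thesis unfolding 1 2 by (rule bootstrap_clt(1)[OF measurable_cell_fun[OF fm] gi C_lim C_ratio])
qed

end

section \<open>Discretized functionals, outer probability and the Gaussian side\<close>

lemma linf_comp:
  assumes "finite (\<pi> ` F)"
  shows "(\<lambda>f. x (\<pi> f)) \<in> linf F"
proof -
  have "(\<lambda>f. \<bar>x (\<pi> f)\<bar>) ` F = (\<lambda>s. \<bar>x s\<bar>) ` (\<pi> ` F)" by (simp add: image_image)
  then show ?thesis using assms by (simp add: linf_def)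
qed

text \<open>The last two claims say that h after discretization is a bounded Lipschitz function of
  finitely many coordinates, ready for smoothing. The first keeps it in BL1, where measurability
  along the Gaussian process is part of \<open>tight_gaussian\<close>.\<close>

lemma BL1_comp:
  assumes h: "h \<in> BL1 F" and F: "F \<noteq> {}" and fin: "finite (\<pi> ` F)" and \<pi>: "\<And>f. f \<in> F \<Longrightarrow> \<pi> f \<in> F"
  shows "(\<lambda>z. h (\<lambda>f. z (\<pi> f))) \<in> BL1 F"
    and "\<And>x. \<bar>h (\<lambda>f. x (\<pi> f))\<bar> \<le> 1"
    and "\<And>x y. \<bar>h (\<lambda>f. x (\<pi> f)) - h (\<lambda>f. y (\<pi> f))\<bar> \<le> (\<Sum>s\<in>\<pi> ` F. \<bar>x s - y s\<bar>)"
proof -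
  note l = linf_comp[OF fin]
  have hb: "\<bar>h z\<bar> \<le> 1" if "z \<in> linf F" for z using h that by (simp add: BL1_def)
  have hl: "\<bar>h z - h z'\<bar> \<le> supdist F z z'" if "z \<in> linf F" "z' \<in> linf F" for z z' using h that by (simp add: BL1_def)
  show b: "\<bar>h (\<lambda>f. x (\<pi> f))\<bar> \<le> 1" for x by (rule hb[OF l])
  show "\<bar>h (\<lambda>f. x (\<pi> f)) - h (\<lambda>f. y (\<pi> f))\<bar> \<le> (\<Sum>s\<in>\<pi> ` F. \<bar>x s - y s\<bar>)" for x y
  proof (rule order_trans[OF hl[OF l l]], rule supdist_le)
    fix f assume "f \<in> F"
    then show "\<bar>x (\<pi> f) - y (\<pi> f)\<bar> \<le> (\<Sum>s\<in>\<pi> ` F. \<bar>x s - y s\<bar>)"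
      by (intro member_le_sum[where f="\<lambda>s. \<bar>x s - y s\<bar>"] fin) auto
  qed (simp add: sum_nonneg)
  have "\<bar>h (\<lambda>f. z (\<pi> f)) - h (\<lambda>f. z' (\<pi> f))\<bar> \<le> supdist F z z'" if z: "z \<in> linf F" "z' \<in> linf F" for z z'
  proof (rule order_trans[OF hl[OF l l]], rule supdist_le)
    obtain f where "f \<in> F" using F by auto
    from supdist_ge[OF z this] show "0 \<le> supdist F z z'" by linarith
    show "\<bar>z (\<pi> f) - z' (\<pi> f)\<bar> \<le> supdist F z z'" if "f \<in> F" for f
      by (rule supdist_ge[OF z \<pi>[OF that]])
  qed
  then show "(\<lambda>z. h (\<lambda>f. z (\<pi> f))) \<in> BL1 F" using b by (simp add: BL1_def)
qed

lemma outer_prob_le: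
  assumes "B \<in> sets M" "A \<subseteq> B"
  shows "outer_prob M A \<le> measure M B"
  unfolding outer_prob_def
  by (rule cINF_lower) (use assms in \<open>auto intro!: bdd_belowI2[where m=0]\<close>)

lemma outer_prob_nonneg: "A \<subseteq> space M \<Longrightarrow> outer_prob M A \<ge> 0"
  unfolding outer_prob_def by (rule cINF_greatest) auto

text \<open>On paths in K' the discretization moves the path by at most e; outside, an event of
  probability at most d, two values in [-1, 1] differ by at most 2.\<close>

lemma tight_partition_approx:
  assumes G: "tight_gaussian P G F K" and h: "h \<in> BL1 F" and F: "F \<noteq> {}" and e: "e \<ge> 0"
    and fin: "finite (\<pi> ` F)" and \<pi>: "\<And>f. f \<in> F \<Longrightarrow> \<pi> f \<in> F"
    and K': "{\<omega>\<in>space P. G \<omega> \<in> K'} \<in> sets P" "measure P {\<omega>\<in>space P. G \<omega> \<in> K'} \<ge> 1 - d"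
    and close: "\<And>z f. z \<in> K' \<Longrightarrow> f \<in> F \<Longrightarrow> \<bar>z f - z (\<pi> f)\<bar> \<le> e"
  shows "\<bar>(\<integral>\<omega>. h (\<lambda>f. G \<omega> (\<pi> f)) \<partial>P) - (\<integral>\<omega>. h (G \<omega>) \<partial>P)\<bar> \<le> e + 2 * d"
proof -
  interpret P: prob_space P using G by (simp add: tight_gaussian_def)
  let ?h = "\<lambda>\<omega>. h (G \<omega>)" and ?k = "\<lambda>\<omega>. h (\<lambda>f. G \<omega> (\<pi> f))" and ?B = "{\<omega>\<in>space P. G \<omega> \<in> K'}"
  have Gl: "G \<omega> \<in> linf F" if "\<omega> \<in> space P" for \<omega> using G that by (simp add: tight_gaussian_def)
  have m [measurable]: "?h \<in> borel_measurable P" "?k \<in> borel_measurable P"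
    using G h BL1_comp(1)[OF h F fin \<pi>] unfolding tight_gaussian_def by auto
  have hb: "\<bar>?h \<omega>\<bar> \<le> 1" if "\<omega> \<in> space P" for \<omega> using h Gl[OF that] by (simp add: BL1_def)
  have kb: "\<bar>?k \<omega>\<bar> \<le> 1" for \<omega> by (rule BL1_comp(2)[OF h F fin \<pi>])
  have ih: "integrable P ?h" by (rule P.integrable_const_bound[where B=1]) (use hb in auto)
  have ik: "integrable P ?k" by (rule P.integrable_const_bound[where B=1]) (use kb in auto)
  have iB: "integrable P (indicator (space P - ?B) :: _ \<Rightarrow> real)"
    by (rule P.integrable_const_bound[where B=1]) (use K'(1) in \<open>auto simp: indicator_def\<close>)
  have "(\<integral>\<omega>. ?k \<omega> \<partial>P) - (\<integral>\<omega>. ?h \<omega> \<partial>P) = (\<integral>\<omega>. ?k \<omega> - ?h \<omega> \<partial>P)" using ih ik by simp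
  also have "\<bar>\<dots>\<bar> \<le> (\<integral>\<omega>. \<bar>?k \<omega> - ?h \<omega>\<bar> \<partial>P)" by (rule integral_abs_bound)
  also have "\<dots> \<le> (\<integral>\<omega>. e + 2 * indicator (space P - ?B) \<omega> \<partial>P)"
  proof (rule integral_mono)
    show "integrable P (\<lambda>\<omega>. \<bar>?k \<omega> - ?h \<omega>\<bar>)" using ih ik by auto
    show "integrable P (\<lambda>\<omega>. e + 2 * indicator (space P - ?B) \<omega>)" using iB by auto
    fix \<omega> assume w: "\<omega> \<in> space P"
    show "\<bar>?k \<omega> - ?h \<omega>\<bar> \<le> e + 2 * indicator (space P - ?B) \<omega>"
    proof (cases "G \<omega> \<in> K'")
      case True
      have "\<bar>?k \<omega> - ?h \<omega>\<bar> \<le> supdist F (\<lambda>f. G \<omega> (\<pi> f)) (G \<omega>)"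
        using h linf_comp[OF fin, of "G \<omega>"] Gl[OF w] by (simp add: BL1_def)
      also have "\<dots> \<le> e" by (rule supdist_le[OF e]) (use close[OF True] in \<open>simp add: abs_minus_commute\<close>)
      finally show ?thesis by (simp add: add_increasing2)
    next
      case False
      then show ?thesis using hb[OF w] kb[of \<omega>] w e by simp
    qed
  qed
  also have "\<dots> = e + 2 * measure P (space P - ?B)" using iB K'(1) by (simp add: P.prob_space)
  also have "\<dots> \<le> e + 2 * d" using P.prob_compl[OF K'(1)] K'(2) by simp
  finally show ?thesis .
qed

context bounded_class
begin

text \<open>The tolerance e is spent in four quarters: bootstrap modulus, Gaussian smoothing,
  difference of the smoothed densities, and discretization of the limit. Only the first and third
  are random, and each is controlled by Markov's inequality.\<close>

lemma bootstrap_consistency: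
  fixes Cs :: "nat \<Rightarrow> 'k \<Rightarrow> nat"
  assumes ch: "chain F net K"
    and net: "\<And>q f y. f \<in> F \<Longrightarrow> y \<in> Ys \<Longrightarrow> \<bar>f y - net q f y\<bar> \<le> K / 2 ^ q * \<rho> y"
    and C_lim: "filterlim (\<lambda>n. minC (Cs n)) at_top sequentially"
    and C_ratio: "\<And>i. (\<lambda>n. real (minC (Cs n)) / real (Cs n i)) \<longlonglongrightarrow> lam i"
    and G: "tight_gaussian P G F (Kcov M N Y lam)" and e: "e > 0"
  shows "(\<lambda>n. outer_prob M {\<omega>\<in>space M. (SUP h\<in>BL1 F. \<bar>boot_exp (Cs n) N Y h \<omega> - (\<integral>\<omega>'. h (G \<omega>') \<partial>P)\<bar>) > e}) \<longlonglongrightarrow> 0"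
proof (rule tendstoI)
  fix \<delta> :: real assume \<delta>: "\<delta> > 0"
  interpret ch: chain F net K by (rule ch)
  define \<kappa> where "\<kappa> = real (card (UNIV - {{}::'k set})) * sqrt R_moment"
  \<comment> \<open>Markov's inequality at threshold e / 4. In 4 = 2 * 2 one factor comes from
    symmetrization, the other from comparing both f and its representative with their common net
    point; \<kappa> bounds the expected modulus for all sample sizes.\<close>
  have "(\<lambda>q. 4 * ch.tail q * \<kappa> / (e / 4)) \<longlonglongrightarrow> 4 * 0 * \<kappa> / (e / 4)"
    by (intro tendsto_intros ch.tail_tendsto) (use e in auto)
  then have "eventually (\<lambda>q. 4 * ch.tail q * \<kappa> / (e / 4) < \<delta> / 2) sequentially"
    using \<delta> by (intro order_tendstoD(2)) auto
  then obtain q0 where q0: "4 * ch.tail q0 * \<kappa> / (e / 4) < \<delta> / 2" by (auto simp: eventually_sequentially)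
  \<comment> \<open>The mass outside the compact set is counted twice, so e / 16 here and mesh e / 8
    below add up to e / 4.\<close>
  obtain K' where K': "linf_compact F K'" "{\<omega>\<in>space P. G \<omega> \<in> K'} \<in> sets P" "measure P {\<omega>\<in>space P. G \<omega> \<in> K'} \<ge> 1 - e / 16"
  proof -
    have "\<forall>\<epsilon>>0. \<exists>K'. linf_compact F K' \<and> {\<omega>\<in>space P. G \<omega> \<in> K'} \<in> sets P \<and> measure P {\<omega>\<in>space P. G \<omega> \<in> K'} \<ge> 1 - \<epsilon>"
      using G unfolding tight_gaussian_def by (elim conjE) assumption
    moreover have "e / 16 > 0" using e by simp
    ultimately show ?thesis using that by blast
  qed
  have e8: "e / 8 > 0" using e by simp
  obtain \<pi> where fin: "finite (\<pi> ` F)" and \<pi>: "\<And>f. f \<in> F \<Longrightarrow> \<pi> f \<in> F" and \<pi>net: "\<And>f. f \<in> F \<Longrightarrow> net q0 (\<pi> f) = net q0 f"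
    and close: "\<And>z f. z \<in> K' \<Longrightarrow> f \<in> F \<Longrightarrow> \<bar>z f - z (\<pi> f)\<bar> \<le> e / 8"
    by (rule compact_refining_partition[OF K'(1) e8 ch.net_fin[of q0]]) blast
  define S where "S = \<pi> ` F"
  have S: "finite S" "S \<subseteq> F" using fin \<pi> by (auto simp: S_def)
  \<comment> \<open>The noise level is chosen after the finite set S, since the smoothing error
    grows with its cardinality.\<close>
  define \<sigma> where "\<sigma> = e / (8 * (real (card S) + 1))"
  have \<sigma>: "\<sigma> > 0" using e by (simp add: \<sigma>_def)
  have S\<sigma>: "2 * real (card S) * \<sigma> \<le> e / 4"
    using e by (simp add: \<sigma>_def divide_simps)
  interpret sm: smoothing S \<sigma> by standard (fact S \<sigma>)+
  have P: "prob_space P" and Gm: "\<And>f. f \<in> F \<Longrightarrow> (\<lambda>\<omega>. G \<omega> f) \<in> borel_measurable P"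
    using conjunct1[OF G[unfolded tight_gaussian_def]]
      bspec[OF conjunct1[OF conjunct2[OF G[unfolded tight_gaussian_def]]]] by blast+
  have Zm: "(\<lambda>\<omega>. Gstar (Cs n) N Y D \<omega> s) \<in> borel_measurable M" if "s \<in> S" for n D s
    unfolding Gstar_eq_bstat cellsum_eq using that S(2) by (intro measurable_bstat cell_fun_meas) auto
  have Gm': "(\<lambda>\<omega>. G \<omega> s) \<in> borel_measurable P" if "s \<in> S" for s by (rule Gm) (use that S(2) in blast)
  have conv: "(\<lambda>n. \<integral>\<omega>. cmod (avg (draws (Cs n)) (\<lambda>D. iexp (\<Sum>s\<in>S. t s * Gstar (Cs n) N Y D \<omega> s))
     - sm.charf P (\<lambda>s \<omega>. G \<omega> s) t) \<partial>M) \<longlonglongrightarrow> 0" for t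
    unfolding sm.charf_def by (rule finite_dim_charf[OF S C_lim C_ratio G])
  define E where "E n \<omega> = (\<integral>x. max 0 (sm.dens P (\<lambda>s \<omega>. G \<omega> s) x - avg (draws (Cs n)) (\<lambda>D. sm.kern (\<lambda>s. Gstar (Cs n) N Y D \<omega> s) x)) \<partial>sm.L)" for n \<omega>
  note smooth = sm.smoothed_convergence[where A="\<lambda>n. draws (Cs n)" and Z="\<lambda>n D s \<omega>. Gstar (Cs n) N Y D \<omega> s" and G="\<lambda>s \<omega>. G \<omega> s",
      OF prob_space_axioms finite_draws draws_nonempty Zm P Gm' conv]
  have E: "integrable M (E n)" for n
    unfolding E_def[abs_def]
    by (rule smooth(1); assumption)
  have E0: "(\<lambda>n. \<integral>\<omega>. E n \<omega> \<partial>M) \<longlonglongrightarrow> 0"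
    unfolding E_def
    by (rule smooth(2); assumption)
  have EH: "\<bar>avg (draws (Cs n)) (\<lambda>D. H (\<lambda>s. Gstar (Cs n) N Y D \<omega> s)) - (\<integral>\<omega>. H (\<lambda>s. G \<omega> s) \<partial>P)\<bar> \<le> 2 * real (card S) * \<sigma> + 2 * E n \<omega>"
    if "sm.bounded_lip H" for H n \<omega>
    unfolding E_def
    by (rule smooth(3); (assumption | rule that))
  have Epos: "E n \<omega> \<ge> 0" for n \<omega> unfolding E_def by (rule Bochner_Integration.integral_nonneg) simp
  have eb0: "modulus_bound C \<omega> \<ge> 0" for C \<omega> unfolding modulus_bound_def by (intro sum_nonneg real_sqrt_ge_zero) simp
  \<comment> \<open>The two exceptional events are measurable and do not mention h. Outside them the
    bound holds for all functionals at once, so no measurability of the supremum enters.\<close>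
  define B1 where "B1 n = {\<omega>\<in>space M. 4 * ch.tail q0 * modulus_bound (Cs n) \<omega> \<ge> e / 4}" for n
  define B2 where "B2 n = {\<omega>\<in>space M. 2 * E n \<omega> \<ge> e / 4}" for n
  have "(\<lambda>n. 2 * (\<integral>\<omega>. E n \<omega> \<partial>M) / (e / 4)) \<longlonglongrightarrow> 2 * 0 / (e / 4)" by (intro tendsto_intros E0) (use e in auto)
  then have ev2: "eventually (\<lambda>n. 2 * (\<integral>\<omega>. E n \<omega> \<partial>M) / (e / 4) < \<delta> / 2) sequentially"
    using \<delta> by (intro order_tendstoD(2)) auto
  show "eventually (\<lambda>n. dist (outer_prob M {\<omega>\<in>space M. (SUP h\<in>BL1 F. \<bar>boot_exp (Cs n) N Y h \<omega> - (\<integral>\<omega>'. h (G \<omega>') \<partial>P)\<bar>) > e}) 0 < \<delta>) sequentially"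
    using ev2 eventually_minC_ge[OF C_lim, of 1]
  proof eventually_elim
    case (elim n)
    then have C: "Cs n i \<ge> 1" for i by blast
    let ?X = "{\<omega>\<in>space M. (SUP h\<in>BL1 F. \<bar>boot_exp (Cs n) N Y h \<omega> - (\<integral>\<omega>'. h (G \<omega>') \<partial>P)\<bar>) > e}"
    note eb = modulus_bound_integral[of "Cs n", OF C]
    have [measurable]: "modulus_bound (Cs n) \<in> borel_measurable M" "E n \<in> borel_measurable M" using eb(1) E by auto
    have Bs: "B1 n \<in> sets M" "B2 n \<in> sets M" unfolding B1_def B2_def by measurable
    have "measure M (B1 n) \<le> (\<integral>\<omega>. 4 * ch.tail q0 * modulus_bound (Cs n) \<omega> \<partial>M) / (e / 4)"
      unfolding B1_def by (rule integral_Markov_inequality_measure[where A="space M"])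
        (use eb(1) ch.tail_nonneg[of q0] eb0 e in auto)
    also have "\<dots> \<le> 4 * ch.tail q0 * \<kappa> / (e / 4)"
      using eb ch.tail_nonneg[of q0] e by (intro divide_right_mono) (auto simp: \<kappa>_def intro!: mult_left_mono)
    finally have m1: "measure M (B1 n) < \<delta> / 2" using q0 by linarith
    have "measure M (B2 n) \<le> (\<integral>\<omega>. 2 * E n \<omega> \<partial>M) / (e / 4)"
      unfolding B2_def by (rule integral_Markov_inequality_measure[where A="space M"])
        (use E Epos e in auto)
    then have m2: "measure M (B2 n) < \<delta> / 2" using elim(1) by simp
    have sub: "?X \<subseteq> B1 n \<union> B2 n"
    proof (rule subsetI, rule ccontr)
      fix \<omega> assume X: "\<omega> \<in> ?X" and nB: "\<omega> \<notin> B1 n \<union> B2 n"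
      then have w: "\<omega> \<in> space M" by simp
      have b1: "4 * ch.tail q0 * modulus_bound (Cs n) \<omega> < e / 4" and b2: "2 * E n \<omega> < e / 4"
        using nB w by (auto simp: B1_def B2_def)
      have "\<bar>boot_exp (Cs n) N Y h \<omega> - (\<integral>\<omega>'. h (G \<omega>') \<partial>P)\<bar> \<le> e" if h: "h \<in> BL1 F" for h
      proof -
        let ?g = "\<lambda>D. Gstar (Cs n) N Y D \<omega>"
        let ?s = "\<lambda>D. sup_abs F (\<lambda>f. ?g D f - ?g D (net q0 f))"
        let ?H = "\<lambda>z. h (\<lambda>f. z (\<pi> f))"
        note eq = equicontinuity[where C="Cs n" and \<omega>=\<omega> and net=net and ?q0.0=q0, OF ch C w net]
        have "\<bar>avg (draws (Cs n)) (\<lambda>D. h (?g D)) - avg (draws (Cs n)) (\<lambda>D. ?H (?g D))\<bar>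
          \<le> avg (draws (Cs n)) (\<lambda>D. \<bar>h (?g D) - ?H (?g D)\<bar>)"
          using norm_avg_le[of "draws (Cs n)" "\<lambda>D. h (?g D) - ?H (?g D)"] by (simp add: avg_diff)
        also have "\<dots> \<le> avg (draws (Cs n)) (\<lambda>D. 2 * ?s D)"
        proof (rule avg_mono)
          fix D
          have "\<bar>h (?g D) - ?H (?g D)\<bar> \<le> supdist F (?g D) (\<lambda>f. ?g D (\<pi> f))"
            using h Gstar_linf[OF w] linf_comp[OF fin, of "?g D"] by (simp add: BL1_def)
          \<comment> \<open>The partition refines the net partition, so f and its representative
            have the same net point, and the triangle inequality passes through it.\<close>
          also have "\<dots> \<le> 2 * ?s D"
          proof (rule supdist_le)
            obtain f where "f \<in> F" using F_ne by auto
            from eq(2)[OF _ _ this, of D] show "0 \<le> 2 * ?s D" by linarith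
            fix f assume f: "f \<in> F"
            have "\<bar>?g D f - ?g D (net q0 f)\<bar> \<le> ?s D" by (rule eq(2)[OF _ _ f]; assumption)
            moreover have "\<bar>?g D (\<pi> f) - ?g D (net q0 (\<pi> f))\<bar> \<le> ?s D" by (rule eq(2)[OF _ _ \<pi>[OF f]]; assumption)
            ultimately show "\<bar>?g D f - ?g D (\<pi> f)\<bar> \<le> 2 * ?s D" unfolding \<pi>net[OF f] by linarith
          qed
          finally show "\<bar>h (?g D) - ?H (?g D)\<bar> \<le> 2 * ?s D" .
        qed
        also have "\<dots> = 2 * avg (draws (Cs n)) ?s" by (rule avg_mult_left)
        also have "\<dots> \<le> 2 * (2 * ch.tail q0 * modulus_bound (Cs n) \<omega>)"
          by (rule mult_left_mono[OF eq(1)]; assumption?) simp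
        finally have 1: "\<bar>avg (draws (Cs n)) (\<lambda>D. h (?g D)) - avg (draws (Cs n)) (\<lambda>D. ?H (?g D))\<bar> < e / 4"
          using b1 by linarith
        have lip: "sm.bounded_lip ?H" unfolding sm.bounded_lip_def
          unfolding S_def by (intro conjI allI BL1_comp(2,3)[OF h F_ne fin \<pi>])
        have 2: "\<bar>avg (draws (Cs n)) (\<lambda>D. ?H (?g D)) - (\<integral>\<omega>. ?H (G \<omega>) \<partial>P)\<bar> \<le> e / 4 + e / 4"
          using EH[OF lip, of n \<omega>] S\<sigma> b2 by simp
        have 3: "\<bar>(\<integral>\<omega>. ?H (G \<omega>) \<partial>P) - (\<integral>\<omega>. h (G \<omega>) \<partial>P)\<bar> \<le> e / 8 + 2 * (e / 16)"
          by (rule tight_partition_approx[OF G h F_ne _ fin \<pi> K'(2,3) close]) (use e in auto)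
        show ?thesis unfolding boot_exp_avg using 1 2 3 by linarith
      qed
      \<comment> \<open>A real supremum over the empty set has no useful value, so the
        least-upper-bound argument needs a member; the zero functional is one.\<close>
      moreover have "BL1 F \<noteq> {}"
      proof -
        obtain f where f: "f \<in> F" using F_ne by auto
        have "0 \<le> supdist F z z'" if "z \<in> linf F" "z' \<in> linf F" for z z'
          using supdist_ge[OF that f] by linarith
        then have "(\<lambda>_. 0) \<in> BL1 F" by (simp add: BL1_def)
        then show ?thesis by auto
      qed
      ultimately have "(SUP h\<in>BL1 F. \<bar>boot_exp (Cs n) N Y h \<omega> - (\<integral>\<omega>'. h (G \<omega>') \<partial>P)\<bar>) \<le> e" by (intro cSUP_least) auto
      then show False using X by simp
    qed
    have "outer_prob M ?X \<le> measure M (B1 n \<union> B2 n)" by (rule outer_prob_le[OF _ sub]) (use Bs in auto)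
    also have "\<dots> \<le> measure M (B1 n) + measure M (B2 n)" by (rule measure_Un_le[OF Bs])
    also have "\<dots> < \<delta>" using m1 m2 by linarith
    finally have "outer_prob M ?X < \<delta>" .
    moreover have "0 \<le> outer_prob M ?X" by (rule outer_prob_nonneg) auto
    ultimately show ?case by (simp only: dist_real_def diff_0_right abs_of_nonneg)
  qed
qed

end

theorem theorem6:
  fixes M :: "'a measure"
    and N :: "('k::finite \<Rightarrow> nat) \<Rightarrow> 'a \<Rightarrow> nat"
    and Y :: "nat \<Rightarrow> ('k \<Rightarrow> nat) \<Rightarrow> 'a \<Rightarrow> real ^ 'l"
    and Ys :: "(real ^ 'l) set"
    and F :: "(real ^ 'l \<Rightarrow> real) set"
    and \<beta> :: real
    and Cs :: "nat \<Rightarrow> 'k \<Rightarrow> nat"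
    and lam :: "'k \<Rightarrow> real"
    and P :: "'b measure"
    and G :: "'b \<Rightarrow> (real ^ 'l \<Rightarrow> real) \<Rightarrow> real"
  assumes M: "prob_space M"
    and N_meas: "\<And>j. N j \<in> measurable M (count_space UNIV)"
    and Y_meas: "\<And>l j. Y l j \<in> borel_measurable M"
    and Y_in: "\<And>l j \<omega>. \<omega> \<in> space M \<Longrightarrow> Y l j \<omega> \<in> Ys"
    and A1: "A1 M N Y"
    and C_lim: "filterlim (\<lambda>n. minC (Cs n)) at_top sequentially"
    and C_ratio: "\<And>i. (\<lambda>n. real (minC (Cs n)) / real (Cs n i)) \<longlonglongrightarrow> lam i"
    and F_meas: "\<And>f. f \<in> F \<Longrightarrow> f \<in> borel_measurable borel"
    and F_pm: "pointwise_measurable Ys F"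
    and A3': "A3' M N Y Ys F \<beta>"
    and G: "tight_gaussian P G F (Kcov M N Y lam)"
  shows "\<forall>\<epsilon>>0. (\<lambda>n. outer_prob M {\<omega>\<in>space M.
            (SUP h\<in>BL1 F. \<bar>boot_exp (Cs n) N Y h \<omega> - (\<integral>\<omega>'. h (G \<omega>') \<partial>P)\<bar>) > \<epsilon>}) \<longlonglongrightarrow> 0"
proof (intro allI impI)
  fix \<epsilon> :: real assume \<epsilon>: "\<epsilon> > 0"
  interpret M: prob_space M by (rule M)
  show "(\<lambda>n. outer_prob M {\<omega>\<in>space M.
            (SUP h\<in>BL1 F. \<bar>boot_exp (Cs n) N Y h \<omega> - (\<integral>\<omega>'. h (G \<omega>') \<partial>P)\<bar>) > \<epsilon>}) \<longlonglongrightarrow> 0"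
  proof (cases "F = {}")
    \<comment> \<open>All paths are at distance 0 from each other, so every functional in BL1 is
      constant and both expectations agree.\<close>
    case True
    interpret P: prob_space P using G by (simp add: tight_gaussian_def)
    have const: "h z = h (\<lambda>_. 0)" if "h \<in> BL1 F" for h z
    proof -
      have "z \<in> linf F" "(\<lambda>_. 0) \<in> linf F" by (auto simp: linf_def True)
      then have "\<bar>h z - h (\<lambda>_. 0)\<bar> \<le> supdist F z (\<lambda>_. 0)" using that by (auto simp: BL1_def)
      then show ?thesis by (simp add: supdist_def True)
    qed
    have "boot_exp (Cs n) N Y h \<omega> - (\<integral>\<omega>'. h (G \<omega>') \<partial>P) = 0" if h: "h \<in> BL1 F" for h n \<omega>
    proof -
      have "boot_exp (Cs n) N Y h \<omega> = avg (draws (Cs n)) (\<lambda>D. h (\<lambda>_. 0))"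
        unfolding boot_exp_avg by (rule avg_cong) (rule const[OF h])
      then have "boot_exp (Cs n) N Y h \<omega> = h (\<lambda>_. 0)" by (simp add: avg_const finite_draws draws_nonempty)
      moreover have "(\<integral>\<omega>'. h (G \<omega>') \<partial>P) = (\<integral>\<omega>'. h (\<lambda>_. 0) \<partial>P)"
        by (rule Bochner_Integration.integral_cong[OF refl]) (rule const[OF h])
      ultimately show ?thesis by (simp add: P.prob_space)
    qed
    moreover have "(\<lambda>_. 0) \<in> BL1 F" by (simp add: BL1_def supdist_def True)
    ultimately have le0: "(SUP h\<in>BL1 F. \<bar>boot_exp (Cs n) N Y h \<omega> - (\<integral>\<omega>'. h (G \<omega>') \<partial>P)\<bar>) \<le> 0" for n \<omega>
      by (intro cSUP_least) auto
    have "\<not> (SUP h\<in>BL1 F. \<bar>boot_exp (Cs n) N Y h \<omega> - (\<integral>\<omega>'. h (G \<omega>') \<partial>P)\<bar>) > \<epsilon>" for n \<omega>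
      using le0[of n \<omega>] \<epsilon> by linarith
    then have "{\<omega>\<in>space M. (SUP h\<in>BL1 F. \<bar>boot_exp (Cs n) N Y h \<omega> - (\<integral>\<omega>'. h (G \<omega>') \<partial>P)\<bar>) > \<epsilon>} = {}" for n
      by blast
    moreover have "outer_prob M {} = 0"
      using outer_prob_le[of "{}" M "{}"] outer_prob_nonneg[of "{}" M] by simp
    ultimately show ?thesis by (simp only: tendsto_const)
  next
    case False
    obtain Fe where Fe: "\<And>f y. f \<in> F \<Longrightarrow> y \<in> Ys \<Longrightarrow> \<bar>f y\<bar> \<le> Fe y" and Fw: "wnorm \<beta> Ys Fe < \<infinity>"
      and R2: "(\<integral>\<^sup>+ \<omega>. ennreal ((\<Sum>l=1..N one_cell \<omega>. (1 + (norm (Y l one_cell \<omega>))\<^sup>2) powr (-\<beta>/2))\<^sup>2) \<partial>M) < \<infinity>"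
      and ent: "(\<integral>\<^sup>+ \<epsilon>\<in>{0<..}. sqrtlog (covnum \<beta> Ys F (\<epsilon> * real_of_ereal (wnorm \<beta> Ys Fe))) \<partial>lborel) < \<infinity>"
      using A3' unfolding A3'_def by blast
    define K where "K = real_of_ereal (wnorm \<beta> Ys Fe)"
    \<comment> \<open>A sample point shows that Ys is nonempty. Otherwise the extended supremum
      \<open>wnorm\<close> would be minus infinity and could not serve as the nonnegative number
      K.\<close>
    obtain \<omega>0 where "\<omega>0 \<in> space M" using M.not_empty by blast
    then have y0: "Y 0 one_cell \<omega>0 \<in> Ys" by (rule Y_in)
    have w0: "0 \<le> wnorm \<beta> Ys Fe" unfolding wnorm_def by (rule SUP_upper2[OF y0]) simp
    have wK: "wnorm \<beta> Ys Fe = ereal K" "K \<ge> 0"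
      using Fw w0 unfolding K_def by (cases "wnorm \<beta> Ys Fe"; simp)+
    define \<rho> where "\<rho> y = (1 + (norm y)\<^sup>2) powr (- \<beta> / 2)" for y :: "real ^ 'l"
    have \<rho>m: "\<rho> \<in> borel_measurable borel" unfolding \<rho>_def[abs_def] by measurable
    obtain net where net: "chain F net K"
      "\<And>q f y. f \<in> F \<Longrightarrow> y \<in> Ys \<Longrightarrow> \<bar>f y - net q f y\<bar> \<le> K / 2 ^ q * \<rho> y"
      using entropy_nets[OF False wK(2) ent[folded K_def]] unfolding \<rho>_def by blast
    interpret X: dissociated_array M N Y
      by (intro dissociated_array.intro dissociated_array_axioms.intro M N_meas Y_meas A1)
    have "bounded_class M N Y Ys F \<rho> K"
    proof (intro bounded_class.intro X.dissociated_array_axioms bounded_class_axioms.intro Y_in False wK(2))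
      show "f \<in> borel_measurable borel" if "f \<in> F" for f by (rule F_meas[OF that])
      show "\<rho> \<in> borel_measurable borel" by (rule \<rho>m)
      show "\<bar>f y\<bar> \<le> K * \<rho> y" if "f \<in> F" "y \<in> Ys" for f y
        using wnorm_le_imp[OF eq_refl[OF wK(1)] that(2)] Fe[OF that] by (simp add: \<rho>_def)
      show "\<rho> y \<ge> 0" for y by (simp add: \<rho>_def)
      have gm: "cell_fun \<rho> \<in> borel_measurable cellspace" by (rule measurable_cell_fun[OF \<rho>m])
      show "integrable M (\<lambda>\<omega>. (cell_fun \<rho> (X.cell one_cell \<omega>))\<^sup>2)"
      proof (rule integrableI_nonneg)
        show "(\<lambda>\<omega>. (cell_fun \<rho> (X.cell one_cell \<omega>))\<^sup>2) \<in> borel_measurable M" using gm by measurable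
        show "(\<integral>\<^sup>+ \<omega>. ennreal ((cell_fun \<rho> (X.cell one_cell \<omega>))\<^sup>2) \<partial>M) < \<infinity>"
          using R2 by (simp add: cell_fun_def X.cell_def \<rho>_def)
      qed simp
    qed
    then interpret B: bounded_class M N Y Ys F \<rho> K .
    show ?thesis by (rule B.bootstrap_consistency[OF net C_lim C_ratio G \<epsilon>])
  qed
qed

end
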